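(* Let $G$ be a group and let $n\geq 3$. Then there is a group homomorphism $\mu_n\colon S_n(G)\to G\wr S_n$ which is a crossed module (for a suitable right action of $G\wr S_n$ on $S_n(G)$). The cokernel of $\mu_n$ is isomorphic to $H_1(G,\mathbb{Z})$ and the kernel of $\mu_n$ is isomorphic to $H_2(G,\mathbb{Z})$.
   Context: For a (possibly noncommutative) group $G$, the group $S_n(G)$ is generated by elements $s_i(a)$, where $1\leq i\leq n-1$ is an integer and $a\in G$, subject to the relations: - $s_i(a)^2=1$ for $a\in G$; - $s_i(a)s_{i+1}(b)s_i(c)=s_{i+1}(a^{-1}cb)\,s_i(a)\,s_{i+1}(b)$ for $a,b,c\in G$; - $s_i(a)s_j(b)=s_j(b)s_i(a)$ for $|i-j|\geq 2$, $a,b\in G$. $G\wr S_n=G^n\rtimes S_n$ is the wreath product, where the symmetric group $S_n$ acts on $G^n$ by permuting the factors. A crossed module is a group homomorphism $\mu\colon M\to N$ together with a right action of $N$ on $M$ (by group automorphisms, written $m^n$) such that $\mu(m^n)=n^{-1}\mu(m)n$ for all $n\in N$, $m\in M$, and $m'^{-1}mm'=m^{\mu(m')}$ for all $m,m'\in M$. The image of $\mu$ is then normal in $N$, and the cokernel is $N/\mathrm{Im}(\mu)$. $H_i(G,\mathbb{Z})$ denotes the integral homology of the group $G$. *)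

theory Defs
  imports "HOL-Algebra.Product_Groups" "HOL-Algebra.Free_Abelian_Groups" "HOL-Algebra.Sym_Groups"
begin

section \<open>Groups given by generators and relations\<close>

text \<open>A word is a list of signed letters; \<open>(True, x)\<close> stands for the generator \<open>x\<close> and
  \<open>(False, x)\<close> for its formal inverse.\<close>

type_synonym 'x word = "(bool \<times> 'x) list"

definition words :: "'x set \<Rightarrow> 'x word set"
  where "words X = lists (UNIV \<times> X)"

inductive_set pres_cong :: "'x set \<Rightarrow> ('x word \<times> 'x word) set \<Rightarrow> ('x word \<times> 'x word) set"
  for X :: "'x set" and R :: "('x word \<times> 'x word) set" where
  refl: "u \<in> words X \<Longrightarrow> (u, u) \<in> pres_cong X R"
| sym: "(u, v) \<in> pres_cong X R \<Longrightarrow> (v, u) \<in> pres_cong X R"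
| trans: "(u, v) \<in> pres_cong X R \<Longrightarrow> (v, w) \<in> pres_cong X R \<Longrightarrow> (u, w) \<in> pres_cong X R"
| append: "(u, u') \<in> pres_cong X R \<Longrightarrow> (v, v') \<in> pres_cong X R \<Longrightarrow> (u @ v, u' @ v') \<in> pres_cong X R"
| cancel: "x \<in> X \<Longrightarrow> ([(b, x), (\<not> b, x)], []) \<in> pres_cong X R"
| relator: "(u, v) \<in> R \<Longrightarrow> u \<in> words X \<Longrightarrow> v \<in> words X \<Longrightarrow> (u, v) \<in> pres_cong X R"

definition presented_group :: "'x set \<Rightarrow> ('x word \<times> 'x word) set \<Rightarrow> 'x word set monoid"
  where "presented_group X R =
    \<lparr>carrier = words X // pres_cong X R,
     monoid.mult = (\<lambda>A B. \<Union>u\<in>A. \<Union>v\<in>B. pres_cong X R `` {u @ v}),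
     one = pres_cong X R `` {[]}\<rparr>"


section \<open>The group \<open>S\<^sub>n(G)\<close>\<close>

text \<open>The pair \<open>(i, a)\<close> is the generator \<open>s\<^sub>i(a)\<close>.\<close>

definition Sn_gens :: "('a, 'b) monoid_scheme \<Rightarrow> nat \<Rightarrow> (nat \<times> 'a) set"
  where "Sn_gens G n = {(i, a). 1 \<le> i \<and> i + 1 \<le> n \<and> a \<in> carrier G}"

abbreviation s_word :: "nat \<Rightarrow> 'a \<Rightarrow> (nat \<times> 'a) word"
  where "s_word i a \<equiv> [(True, (i, a))]"

definition Sn_rels :: "('a, 'b) monoid_scheme \<Rightarrow> nat \<Rightarrow> ((nat \<times> 'a) word \<times> (nat \<times> 'a) word) set"
  where "Sn_rels G n =
    {(s_word i a @ s_word i a, []) | i a. (i, a) \<in> Sn_gens G n} \<union>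
    {(s_word i a @ s_word (i + 1) b @ s_word i c,
      s_word (i + 1) (inv\<^bsub>G\<^esub> a \<otimes>\<^bsub>G\<^esub> c \<otimes>\<^bsub>G\<^esub> b) @ s_word i a @ s_word (i + 1) b) | i a b c.
      (i, a) \<in> Sn_gens G n \<and> (i + 1, b) \<in> Sn_gens G n \<and> (i, c) \<in> Sn_gens G n} \<union>
    {(s_word i a @ s_word j b, s_word j b @ s_word i a) | i j a b.
      (i, a) \<in> Sn_gens G n \<and> (j, b) \<in> Sn_gens G n \<and> (i + 2 \<le> j \<or> j + 2 \<le> i)}"

definition Sn_group :: "('a, 'b) monoid_scheme \<Rightarrow> nat \<Rightarrow> (nat \<times> 'a) word set monoid"
  where "Sn_group G n = presented_group (Sn_gens G n) (Sn_rels G n)"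


section \<open>Wreath products with symmetric groups\<close>

definition semidirect_product ::
  "('k, 'c) monoid_scheme \<Rightarrow> ('h, 'd) monoid_scheme \<Rightarrow> ('h \<Rightarrow> 'k \<Rightarrow> 'k) \<Rightarrow> ('k \<times> 'h) monoid"
  where "semidirect_product K H \<phi> =
    \<lparr>carrier = carrier K \<times> carrier H,
     monoid.mult = (\<lambda>(k, h) (k', h'). (k \<otimes>\<^bsub>K\<^esub> \<phi> h k', h \<otimes>\<^bsub>H\<^esub> h')),
     one = (\<one>\<^bsub>K\<^esub>, \<one>\<^bsub>H\<^esub>)\<rparr>"

text \<open>The inverse permutation makes \<open>permute_factors\<close> a left action, as multiplication in
  \<^const>\<open>sym_group\<close> is composition of functions.\<close>

definition permute_factors :: "nat \<Rightarrow> (nat \<Rightarrow> nat) \<Rightarrow> (nat \<Rightarrow> 'a) \<Rightarrow> nat \<Rightarrow> 'a"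
  where "permute_factors n \<sigma> f = (\<lambda>i\<in>{1..n}. f (inv_into UNIV \<sigma> i))"

definition wreath_product ::
  "('a, 'b) monoid_scheme \<Rightarrow> nat \<Rightarrow> ((nat \<Rightarrow> 'a) \<times> (nat \<Rightarrow> nat)) monoid"
  where "wreath_product G n =
    semidirect_product (product_group {1..n} (\<lambda>_. G)) (sym_group n) (permute_factors n)"


section \<open>Crossed modules\<close>

text \<open>\<open>act n m\<close> is the right action, usually written \<open>m\<^sup>n\<close>.\<close>

locale crossed_module = group_hom M N \<mu>
  for M :: "('m, 'c) monoid_scheme" and N :: "('n, 'd) monoid_scheme" and \<mu> :: "'m \<Rightarrow> 'n" +
  fixes act :: "'n \<Rightarrow> 'm \<Rightarrow> 'm"
  assumes act_auto: "n \<in> carrier N \<Longrightarrow> act n \<in> iso M M"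
    and act_one: "m \<in> carrier M \<Longrightarrow> act \<one>\<^bsub>N\<^esub> m = m"
    and act_mult: "n \<in> carrier N \<Longrightarrow> n' \<in> carrier N \<Longrightarrow> m \<in> carrier M \<Longrightarrow>
      act (n \<otimes>\<^bsub>N\<^esub> n') m = act n' (act n m)"
    and equivariant: "n \<in> carrier N \<Longrightarrow> m \<in> carrier M \<Longrightarrow>
      \<mu> (act n m) = inv\<^bsub>N\<^esub> n \<otimes>\<^bsub>N\<^esub> \<mu> m \<otimes>\<^bsub>N\<^esub> n"
    and peiffer: "m \<in> carrier M \<Longrightarrow> m' \<in> carrier M \<Longrightarrow>
      inv\<^bsub>M\<^esub> m' \<otimes>\<^bsub>M\<^esub> m \<otimes>\<^bsub>M\<^esub> m' = act (\<mu> m') m"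

definition kernel_group ::
  "('m, 'c) monoid_scheme \<Rightarrow> ('n, 'd) monoid_scheme \<Rightarrow> ('m \<Rightarrow> 'n) \<Rightarrow> ('m, 'c) monoid_scheme"
  where "kernel_group M N \<mu> = M\<lparr>carrier := kernel M N \<mu>\<rparr>"

definition cokernel_group ::
  "('m, 'c) monoid_scheme \<Rightarrow> ('n, 'd) monoid_scheme \<Rightarrow> ('m \<Rightarrow> 'n) \<Rightarrow> 'n set monoid"
  where "cokernel_group M N \<mu> = N Mod (\<mu> ` carrier M)"


section \<open>Integral group homology\<close>

text \<open>The homology of the inhomogeneous bar complex with trivial integer coefficients: the list
  \<open>[g\<^sub>1, \<dots>, g\<^sub>k]\<close> is the bar symbol \<open>[g\<^sub>1|\<dots>|g\<^sub>k]\<close>, and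
  \<open>bar_face G k i\<close> is the \<open>i\<close>-th face, \<open>0 \<le> i \<le> k\<close>. The complex is zero in negative
  degrees, so the boundary vanishes in degree \<open>0\<close>.\<close>

definition bar_chain_group :: "('a, 'b) monoid_scheme \<Rightarrow> nat \<Rightarrow> ('a list \<Rightarrow>\<^sub>0 int) monoid"
  where "bar_chain_group G k = free_Abelian_group {gs. length gs = k \<and> set gs \<subseteq> carrier G}"

definition bar_face :: "('a, 'b) monoid_scheme \<Rightarrow> nat \<Rightarrow> nat \<Rightarrow> 'a list \<Rightarrow> 'a list"
  where "bar_face G k i gs =
    (if i = 0 then tl gs
     else if i = k then butlast gs
     else take (i - 1) gs @ [gs ! (i - 1) \<otimes>\<^bsub>G\<^esub> gs ! i] @ drop (i + 1) gs)"

definition bar_boundary ::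
  "('a, 'b) monoid_scheme \<Rightarrow> nat \<Rightarrow> ('a list \<Rightarrow>\<^sub>0 int) \<Rightarrow> ('a list \<Rightarrow>\<^sub>0 int)"
  where "bar_boundary G k c =
    (if k = 0 then 0
     else frag_extend (\<lambda>gs. \<Sum>i\<le>k. frag_cmul ((- 1) ^ i) (frag_of (bar_face G k i gs))) c)"

definition group_homology :: "('a, 'b) monoid_scheme \<Rightarrow> nat \<Rightarrow> ('a list \<Rightarrow>\<^sub>0 int) set monoid"
  where "group_homology G k =
    kernel_group (bar_chain_group G k) (bar_chain_group G (k - 1)) (bar_boundary G k)
      Mod (bar_boundary G (k + 1) ` carrier (bar_chain_group G (k + 1)))"

end

theory Submission
  imports Defs "HOL-Algebra.Bij"
begin

text \<open>For \<open>i \<noteq> j\<close> the monomial matrix of the transposition \<open>(i j)\<close> with entries \<open>a\<close> and \<open>a\<inverse>\<close> lifts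
  canonically to a symbol in \<open>S\<^sub>n(G)\<close>, and \<open>S\<^sub>n(G)\<close> is presented by these symbols together with their
  conjugation relations. Hence \<open>G \<wr> S\<^sub>n\<close> acts on \<open>S\<^sub>n(G)\<close> by permuting symbols, and the map \<open>\<mu>\<close> from
  symbols to matrices is a crossed module.

  Let \<open>\<Gamma>\<close> be the central extension of \<open>G\<close> by \<open>C\<^sub>2 / B\<^sub>2\<close>, taken from the bar complex, with cocycle
  \<open>[a|b]\<close>. Modulo the diagonal matrices over \<open>C\<^sub>2 / B\<^sub>2\<close> with product one, the symbols over \<open>\<Gamma>\<close> depend
  only on their image over \<open>G\<close>, so \<open>\<mu>\<close> lifts to this quotient of \<open>\<Gamma> \<wr> S\<^sub>n\<close>. The image of the lift is the
  kernel of the determinant to \<open>C\<^sub>1\<close> that is \<open>[g]\<close> on the lift of \<open>g\<close> and the boundary map on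
  \<open>C\<^sub>2 / B\<^sub>2\<close>. This gives the cokernel \<open>H\<^sub>1\<close>, and the kernel \<open>H\<^sub>2\<close> once the lift is known to be injective.

  For injectivity, adjoin to \<open>S\<^sub>n(G)\<close> elements \<open>d(g)\<close> that act on it like the matrix with first diagonal
  entry \<open>g\<close> and whose commutators are prescribed lifts in \<open>S\<^sub>n(G)\<close> of the commutators in \<open>G\<close>. Then
  \<open>d(a) d(b) d(ab)\<inverse>\<close> is central, so \<open>d\<close> extends to \<open>\<Gamma>\<close>, and this recovers an element of
  \<open>ker \<mu>\<close> from its image under the lift.\<close>

section \<open>Presented groups\<close>

text \<open>Adjoining elements \<open>d(g)\<close> could collapse \<open>S\<^sub>n(G)\<close>. This
  is avoided by prescribing only commutators of the \<open>d(g)\<close> and no products: the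
  extension is then by the free abelian group on G, and consistency reduces to one identity for each
  pair \<open>g\<close>, \<open>h\<close>, together with antisymmetry of the prescribed commutators.
  The lift of \<open>[a, b]\<close> is the commutator of \<open>hh 1 2 a\<close>, which lifts the
  diagonal matrix with entries \<open>a\<close>, \<open>a\<inverse>\<close>, with the diagonal
  action of \<open>b\<close>. If t is the symbol (1, 2, 1), this choice makes t d(b) t commute with
  every \<open>d(a)\<close>, as a diagonal entry in position 2 should, and \<open>hh 1 2 a\<close>
  becomes \<open>d(a) t d(a)\<inverse> t\<close>. An element of the kernel is a product of such
  factors, so it equals X t Y t, where X is a product of \<open>d(a)\<close> and Y the product of
  their inverses in the same order. Once Y commutes with t, it depends on XY alone. The hypothesis
  \<open>3 \<le> n\<close> provides a neighbouring generator for the relation \<open>s\<^sub>i(a)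
  s\<^sub>i(c) s\<^sub>i(a) = s\<^sub>i(a c\<inverse> a)\<close>, and a third index for the
  symmetries of the lifted commutators.\<close>

definition pres_cls :: "'x set \<Rightarrow> ('x word \<times> 'x word) set \<Rightarrow> 'x word \<Rightarrow> 'x word set"
  where "pres_cls X R u = pres_cong X R `` {u}"

lemma words_simps [simp]:
  "[] \<in> words X"
  "p # u \<in> words X \<longleftrightarrow> snd p \<in> X \<and> u \<in> words X"
  "u @ v \<in> words X \<longleftrightarrow> u \<in> words X \<and> v \<in> words X"
  by (cases p; auto simp: words_def)+

lemma pres_cong_words:
  assumes "(u, v) \<in> pres_cong X R"
  shows "u \<in> words X \<and> v \<in> words X"
  using assms by induction auto

lemma equiv_pres_cong: "equiv (words X) (pres_cong X R)"
proof (rule equivI)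
  show "refl_on (words X) (pres_cong X R)"
    by (auto simp: refl_on_def intro: pres_cong.refl dest: pres_cong_words)
  show "sym (pres_cong X R)"
    by (auto simp: sym_def intro: pres_cong.sym)
  show "trans (pres_cong X R)"
    by (auto simp: trans_def intro: pres_cong.trans)
  show "pres_cong X R \<subseteq> words X \<times> words X"
    by (auto dest: pres_cong_words)
qed

lemma pres_cls_eq_iff:
  assumes "u \<in> words X" "v \<in> words X"
  shows "pres_cls X R u = pres_cls X R v \<longleftrightarrow> (u, v) \<in> pres_cong X R"
  unfolding pres_cls_def using assms eq_equiv_class_iff[OF equiv_pres_cong] by blast

lemma carrier_presented_group: "carrier (presented_group X R) = pres_cls X R ` words X"
  by (auto simp: presented_group_def quotient_def pres_cls_def)

lemma one_presented_group: "\<one>\<^bsub>presented_group X R\<^esub> = pres_cls X R []"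
  by (simp add: presented_group_def pres_cls_def)

lemma mult_presented_group:
  assumes "u \<in> words X" "v \<in> words X"
  shows "pres_cls X R u \<otimes>\<^bsub>presented_group X R\<^esub> pres_cls X R v = pres_cls X R (u @ v)"
proof -
  have "pres_cls X R (u' @ v') = pres_cls X R (u @ v)"
    if "u' \<in> pres_cls X R u" "v' \<in> pres_cls X R v" for u' v'
  proof -
    have "(u, u') \<in> pres_cong X R" "(v, v') \<in> pres_cong X R"
      using that by (auto simp: pres_cls_def)
    then have "(u @ v, u' @ v') \<in> pres_cong X R"
      by (rule pres_cong.append)
    then show ?thesis
      by (metis pres_cls_eq_iff pres_cong_words)
  qed
  moreover have "u \<in> pres_cls X R u" "v \<in> pres_cls X R v"
    using assms by (auto simp: pres_cls_def intro: pres_cong.refl)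
  ultimately have "(\<Union>u'\<in>pres_cls X R u. \<Union>v'\<in>pres_cls X R v. pres_cls X R (u' @ v')) = pres_cls X R (u @ v)"
    by blast
  then show ?thesis
    by (simp add: presented_group_def flip: pres_cls_def)
qed

definition winv :: "'x word \<Rightarrow> 'x word"
  where "winv u = rev (map (\<lambda>(b, x). (\<not> b, x)) u)"

lemma winv_words [simp]: "winv u \<in> words X \<longleftrightarrow> u \<in> words X"
  by (induction u) (auto simp: winv_def)

lemma winv_cancel: "u \<in> words X \<Longrightarrow> (winv u @ u, []) \<in> pres_cong X R"
proof (induction u)
  case Nil
  then show ?case by (auto simp: winv_def intro: pres_cong.refl)
next
  case (Cons p u)
  obtain b x where p: "p = (b, x)" by (cases p)
  have x: "x \<in> X" and u: "u \<in> words X" using Cons.prems p by auto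
  have "([(\<not> b, x), (b, x)], []) \<in> pres_cong X R"
    using pres_cong.cancel[OF x, of "\<not> b"] by simp
  then have "(winv u @ [(\<not> b, x), (b, x)] @ u, winv u @ [] @ u) \<in> pres_cong X R"
    by (intro pres_cong.append) (auto simp: u intro: pres_cong.refl)
  with Cons.IH[OF u] show ?case
    by (auto simp: winv_def p intro: pres_cong.trans)
qed

lemma group_presented_group: "group (presented_group X R)"
proof (rule groupI)
  fix x assume "x \<in> carrier (presented_group X R)"
  then obtain u where u: "u \<in> words X" "x = pres_cls X R u"
    by (auto simp: carrier_presented_group)
  then show "\<one>\<^bsub>presented_group X R\<^esub> \<otimes>\<^bsub>presented_group X R\<^esub> x = x"
    by (simp add: one_presented_group mult_presented_group)
  have "pres_cls X R (winv u) \<otimes>\<^bsub>presented_group X R\<^esub> x = \<one>\<^bsub>presented_group X R\<^esub>"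
    using u by (simp add: one_presented_group mult_presented_group pres_cls_eq_iff winv_cancel)
  then show "\<exists>y\<in>carrier (presented_group X R). y \<otimes>\<^bsub>presented_group X R\<^esub> x = \<one>\<^bsub>presented_group X R\<^esub>"
    using u by (auto simp: carrier_presented_group)
qed (auto simp: carrier_presented_group one_presented_group mult_presented_group)

lemma pres_cls_in_carrier: "u \<in> words X \<Longrightarrow> pres_cls X R u \<in> carrier (presented_group X R)"
  by (auto simp: carrier_presented_group)

lemma inv_presented_group_gen:
  assumes "x \<in> X"
  shows "inv\<^bsub>presented_group X R\<^esub> (pres_cls X R [(True, x)]) = pres_cls X R [(False, x)]"
proof -
  interpret group "presented_group X R" by (rule group_presented_group)
  have "pres_cls X R [(False, x)] \<otimes>\<^bsub>presented_group X R\<^esub> pres_cls X R [(True, x)] = \<one>\<^bsub>presented_group X R\<^esub>"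
    using assms pres_cong.cancel[OF assms, of False]
    by (simp add: mult_presented_group one_presented_group pres_cls_eq_iff)
  then show ?thesis
    using assms by (intro inv_equality) (auto intro: pres_cls_in_carrier)
qed

lemma generate_presented_group:
  "carrier (presented_group X R) = generate (presented_group X R) ((\<lambda>x. pres_cls X R [(True, x)]) ` X)"
    (is "_ = generate ?P ?S")
proof
  interpret group ?P by (rule group_presented_group)
  have "pres_cls X R u \<in> generate ?P ?S" if "u \<in> words X" for u
    using that
  proof (induction u)
    case Nil
    then show ?case using generate.one[of ?P ?S] by (simp add: one_presented_group)
  next
    case (Cons p u)
    obtain b x where p: "p = (b, x)" by (cases p)
    have x: "x \<in> X" and u: "u \<in> words X" using Cons.prems p by auto
    have "pres_cls X R [p] \<in> generate ?P ?S"
    proof (cases b)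
      case True
      then show ?thesis using p x by (auto intro: generate.incl)
    next
      case False
      have "inv\<^bsub>?P\<^esub> (pres_cls X R [(True, x)]) \<in> generate ?P ?S"
        using x by (auto intro: generate.inv)
      then show ?thesis using False p x by (simp add: inv_presented_group_gen)
    qed
    then have "pres_cls X R [p] \<otimes>\<^bsub>?P\<^esub> pres_cls X R u \<in> generate ?P ?S"
      using Cons.IH[OF u] by (rule generate.eng)
    then show ?case using Cons.prems u by (simp add: mult_presented_group)
  qed
  then show "carrier ?P \<subseteq> generate ?P ?S"
    by (auto simp: carrier_presented_group)
  show "generate ?P ?S \<subseteq> carrier ?P"
    by (rule generate_incl) (auto intro: pres_cls_in_carrier)
qed

primrec word_eval :: "('h, 'd) monoid_scheme \<Rightarrow> ('x \<Rightarrow> 'h) \<Rightarrow> 'x word \<Rightarrow> 'h" where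
  "word_eval H \<phi> [] = \<one>\<^bsub>H\<^esub>"
| "word_eval H \<phi> (p # u) = (if fst p then \<phi> (snd p) else inv\<^bsub>H\<^esub> \<phi> (snd p)) \<otimes>\<^bsub>H\<^esub> word_eval H \<phi> u"

lemma (in group) word_eval_closed:
  assumes "\<phi> \<in> X \<rightarrow> carrier G" "u \<in> words X"
  shows "word_eval G \<phi> u \<in> carrier G"
  using assms by (induction u) auto

lemma (in group) word_eval_append:
  assumes "\<phi> \<in> X \<rightarrow> carrier G" "u \<in> words X" "v \<in> words X"
  shows "word_eval G \<phi> (u @ v) = word_eval G \<phi> u \<otimes> word_eval G \<phi> v"
  using assms(2)
proof (induction u)
  case Nil
  then show ?case using word_eval_closed[OF assms(1,3)] by simp
next
  case (Cons p u)
  have "snd p \<in> X" "u \<in> words X" using Cons.prems by auto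
  then have "\<phi> (snd p) \<in> carrier G" "word_eval G \<phi> u \<in> carrier G" "word_eval G \<phi> v \<in> carrier G"
    using word_eval_closed[OF assms(1)] assms by auto
  then show ?case
    using Cons.IH \<open>u \<in> words X\<close> by (simp add: m_assoc)
qed

lemma (in group) presented_group_universal:
  assumes \<phi>: "\<phi> \<in> X \<rightarrow> carrier G"
    and rel: "\<And>u v. (u, v) \<in> R \<Longrightarrow> u \<in> words X \<Longrightarrow> v \<in> words X \<Longrightarrow> word_eval G \<phi> u = word_eval G \<phi> v"
  obtains \<Phi> where "\<Phi> \<in> hom (presented_group X R) G"
    "\<And>x. x \<in> X \<Longrightarrow> \<Phi> (pres_cls X R [(True, x)]) = \<phi> x"
proof -
  have respects: "word_eval G \<phi> u = word_eval G \<phi> v" if "(u, v) \<in> pres_cong X R" for u v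
    using that
  proof induction
    case (append u u' v v')
    then show ?case
      by (metis \<phi> pres_cong_words word_eval_append)
  next
    case (cancel x b)
    then have "\<phi> x \<in> carrier G" using \<phi> by auto
    then show ?case by (cases b) auto
  qed (auto intro: rel)
  define \<Phi> where "\<Phi> A = word_eval G \<phi> (SOME u. u \<in> A)" for A
  have \<Phi>: "\<Phi> (pres_cls X R u) = word_eval G \<phi> u" if "u \<in> words X" for u
  proof -
    have "u \<in> pres_cls X R u"
      using that by (auto simp: pres_cls_def intro: pres_cong.refl)
    then have "(SOME u'. u' \<in> pres_cls X R u) \<in> pres_cls X R u"
      by (rule someI)
    then show ?thesis
      unfolding \<Phi>_def using respects by (auto simp: pres_cls_def)
  qed
  show thesis
  proof
    show "\<Phi> \<in> hom (presented_group X R) G"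
      by (rule homI)
        (auto simp: carrier_presented_group \<Phi> mult_presented_group
          word_eval_closed[OF \<phi>] word_eval_append[OF \<phi>])
    show "\<Phi> (pres_cls X R [(True, x)]) = \<phi> x" if "x \<in> X" for x
    proof -
      have "\<phi> x \<in> carrier G" using \<phi> that by auto
      then show ?thesis using that by (simp add: \<Phi>)
    qed
  qed
qed

lemma hom_eq_on_generate:
  assumes "group G" "group H" "f \<in> hom G H" "h \<in> hom G H" "S \<subseteq> carrier G"
    and eq: "\<And>x. x \<in> S \<Longrightarrow> f x = h x"
    and x: "x \<in> generate G S"
  shows "f x = h x"
proof -
  interpret G: group G by fact
  interpret f: group_hom G H f by (simp add: assms group_hom_axioms_def group_hom_def)
  interpret h: group_hom G H h by (simp add: assms group_hom_axioms_def group_hom_def)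
  from x show ?thesis
  proof induction
    case (inv y)
    then show ?case using assms(5) eq by (metis f.hom_inv h.hom_inv subsetD)
  next
    case (eng y z)
    then show ?case
      using G.generate_in_carrier[OF assms(5)] by (metis f.hom_mult h.hom_mult)
  qed (auto simp: eq)
qed

section \<open>Monomial symbols\<close>

lemma carrier_wreath:
  "w \<in> carrier (wreath_product G n) \<longleftrightarrow>
    fst w \<in> {1..n} \<rightarrow>\<^sub>E carrier G \<and> snd w permutes {1..n}"
  by (cases w) (simp add: wreath_product_def semidirect_product_def sym_group_carrier)

lemma one_wreath: "\<one>\<^bsub>wreath_product G n\<^esub> = (\<lambda>i\<in>{1..n}. \<one>\<^bsub>G\<^esub>, id)"
  by (simp add: wreath_product_def semidirect_product_def sym_group_one)

lemma permutes_bij_inv: "\<sigma> permutes S \<Longrightarrow> inv_into UNIV \<sigma> (\<sigma> i) = i" "\<sigma> permutes S \<Longrightarrow> \<sigma> (inv_into UNIV \<sigma> i) = i"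
  by (simp_all add: permutes_inverses)

lemma permutes_inv_in [simp]: "\<sigma> permutes S \<Longrightarrow> inv_into UNIV \<sigma> i \<in> S \<longleftrightarrow> i \<in> S"
  by (meson permutes_in_image permutes_inv)

lemma mult_wreath:
  "(g, \<sigma>) \<otimes>\<^bsub>wreath_product G n\<^esub> (h, \<tau>) =
    (\<lambda>i\<in>{1..n}. g i \<otimes>\<^bsub>G\<^esub> h (inv_into UNIV \<sigma> i), \<sigma> \<circ> \<tau>)"
  by (auto simp: wreath_product_def semidirect_product_def sym_group_mult permute_factors_def)

lemma group_wreath:
  assumes "group G"
  shows "group (wreath_product G n)"
proof -
  interpret G: group G by fact
  show ?thesis
  proof (rule groupI)
    fix w w' w'' assume "w \<in> carrier (wreath_product G n)" "w' \<in> carrier (wreath_product G n)"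
      "w'' \<in> carrier (wreath_product G n)"
    then obtain g \<sigma> g' \<sigma>' g'' \<sigma>'' where *: "w = (g, \<sigma>)" "w' = (g', \<sigma>')" "w'' = (g'', \<sigma>'')"
      and g: "g \<in> {1..n} \<rightarrow>\<^sub>E carrier G" "g' \<in> {1..n} \<rightarrow>\<^sub>E carrier G" "g'' \<in> {1..n} \<rightarrow>\<^sub>E carrier G"
      and s: "\<sigma> permutes {1..n}" "\<sigma>' permutes {1..n}" "\<sigma>'' permutes {1..n}"
      by (cases w; cases w'; cases w'') (auto simp: carrier_wreath)
    have inv: "inv_into UNIV (\<sigma> \<circ> \<sigma>') i = inv_into UNIV \<sigma>' (inv_into UNIV \<sigma> i)" for i
      using s by (simp add: o_inv_distrib permutes_bij)
    show "w \<otimes>\<^bsub>wreath_product G n\<^esub> w' \<otimes>\<^bsub>wreath_product G n\<^esub> w'' =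
      w \<otimes>\<^bsub>wreath_product G n\<^esub> (w' \<otimes>\<^bsub>wreath_product G n\<^esub> w'')"
      unfolding * mult_wreath
    proof (intro prod.inject[THEN iffD2] conjI ext)
      fix i
      show "(\<lambda>i\<in>{1..n}. (\<lambda>i\<in>{1..n}. g i \<otimes>\<^bsub>G\<^esub> g' (inv_into UNIV \<sigma> i)) i \<otimes>\<^bsub>G\<^esub> g'' (inv_into UNIV (\<sigma> \<circ> \<sigma>') i)) i =
        (\<lambda>i\<in>{1..n}. g i \<otimes>\<^bsub>G\<^esub> (\<lambda>i\<in>{1..n}. g' i \<otimes>\<^bsub>G\<^esub> g'' (inv_into UNIV \<sigma>' i)) (inv_into UNIV \<sigma> i)) i"
      proof (cases "i \<in> {1..n}")
        case True
        then have "inv_into UNIV \<sigma> i \<in> {1..n}" "inv_into UNIV \<sigma>' (inv_into UNIV \<sigma> i) \<in> {1..n}"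
          using s by (simp_all only: permutes_inv_in)
        then show ?thesis
          using True g by (simp add: inv PiE_iff G.m_assoc)
      qed auto
    qed (auto simp: comp_assoc)
  next
    fix w assume "w \<in> carrier (wreath_product G n)"
    then obtain g \<sigma> where w: "w = (g, \<sigma>)" "g \<in> {1..n} \<rightarrow>\<^sub>E carrier G" "\<sigma> permutes {1..n}"
      by (cases w) (auto simp: carrier_wreath)
    show "\<one>\<^bsub>wreath_product G n\<^esub> \<otimes>\<^bsub>wreath_product G n\<^esub> w = w"
      using w by (auto simp: one_wreath mult_wreath PiE_iff extensional_def fun_eq_iff)
    have "(\<lambda>i\<in>{1..n}. inv\<^bsub>G\<^esub> g (\<sigma> i), inv_into UNIV \<sigma>) \<otimes>\<^bsub>wreath_product G n\<^esub> w = \<one>\<^bsub>wreath_product G n\<^esub>"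
    proof -
      have "\<sigma> i \<in> {1..n}" if "i \<in> {1..n}" for i
        using that w(3) by (simp only: permutes_in_image)
      then show ?thesis
        using w by (auto simp: one_wreath mult_wreath PiE_iff fun_eq_iff G.l_inv
            permutes_inv_inv permutes_inv_o)
    qed
    moreover have "(\<lambda>i\<in>{1..n}. inv\<^bsub>G\<^esub> g (\<sigma> i), inv_into UNIV \<sigma>) \<in> carrier (wreath_product G n)"
    proof -
      have "\<sigma> i \<in> {1..n}" if "i \<in> {1..n}" for i
        using that w(3) by (simp only: permutes_in_image)
      then show ?thesis
        using w by (auto simp: carrier_wreath PiE_iff permutes_inv)
    qed
    ultimately show "\<exists>v\<in>carrier (wreath_product G n). v \<otimes>\<^bsub>wreath_product G n\<^esub> w = \<one>\<^bsub>wreath_product G n\<^esub>"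
      by blast
  next
    fix w w' assume "w \<in> carrier (wreath_product G n)" "w' \<in> carrier (wreath_product G n)"
    then show "w \<otimes>\<^bsub>wreath_product G n\<^esub> w' \<in> carrier (wreath_product G n)"
    proof (cases w; cases w')
      fix g \<sigma> h \<tau> assume *: "w = (g, \<sigma>)" "w' = (h, \<tau>)" "w \<in> carrier (wreath_product G n)" "w' \<in> carrier (wreath_product G n)"
      then have "inv_into UNIV \<sigma> i \<in> {1..n}" if "i \<in> {1..n}" for i
        using that by (auto simp only: carrier_wreath permutes_inv_in snd_conv)
      then show ?thesis using *
        by (auto simp: carrier_wreath mult_wreath PiE_iff permutes_compose)
    qed
  qed (auto simp: carrier_wreath one_wreath permutes_id)
qed

text \<open>The symbol \<open>(i, j, a)\<close> stands for the monomial matrix of the transposition \<open>(i j)\<close> with entry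
  \<open>a\<close> in position \<open>(i, j)\<close> and \<open>a\<inverse>\<close> in position \<open>(j, i)\<close>; a pair \<open>(g, \<sigma>)\<close> of the wreath
  product is the monomial matrix with entry \<open>g i\<close> in position \<open>(i, \<sigma>\<inverse> i)\<close>.\<close>

definition symbols :: "('a, 'b) monoid_scheme \<Rightarrow> nat \<Rightarrow> (nat \<times> nat \<times> 'a) set"
  where "symbols G n = {(i, j, a). i \<in> {1..n} \<and> j \<in> {1..n} \<and> i \<noteq> j \<and> a \<in> carrier G}"

definition wsym :: "('a, 'b) monoid_scheme \<Rightarrow> nat \<Rightarrow> nat \<times> nat \<times> 'a \<Rightarrow> (nat \<Rightarrow> 'a) \<times> (nat \<Rightarrow> nat)"
  where "wsym G n = (\<lambda>(i, j, a).
    (\<lambda>k\<in>{1..n}. if k = i then a else if k = j then inv\<^bsub>G\<^esub> a else \<one>\<^bsub>G\<^esub>, transpose i j))"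

text \<open>The formula is dictated by conjugation: \<open>wsym_conj\<close> shows that w times the
  matrix of x equals the matrix of \<open>wact G w x\<close> times w.\<close>

definition wact :: "('a, 'b) monoid_scheme \<Rightarrow> (nat \<Rightarrow> 'a) \<times> (nat \<Rightarrow> nat) \<Rightarrow> nat \<times> nat \<times> 'a \<Rightarrow> nat \<times> nat \<times> 'a"
  where "wact G = (\<lambda>(g, \<sigma>) (i, j, a). (\<sigma> i, \<sigma> j, g (\<sigma> i) \<otimes>\<^bsub>G\<^esub> a \<otimes>\<^bsub>G\<^esub> inv\<^bsub>G\<^esub> g (\<sigma> j)))"

lemma in_symbols [simp]:
  "(i, j, a) \<in> symbols G n \<longleftrightarrow> i \<in> {1..n} \<and> j \<in> {1..n} \<and> i \<noteq> j \<and> a \<in> carrier G"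
  by (simp add: symbols_def)

lemma wact_eq: "wact G (g, \<sigma>) (i, j, a) = (\<sigma> i, \<sigma> j, g (\<sigma> i) \<otimes>\<^bsub>G\<^esub> a \<otimes>\<^bsub>G\<^esub> inv\<^bsub>G\<^esub> g (\<sigma> j))"
  by (simp add: wact_def)

context group
begin

lemma wreath_cases:
  assumes "w \<in> carrier (wreath_product G n)"
  obtains g \<sigma> where "w = (g, \<sigma>)" "g \<in> {1..n} \<rightarrow>\<^sub>E carrier G" "\<sigma> permutes {1..n}"
    "\<And>i. i \<in> {1..n} \<Longrightarrow> g i \<in> carrier G" "\<And>i. i \<in> {1..n} \<Longrightarrow> \<sigma> i \<in> {1..n}" "inj \<sigma>"
proof (rule that)
  show "inj (snd w)"
    using assms permutes_inj by (auto simp: carrier_wreath)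
  show "w = (fst w, snd w)" by simp
  show "\<And>i. i \<in> {1..n} \<Longrightarrow> snd w i \<in> {1..n}"
    using assms by (simp only: carrier_wreath permutes_in_image)
qed (use assms in \<open>auto simp: carrier_wreath\<close>)

lemma wsym_closed [simp]: "x \<in> symbols G n \<Longrightarrow> wsym G n x \<in> carrier (wreath_product G n)"
  by (cases x) (auto simp: wsym_def carrier_wreath permutes_swap_id)

lemma wact_closed:
  assumes "w \<in> carrier (wreath_product G n)" "x \<in> symbols G n"
  shows "wact G w x \<in> symbols G n"
proof -
  obtain i j a where x: "x = (i, j, a)" "i \<in> {1..n}" "j \<in> {1..n}" "i \<noteq> j" "a \<in> carrier G"
    using assms(2) by (cases x) auto
  obtain g \<sigma> where w: "w = (g, \<sigma>)" 
    "\<And>i. i \<in> {1..n} \<Longrightarrow> g i \<in> carrier G" "\<And>i. i \<in> {1..n} \<Longrightarrow> \<sigma> i \<in> {1..n}" "inj \<sigma>"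
    using wreath_cases[OF assms(1)] by metis
  have "\<sigma> i \<noteq> \<sigma> j" using w(4) x(4) by (simp add: inj_eq)
  then show ?thesis
    using x w(2,3) unfolding w(1) x(1) wact_eq in_symbols by blast
qed

lemma wact_one:
  assumes "x \<in> symbols G n"
  shows "wact G \<one>\<^bsub>wreath_product G n\<^esub> x = x"
  using assms by (cases x) (auto simp: one_wreath wact_eq)

lemma wact_mult:
  assumes "w \<in> carrier (wreath_product G n)" "w' \<in> carrier (wreath_product G n)" "x \<in> symbols G n"
  shows "wact G (w \<otimes>\<^bsub>wreath_product G n\<^esub> w') x = wact G w (wact G w' x)"
proof -
  obtain i j a where x: "x = (i, j, a)" "i \<in> {1..n}" "j \<in> {1..n}" "i \<noteq> j" "a \<in> carrier G"
    using assms(3) by (cases x) auto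
  obtain g \<sigma> where w: "w = (g, \<sigma>)" "\<sigma> permutes {1..n}"
    "\<And>i. i \<in> {1..n} \<Longrightarrow> g i \<in> carrier G" "\<And>i. i \<in> {1..n} \<Longrightarrow> \<sigma> i \<in> {1..n}"
    using wreath_cases[OF assms(1)] by metis
  obtain h \<tau> where w': "w' = (h, \<tau>)" "\<tau> permutes {1..n}"
    "\<And>i. i \<in> {1..n} \<Longrightarrow> h i \<in> carrier G" "\<And>i. i \<in> {1..n} \<Longrightarrow> \<tau> i \<in> {1..n}"
    using wreath_cases[OF assms(2)] by metis
  have 1: "\<sigma> (\<tau> i) \<in> {1..n}" "\<sigma> (\<tau> j) \<in> {1..n}" "\<tau> i \<in> {1..n}" "\<tau> j \<in> {1..n}"
    using w w' x by blast+
  then have "g (\<sigma> (\<tau> i)) \<in> carrier G" "g (\<sigma> (\<tau> j)) \<in> carrier G" "h (\<tau> i) \<in> carrier G" "h (\<tau> j) \<in> carrier G"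
    using w w' by blast+
  then show ?thesis
    using x 1 by (simp add: w(1) w'(1) x(1) mult_wreath wact_eq permutes_bij_inv[OF w(2)] m_assoc inv_mult_group)
qed

lemma wsym_conj:
  assumes "w \<in> carrier (wreath_product G n)" "x \<in> symbols G n"
  shows "w \<otimes>\<^bsub>wreath_product G n\<^esub> wsym G n x = wsym G n (wact G w x) \<otimes>\<^bsub>wreath_product G n\<^esub> w"
proof -
  obtain i j a where x: "x = (i, j, a)" "i \<in> {1..n}" "j \<in> {1..n}" "i \<noteq> j" "a \<in> carrier G"
    using assms(2) by (cases x) auto
  obtain g \<sigma> where w: "w = (g, \<sigma>)" "\<sigma> permutes {1..n}"
    "\<And>i. i \<in> {1..n} \<Longrightarrow> g i \<in> carrier G" "\<And>i. i \<in> {1..n} \<Longrightarrow> \<sigma> i \<in> {1..n}" "inj \<sigma>"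
    using wreath_cases[OF assms(1)] by metis
  have perm: "\<sigma> \<circ> transpose i j = transpose (\<sigma> i) (\<sigma> j) \<circ> \<sigma>"
    using w(5) by (auto simp: fun_eq_iff transpose_def inj_eq)
  have eq: "inv_into UNIV \<sigma> k = i \<longleftrightarrow> k = \<sigma> i" for k i
    using permutes_bij_inv[OF w(2)] by metis
  have s: "\<sigma> i \<in> {1..n}" "\<sigma> j \<in> {1..n}" "\<sigma> i \<noteq> \<sigma> j"
    using w x by (auto simp: inj_eq simp del: atLeastAtMost_iff)
  have gs: "g (\<sigma> i) \<in> carrier G" "g (\<sigma> j) \<in> carrier G"
    using s w(3) by blast+
  show ?thesis
    unfolding w(1) x(1) wact_eq wsym_def prod.case mult_wreath
  proof (intro prod.inject[THEN iffD2] conjI ext perm)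
    fix k
    show "(\<lambda>k\<in>{1..n}. g k \<otimes> (\<lambda>k\<in>{1..n}. if k = i then a else if k = j then inv a else \<one>) (inv_into UNIV \<sigma> k)) k =
      (\<lambda>k\<in>{1..n}. (\<lambda>k\<in>{1..n}. if k = \<sigma> i then g (\<sigma> i) \<otimes> a \<otimes> inv g (\<sigma> j)
        else if k = \<sigma> j then inv (g (\<sigma> i) \<otimes> a \<otimes> inv g (\<sigma> j)) else \<one>) k \<otimes> g (inv_into UNIV (transpose (\<sigma> i) (\<sigma> j)) k)) k"
    proof (cases "k \<in> {1..n}")
      case True
      then have "inv_into UNIV \<sigma> k \<in> {1..n}" using w(2) by (simp only: permutes_inv_in)
      moreover have gk: "g k \<in> carrier G" using True w by blast
      moreover have "inv_into UNIV (transpose (\<sigma> i) (\<sigma> j)) = transpose (\<sigma> i) (\<sigma> j)"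
        by simp
      moreover have "g (\<sigma> i) \<otimes> a \<otimes> inv g (\<sigma> j) \<otimes> g (\<sigma> j) = g (\<sigma> i) \<otimes> a"
        "inv (g (\<sigma> i) \<otimes> a \<otimes> inv g (\<sigma> j)) \<otimes> g (\<sigma> i) = g (\<sigma> j) \<otimes> inv a"
        using gs x(5) by (simp_all add: m_assoc inv_mult_group)
      ultimately have facts: "g k \<in> carrier G" "inv_into UNIV \<sigma> k \<in> {1..n}" "inv_into UNIV (transpose (\<sigma> i) (\<sigma> j)) = transpose (\<sigma> i) (\<sigma> j)"
        "g (\<sigma> i) \<otimes> a \<otimes> inv g (\<sigma> j) \<otimes> g (\<sigma> j) = g (\<sigma> i) \<otimes> a"
        "inv (g (\<sigma> i) \<otimes> a \<otimes> inv g (\<sigma> j)) \<otimes> g (\<sigma> i) = g (\<sigma> j) \<otimes> inv a" by blast+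
      consider "k = \<sigma> i" "inv_into UNIV \<sigma> k = i" | "k = \<sigma> j" "inv_into UNIV \<sigma> k = j"
        | "k \<noteq> \<sigma> i" "k \<noteq> \<sigma> j" "inv_into UNIV \<sigma> k \<noteq> i" "inv_into UNIV \<sigma> k \<noteq> j"
        using eq by blast
      then show ?thesis
        using True x(4) s(3) facts
        by cases (simp_all del: atLeastAtMost_iff)
    next
      case False
      then show ?thesis by (simp only: restrict_apply if_False)
    qed
  qed (use perm in \<open>simp only: fun_eq_iff\<close>)
qed

lemma wsym_square:
  assumes "x \<in> symbols G n"
  shows "wsym G n x \<otimes>\<^bsub>wreath_product G n\<^esub> wsym G n x = \<one>\<^bsub>wreath_product G n\<^esub>"
  using assms by (cases x) (auto simp: wsym_def one_wreath mult_wreath fun_eq_iff transpose_def)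

end

section \<open>Symbol systems: the relations among monomial transpositions\<close>

definition symbol_swap :: "('a, 'b) monoid_scheme \<Rightarrow> nat \<times> nat \<times> 'a \<Rightarrow> nat \<times> nat \<times> 'a"
  where "symbol_swap G = (\<lambda>(i, j, a). (j, i, inv\<^bsub>G\<^esub> a))"

text \<open>These are the relations that the monomial matrices themselves satisfy, with conjugation
  expressed through \<open>wact\<close> so that they make sense in any target group. They are
  instantiated by the wreath product, by \<open>S\<^sub>n(G)\<close>, by twisted copies of it, and
  by a quotient of the wreath product over the extension.\<close>

locale symbol_system = G: group G + H: group H
  for G :: "('a, 'b) monoid_scheme" and H :: "('h, 'c) monoid_scheme" (structure) +
  fixes n :: nat and sym :: "nat \<times> nat \<times> 'a \<Rightarrow> 'h"
  assumes sym_closed [simp]: "x \<in> symbols G n \<Longrightarrow> sym x \<in> carrier H"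
    and sym_swap: "x \<in> symbols G n \<Longrightarrow> sym (symbol_swap G x) = sym x"
    and sym_square: "x \<in> symbols G n \<Longrightarrow> sym x \<otimes> sym x = \<one>"
    and sym_conj: "x \<in> symbols G n \<Longrightarrow> y \<in> symbols G n \<Longrightarrow>
      sym x \<otimes> sym y = sym (wact G (wsym G n x) y) \<otimes> sym x"
begin

lemma sym_closed' [simp]:
  "i \<in> {1..n} \<Longrightarrow> j \<in> {1..n} \<Longrightarrow> i \<noteq> j \<Longrightarrow> a \<in> carrier G \<Longrightarrow> sym (i, j, a) \<in> carrier H"
  by (rule sym_closed) simp

lemma sym_swap':
  assumes "i \<in> {1..n}" "j \<in> {1..n}" "i \<noteq> j" "a \<in> carrier G"
  shows "sym (j, i, a) = sym (i, j, inv\<^bsub>G\<^esub> a)"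
  using sym_swap[of "(j, i, a)"] assms by (auto simp: symbol_swap_def)

lemma sym_square_cancel:
  assumes "x \<in> symbols G n" "h \<in> carrier H"
  shows "sym x \<otimes> (sym x \<otimes> h) = h"
  using assms by (simp add: sym_square flip: H.m_assoc)

lemma inv_sym: "x \<in> symbols G n \<Longrightarrow> inv sym x = sym x"
  by (simp add: H.inv_equality sym_square)

context
  fixes i j k
  assumes ijk: "i \<in> {1..n}" "j \<in> {1..n}" "k \<in> {1..n}" "i \<noteq> j" "i \<noteq> k" "j \<noteq> k"
begin

lemma sym_conj_jk: "a \<in> carrier G \<Longrightarrow> b \<in> carrier G \<Longrightarrow>
    sym (i, j, a) \<otimes> sym (j, k, b) = sym (i, k, a \<otimes>\<^bsub>G\<^esub> b) \<otimes> sym (i, j, a)"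
  using ijk by (subst sym_conj) (auto simp: wsym_def wact_eq transpose_def)

lemma sym_conj_ik: "a \<in> carrier G \<Longrightarrow> b \<in> carrier G \<Longrightarrow>
    sym (i, j, a) \<otimes> sym (i, k, b) = sym (j, k, inv\<^bsub>G\<^esub> a \<otimes>\<^bsub>G\<^esub> b) \<otimes> sym (i, j, a)"
  using ijk by (subst sym_conj) (auto simp: wsym_def wact_eq transpose_def)

end

text \<open>Conjugation exchanges the two indices and gives (j, i,
  \<open>a\<inverse> c a\<inverse>\<close>); swapping back inverts the label.\<close>

lemma sym_conj_ij:
  assumes "i \<in> {1..n}" "j \<in> {1..n}" "i \<noteq> j" "a \<in> carrier G" "c \<in> carrier G"
  shows "sym (i, j, a) \<otimes> sym (i, j, c) = sym (i, j, a \<otimes>\<^bsub>G\<^esub> inv\<^bsub>G\<^esub> c \<otimes>\<^bsub>G\<^esub> a) \<otimes> sym (i, j, a)"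
  using assms by (subst sym_conj) (auto simp: wsym_def wact_eq transpose_def sym_swap'[of i j]
      G.inv_mult_group G.m_assoc)

lemma sym_conj_disjoint:
  assumes "i \<in> {1..n}" "j \<in> {1..n}" "k \<in> {1..n}" "l \<in> {1..n}" "i \<noteq> j" "k \<noteq> l"
    "k \<noteq> i" "k \<noteq> j" "l \<noteq> i" "l \<noteq> j" "a \<in> carrier G" "b \<in> carrier G"
  shows "sym (i, j, a) \<otimes> sym (k, l, b) = sym (k, l, b) \<otimes> sym (i, j, a)"
  using assms by (subst sym_conj) (auto simp: wsym_def wact_eq transpose_def)

text \<open>The left side is pushed through the symbol (i, k, ab): moving the first factor past the
  second creates it, and conjugating by it turns the remaining (i, j) symbol into a (j, k) symbol.
  So every symbol system satisfies the braid relation of \<open>S\<^sub>n(G)\<close>.\<close>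

lemma sym_braid:
  assumes "i \<in> {1..n}" "j \<in> {1..n}" "k \<in> {1..n}" "i \<noteq> j" "i \<noteq> k" "j \<noteq> k"
    and abc: "a \<in> carrier G" "b \<in> carrier G" "c \<in> carrier G"
  shows "sym (i, j, a) \<otimes> sym (j, k, b) \<otimes> sym (i, j, c) =
    sym (j, k, inv\<^bsub>G\<^esub> a \<otimes>\<^bsub>G\<^esub> c \<otimes>\<^bsub>G\<^esub> b) \<otimes> sym (i, j, a) \<otimes> sym (j, k, b)"
proof -
  note ijk = assms(1-6)
  let ?x = "inv\<^bsub>G\<^esub> a \<otimes>\<^bsub>G\<^esub> c \<otimes>\<^bsub>G\<^esub> b"
  have "sym (i, k, a \<otimes>\<^bsub>G\<^esub> b) \<otimes> sym (i, j, a \<otimes>\<^bsub>G\<^esub> inv\<^bsub>G\<^esub> c \<otimes>\<^bsub>G\<^esub> a) =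
    sym (k, j, inv\<^bsub>G\<^esub> (a \<otimes>\<^bsub>G\<^esub> b) \<otimes>\<^bsub>G\<^esub> (a \<otimes>\<^bsub>G\<^esub> inv\<^bsub>G\<^esub> c \<otimes>\<^bsub>G\<^esub> a)) \<otimes> sym (i, k, a \<otimes>\<^bsub>G\<^esub> b)"
    using ijk abc by (intro sym_conj_ik) auto
  also have "sym (k, j, inv\<^bsub>G\<^esub> (a \<otimes>\<^bsub>G\<^esub> b) \<otimes>\<^bsub>G\<^esub> (a \<otimes>\<^bsub>G\<^esub> inv\<^bsub>G\<^esub> c \<otimes>\<^bsub>G\<^esub> a)) = sym (j, k, ?x)"
    using ijk abc by (simp add: sym_swap'[of j k] G.inv_mult_group G.m_assoc)
  finally have 1: "sym (i, k, a \<otimes>\<^bsub>G\<^esub> b) \<otimes> sym (i, j, a \<otimes>\<^bsub>G\<^esub> inv\<^bsub>G\<^esub> c \<otimes>\<^bsub>G\<^esub> a) = sym (j, k, ?x) \<otimes> sym (i, k, a \<otimes>\<^bsub>G\<^esub> b)" .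
  have "sym (i, j, a) \<otimes> sym (j, k, b) \<otimes> sym (i, j, c) =
    sym (i, k, a \<otimes>\<^bsub>G\<^esub> b) \<otimes> (sym (i, j, a) \<otimes> sym (i, j, c))"
    using ijk abc by (simp add: sym_conj_jk H.m_assoc)
  also have "\<dots> = sym (i, k, a \<otimes>\<^bsub>G\<^esub> b) \<otimes> sym (i, j, a \<otimes>\<^bsub>G\<^esub> inv\<^bsub>G\<^esub> c \<otimes>\<^bsub>G\<^esub> a) \<otimes> sym (i, j, a)"
    using ijk abc sym_conj_ij[of i j a c] by (simp add: H.m_assoc)
  also have "\<dots> = sym (j, k, ?x) \<otimes> (sym (i, k, a \<otimes>\<^bsub>G\<^esub> b) \<otimes> sym (i, j, a))"
    using ijk abc by (simp add: 1 H.m_assoc)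
  also have "\<dots> = sym (j, k, ?x) \<otimes> sym (i, j, a) \<otimes> sym (j, k, b)"
    using ijk abc by (simp add: sym_conj_jk H.m_assoc)
  finally show ?thesis .
qed

end

lemma symbol_system_wsym:
  assumes "group G"
  shows "symbol_system G (wreath_product G n) n (wsym G n)"
proof -
  interpret group G by fact
  interpret W: group "wreath_product G n" by (rule group_wreath[OF assms])
  show ?thesis
  proof
    fix x assume x: "x \<in> symbols G n"
    then show "wsym G n (symbol_swap G x) = wsym G n x"
      by (cases x) (auto simp: wsym_def symbol_swap_def fun_eq_iff transpose_commute)
    show "wsym G n x \<otimes>\<^bsub>wreath_product G n\<^esub> wsym G n x = \<one>\<^bsub>wreath_product G n\<^esub>"
      by (rule wsym_square[OF x])
  qed (auto intro: wsym_conj)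
qed

section \<open>Generators and relations of \<open>S\<^sub>n(G)\<close>\<close>

definition sgen :: "('a, 'b) monoid_scheme \<Rightarrow> nat \<Rightarrow> nat \<Rightarrow> 'a \<Rightarrow> (nat \<times> 'a) word set"
  where "sgen G n i a = pres_cls (Sn_gens G n) (Sn_rels G n) (s_word i a)"

lemma Sn_gens_iff: "(i, a) \<in> Sn_gens G n \<longleftrightarrow> 1 \<le> i \<and> i < n \<and> a \<in> carrier G"
  by (auto simp: Sn_gens_def)

lemma group_Sn: "group (Sn_group G n)"
  by (simp add: Sn_group_def group_presented_group)

lemma sgen_closed [simp]:
  "1 \<le> i \<Longrightarrow> i < n \<Longrightarrow> a \<in> carrier G \<Longrightarrow> sgen G n i a \<in> carrier (Sn_group G n)"
  by (simp add: sgen_def Sn_group_def pres_cls_in_carrier Sn_gens_iff)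

lemma generate_Sn:
  "carrier (Sn_group G n) = generate (Sn_group G n) {sgen G n i a | i a. 1 \<le> i \<and> i < n \<and> a \<in> carrier G}"
proof -
  have "{sgen G n i a | i a. 1 \<le> i \<and> i < n \<and> a \<in> carrier G} =
      (\<lambda>x. pres_cls (Sn_gens G n) (Sn_rels G n) [(True, x)]) ` Sn_gens G n"
    by (force simp: sgen_def Sn_gens_iff image_iff)
  then show ?thesis
    using generate_presented_group[of "Sn_gens G n" "Sn_rels G n"] by (simp add: Sn_group_def)
qed

lemma Sn_relator:
  assumes "(u, v) \<in> Sn_rels G n" "u \<in> words (Sn_gens G n)" "v \<in> words (Sn_gens G n)"
  shows "pres_cls (Sn_gens G n) (Sn_rels G n) u = pres_cls (Sn_gens G n) (Sn_rels G n) v"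
  using assms by (simp add: pres_cls_eq_iff pres_cong.relator)

lemma sgen_square:
  assumes "1 \<le> i" "i < n" "a \<in> carrier G"
  shows "sgen G n i a \<otimes>\<^bsub>Sn_group G n\<^esub> sgen G n i a = \<one>\<^bsub>Sn_group G n\<^esub>"
  unfolding sgen_def Sn_group_def using assms
  by (simp add: mult_presented_group one_presented_group Sn_gens_iff)
    (rule Sn_relator; auto simp: Sn_rels_def Sn_gens_iff)

lemma (in group) sgen_braid:
  assumes "1 \<le> i" "i + 1 < n" "a \<in> carrier G" "b \<in> carrier G" "c \<in> carrier G"
  shows "sgen G n i a \<otimes>\<^bsub>Sn_group G n\<^esub> sgen G n (i + 1) b \<otimes>\<^bsub>Sn_group G n\<^esub> sgen G n i c =
    sgen G n (i + 1) (inv a \<otimes> c \<otimes> b) \<otimes>\<^bsub>Sn_group G n\<^esub> sgen G n i a \<otimes>\<^bsub>Sn_group G n\<^esub> sgen G n (i + 1) b"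
proof -
  have "(s_word i a @ s_word (i + 1) b @ s_word i c,
      s_word (i + 1) (inv a \<otimes> c \<otimes> b) @ s_word i a @ s_word (i + 1) b) \<in> Sn_rels G n"
    using assms unfolding Sn_rels_def by (simp add: Sn_gens_iff)
  from Sn_relator[OF this] show ?thesis
    unfolding sgen_def Sn_group_def using assms
    by (simp add: mult_presented_group Sn_gens_iff)
qed

lemma sgen_commute:
  assumes "1 \<le> i" "i < n" "1 \<le> j" "j < n" "i + 2 \<le> j \<or> j + 2 \<le> i" "a \<in> carrier G" "b \<in> carrier G"
  shows "sgen G n i a \<otimes>\<^bsub>Sn_group G n\<^esub> sgen G n j b = sgen G n j b \<otimes>\<^bsub>Sn_group G n\<^esub> sgen G n i a"
proof -
  have "(s_word i a @ s_word j b, s_word j b @ s_word i a) \<in> Sn_rels G n"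
    using assms unfolding Sn_rels_def by (simp add: Sn_gens_iff)
  from Sn_relator[OF this] show ?thesis
    unfolding sgen_def Sn_group_def using assms
    by (simp add: mult_presented_group Sn_gens_iff)
qed

text \<open>Only symbols with adjacent indices are matched here; \<open>Sn_lift\<close> extends the
  agreement to all symbols, once these exist in \<open>S\<^sub>n(G)\<close>.\<close>

lemma (in symbol_system) Sn_universal:
  obtains \<Phi> where "\<Phi> \<in> hom (Sn_group G n) H"
    "\<And>i a. 1 \<le> i \<Longrightarrow> i < n \<Longrightarrow> a \<in> carrier G \<Longrightarrow> \<Phi> (sgen G n i a) = sym (i, i + 1, a)"
proof -
  have 1: "(\<lambda>(i, a). sym (i, i + 1, a)) \<in> Sn_gens G n \<rightarrow> carrier H"
    by (auto simp: Sn_gens_def)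
  obtain \<Phi> where \<Phi>: "\<Phi> \<in> hom (Sn_group G n) H"
    "\<And>x. x \<in> Sn_gens G n \<Longrightarrow> \<Phi> (pres_cls (Sn_gens G n) (Sn_rels G n) [(True, x)]) = (\<lambda>(i, a). sym (i, i + 1, a)) x"
  proof (rule H.presented_group_universal[OF 1, of "Sn_rels G n"])
    fix u v assume "(u, v) \<in> Sn_rels G n" "u \<in> words (Sn_gens G n)" "v \<in> words (Sn_gens G n)"
    then show "word_eval H (\<lambda>(i, a). sym (i, i + 1, a)) u = word_eval H (\<lambda>(i, a). sym (i, i + 1, a)) v"
      unfolding Sn_rels_def
    proof (elim UnE CollectE exE conjE)
      fix i a assume "(u, v) = (s_word i a @ s_word i a, [])" "(i, a) \<in> Sn_gens G n"
      then show ?thesis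
        by (auto simp: Sn_gens_iff sym_square)
    next
      fix i a b c assume *: "(u, v) = (s_word i a @ s_word (i + 1) b @ s_word i c,
          s_word (i + 1) (inv\<^bsub>G\<^esub> a \<otimes>\<^bsub>G\<^esub> c \<otimes>\<^bsub>G\<^esub> b) @ s_word i a @ s_word (i + 1) b)"
        "(i, a) \<in> Sn_gens G n" "(i + 1, b) \<in> Sn_gens G n" "(i, c) \<in> Sn_gens G n"
      then show ?thesis
        using sym_braid[of i "i + 1" "i + 1 + 1" a b c]
        by (simp add: Sn_gens_iff H.m_assoc)
    next
      fix i j a b assume *: "(u, v) = (s_word i a @ s_word j b, s_word j b @ s_word i a)"
        "(i, a) \<in> Sn_gens G n" "(j, b) \<in> Sn_gens G n" "i + 2 \<le> j \<or> j + 2 \<le> i"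
      then show ?thesis
        using sym_conj_disjoint[of i "i + 1" j "j + 1" a b]
        by (auto simp: Sn_gens_iff)
    qed
  qed (auto simp: Sn_group_def)
  show thesis
    by (rule that[OF \<Phi>(1)]) (use \<Phi>(2) in \<open>auto simp: sgen_def Sn_gens_iff\<close>)
qed

section \<open>The symbols in \<open>S\<^sub>n(G)\<close>\<close>

locale braid_system = G: group G + S: group S
  for G :: "('a, 'b) monoid_scheme" and S :: "('s, 'c) monoid_scheme" (structure) +
  fixes n :: nat and s :: "nat \<Rightarrow> 'a \<Rightarrow> 's"
  assumes three_le: "3 \<le> n"
    and s_closed [simp]: "1 \<le> i \<Longrightarrow> i < n \<Longrightarrow> a \<in> carrier G \<Longrightarrow> s i a \<in> carrier S"
    and s_square [simp]: "1 \<le> i \<Longrightarrow> i < n \<Longrightarrow> a \<in> carrier G \<Longrightarrow> s i a \<otimes> s i a = \<one>"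
    and s_braid: "1 \<le> i \<Longrightarrow> i + 1 < n \<Longrightarrow> a \<in> carrier G \<Longrightarrow> b \<in> carrier G \<Longrightarrow> c \<in> carrier G \<Longrightarrow>
      s i a \<otimes> s (i + 1) b \<otimes> s i c = s (i + 1) (inv\<^bsub>G\<^esub> a \<otimes>\<^bsub>G\<^esub> c \<otimes>\<^bsub>G\<^esub> b) \<otimes> s i a \<otimes> s (i + 1) b"
    and s_commute: "1 \<le> i \<Longrightarrow> i + 2 \<le> j \<Longrightarrow> j < n \<Longrightarrow> a \<in> carrier G \<Longrightarrow> b \<in> carrier G \<Longrightarrow>
      s i a \<otimes> s j b = s j b \<otimes> s i a"
begin

lemma s_cancel [simp]:
  "1 \<le> i \<Longrightarrow> i < n \<Longrightarrow> a \<in> carrier G \<Longrightarrow> x \<in> carrier S \<Longrightarrow> s i a \<otimes> (s i a \<otimes> x) = x"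
  by (simp flip: S.m_assoc)

lemma inv_s [simp]: "1 \<le> i \<Longrightarrow> i < n \<Longrightarrow> a \<in> carrier G \<Longrightarrow> inv (s i a) = s i a"
  by (simp add: S.inv_equality)

definition cnj :: "nat \<Rightarrow> 'a \<Rightarrow> 's \<Rightarrow> 's"
  where "cnj i a x = s i a \<otimes> x \<otimes> s i a"

lemma cnj_closed [simp]:
  "1 \<le> i \<Longrightarrow> i < n \<Longrightarrow> a \<in> carrier G \<Longrightarrow> x \<in> carrier S \<Longrightarrow> cnj i a x \<in> carrier S"
  by (simp add: cnj_def)

lemma cnj_cnj [simp]:
  "1 \<le> i \<Longrightarrow> i < n \<Longrightarrow> a \<in> carrier G \<Longrightarrow> x \<in> carrier S \<Longrightarrow> cnj i a (cnj i a x) = x"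
  by (simp add: cnj_def S.m_assoc)

lemma cnj_eq_iff:
  assumes "1 \<le> i" "i < n" "a \<in> carrier G" "x \<in> carrier S" "y \<in> carrier S"
  shows "cnj i a x = y \<longleftrightarrow> s i a \<otimes> x = y \<otimes> s i a"
  using assms by (metis S.m_assoc S.m_closed S.r_one cnj_def s_closed s_square)

lemma cnj_commute:
  assumes "1 \<le> i" "i + 2 \<le> j" "j < n" "a \<in> carrier G" "b \<in> carrier G" "x \<in> carrier S"
  shows "cnj i a (cnj j b x) = cnj j b (cnj i a x)"
proof -
  have i: "i < n" "1 \<le> j" using assms by auto
  have "cnj i a (cnj j b x) = (s i a \<otimes> s j b) \<otimes> x \<otimes> (s j b \<otimes> s i a)"
    using assms i by (simp add: cnj_def S.m_assoc)
  also have "\<dots> = (s j b \<otimes> s i a) \<otimes> x \<otimes> (s i a \<otimes> s j b)"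
    using assms s_commute[of i j a b] by simp
  also have "\<dots> = cnj j b (cnj i a x)"
    using assms i by (simp add: cnj_def S.m_assoc)
  finally show ?thesis .
qed

section \<open>Consequences of the braid relation for two neighbouring indices\<close>

context
  fixes i assumes i: "1 \<le> i" "i + 1 < n"
begin

lemma i_bounds [simp]: "1 \<le> i" "i < n" "Suc 0 \<le> i" "Suc i < n"
  using i by auto

lemma braid_same:
  assumes "a \<in> carrier G" "b \<in> carrier G"
  shows "s i a \<otimes> s (i + 1) b \<otimes> s i a = s (i + 1) b \<otimes> s i a \<otimes> s (i + 1) b"
  using s_braid[OF i assms(1) assms(2) assms(1)] assms by simp

text \<open>The element \<open>s\<^sub>i(a) s\<^sub>i\<^sub>+\<^sub>1(b) s\<^sub>i(a)\<close> is the symbol \<open>(i, i + 2, a b)\<close>, so it should depend on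
  the product \<open>a b\<close> only.\<close>

lemma braid_depends_on_product:
  assumes abc: "a \<in> carrier G" "b \<in> carrier G" "c \<in> carrier G"
  shows "s i a \<otimes> s (i + 1) b \<otimes> s i a = s i c \<otimes> s (i + 1) (inv\<^bsub>G\<^esub> c \<otimes>\<^bsub>G\<^esub> a \<otimes>\<^bsub>G\<^esub> b) \<otimes> s i c"
proof -
  let ?v = "inv\<^bsub>G\<^esub> c \<otimes>\<^bsub>G\<^esub> a \<otimes>\<^bsub>G\<^esub> b"
  have "s i c \<otimes> (s (i + 1) b \<otimes> s i a \<otimes> s (i + 1) b) = (s i c \<otimes> s (i + 1) b \<otimes> s i a) \<otimes> s (i + 1) b"
    using abc by (simp add: S.m_assoc)
  also have "\<dots> = (s (i + 1) ?v \<otimes> s i c \<otimes> s (i + 1) b) \<otimes> s (i + 1) b"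
    using abc i by (simp only: s_braid)
  also have "\<dots> = s (i + 1) ?v \<otimes> s i c"
    using abc by (simp add: S.m_assoc)
  finally have "s i c \<otimes> (s i c \<otimes> (s (i + 1) b \<otimes> s i a \<otimes> s (i + 1) b)) = s i c \<otimes> (s (i + 1) ?v \<otimes> s i c)"
    by simp
  then show ?thesis
    using abc by (simp only: braid_same) (simp add: S.m_assoc)
qed

text \<open>The generators are involutions, so inverting both sides of the braid relation reverses
  the words.\<close>

lemma braid_rev:
  assumes abc: "a \<in> carrier G" "b \<in> carrier G" "c \<in> carrier G"
  shows "s i c \<otimes> s (i + 1) b \<otimes> s i a = s (i + 1) b \<otimes> s i a \<otimes> s (i + 1) (inv\<^bsub>G\<^esub> a \<otimes>\<^bsub>G\<^esub> c \<otimes>\<^bsub>G\<^esub> b)"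
proof -
  have "inv (s i a \<otimes> s (i + 1) b \<otimes> s i c) =
    inv (s (i + 1) (inv\<^bsub>G\<^esub> a \<otimes>\<^bsub>G\<^esub> c \<otimes>\<^bsub>G\<^esub> b) \<otimes> s i a \<otimes> s (i + 1) b)"
    using abc i by (simp only: s_braid)
  then show ?thesis
    using abc by (simp add: S.inv_mult_group S.m_assoc)
qed

text \<open>The presentation has no relation between different labels at the same index apart from
  the braid relation, so the neighbour i has to be used. One braid word is rewritten in two ways and
  compared with two expressions of the same symbol (i, i + 2, b).\<close>

lemma triple_upper:
  assumes bt: "b \<in> carrier G" "y \<in> carrier G"
  shows "cnj (i + 1) b (s (i + 1) y) = s (i + 1) (b \<otimes>\<^bsub>G\<^esub> inv\<^bsub>G\<^esub> y \<otimes>\<^bsub>G\<^esub> b)"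
proof -
  \<comment> \<open>With this \<open>c\<close>, the word
    \<open>s\<^sub>i(c) s\<^sub>i\<^sub>+\<^sub>1(b) s\<^sub>i(1)\<close> ends in
    \<open>s\<^sub>i\<^sub>+\<^sub>1(y)\<close> when braided to the right, and starts with
    \<open>s\<^sub>i\<^sub>+\<^sub>1(v)\<close> when braided to the left.\<close>
  define c where "c = y \<otimes>\<^bsub>G\<^esub> inv\<^bsub>G\<^esub> b"
  define v where "v = b \<otimes>\<^bsub>G\<^esub> inv\<^bsub>G\<^esub> y \<otimes>\<^bsub>G\<^esub> b"
  let ?E = "s (i + 1) b \<otimes> s i \<one>\<^bsub>G\<^esub> \<otimes> s (i + 1) b"
  have c: "c \<in> carrier G" and v: "v \<in> carrier G" using bt by (simp_all add: c_def v_def)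
  have cb: "c \<otimes>\<^bsub>G\<^esub> b = y" "inv\<^bsub>G\<^esub> c \<otimes>\<^bsub>G\<^esub> b = v"
    using bt by (simp_all add: c_def v_def G.m_assoc G.inv_mult_group)
  have "s (i + 1) v \<otimes> s i c \<otimes> s (i + 1) b = s i c \<otimes> s (i + 1) b \<otimes> s i \<one>\<^bsub>G\<^esub>"
    using s_braid[OF i c bt(1), of "\<one>\<^bsub>G\<^esub>"] c bt cb by (simp add: G.m_assoc)
  also have "\<dots> = s (i + 1) b \<otimes> s i \<one>\<^bsub>G\<^esub> \<otimes> s (i + 1) y"
    using braid_rev[OF _ bt(1) c, of "\<one>\<^bsub>G\<^esub>"] c bt cb by simp
  finally have 1: "s (i + 1) v \<otimes> s i c \<otimes> s (i + 1) b = s (i + 1) b \<otimes> s i \<one>\<^bsub>G\<^esub> \<otimes> s (i + 1) y" .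
  have E: "?E = s (i + 1) v \<otimes> s i c \<otimes> s (i + 1) v"
    using braid_depends_on_product[of "\<one>\<^bsub>G\<^esub>" b c] c bt cb v braid_same[of "\<one>\<^bsub>G\<^esub>" b] braid_same[of c v]
    by simp
  have "?E \<otimes> cnj (i + 1) b (s (i + 1) y) = s (i + 1) b \<otimes> s i \<one>\<^bsub>G\<^esub> \<otimes> s (i + 1) y \<otimes> s (i + 1) b"
    using bt by (simp add: cnj_def S.m_assoc)
  also have "\<dots> = s (i + 1) v \<otimes> s i c \<otimes> s (i + 1) b \<otimes> s (i + 1) b"
    by (simp only: 1)
  also have "\<dots> = s (i + 1) v \<otimes> s i c"
    using bt c v by (simp add: S.m_assoc)
  also have "\<dots> = ?E \<otimes> s (i + 1) v"
    unfolding E using c v by (simp add: S.m_assoc)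
  finally show ?thesis
    unfolding v_def[symmetric] using bt c v by simp
qed

text \<open>The same relation at the lower index, now with the neighbour above: the symbol (i, i +
  2, a) is written once with labels a, 1 and once with labels d, y, where dy = a.\<close>

lemma triple_lower:
  assumes ac: "a \<in> carrier G" "c \<in> carrier G"
  shows "cnj i a (s i c) = s i (a \<otimes>\<^bsub>G\<^esub> inv\<^bsub>G\<^esub> c \<otimes>\<^bsub>G\<^esub> a)"
proof -
  define y where "y = inv\<^bsub>G\<^esub> a \<otimes>\<^bsub>G\<^esub> c"
  define d where "d = a \<otimes>\<^bsub>G\<^esub> inv\<^bsub>G\<^esub> c \<otimes>\<^bsub>G\<^esub> a"
  let ?t = "s (i + 1) \<one>\<^bsub>G\<^esub>"
  have y: "y \<in> carrier G" and d: "d \<in> carrier G" using ac by (simp_all add: y_def d_def)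
  have dy: "inv\<^bsub>G\<^esub> d \<otimes>\<^bsub>G\<^esub> a = y"
    using ac by (simp add: y_def d_def G.inv_mult_group G.m_assoc)
  have E: "s i a \<otimes> ?t \<otimes> s i a = s (i + 1) y \<otimes> s i d \<otimes> s (i + 1) y"
    using braid_depends_on_product[of a "\<one>\<^bsub>G\<^esub>" d] ac y d dy braid_same[of d y] by simp
  have "s i a \<otimes> ?t \<otimes> s i a \<otimes> cnj i a (s i c) = s i a \<otimes> ?t \<otimes> s i c \<otimes> s i a"
    using ac by (simp add: cnj_def S.m_assoc)
  also have "\<dots> = s (i + 1) y \<otimes> s i a \<otimes> ?t \<otimes> s i a"
    using s_braid[OF i ac(1) _ ac(2), of "\<one>\<^bsub>G\<^esub>"] ac by (simp add: y_def)
  also have "\<dots> = s (i + 1) y \<otimes> (s i a \<otimes> ?t \<otimes> s i a)"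
    using ac y by (simp add: S.m_assoc)
  also have "\<dots> = s (i + 1) y \<otimes> (s (i + 1) y \<otimes> s i d \<otimes> s (i + 1) y)"
    by (simp only: E)
  also have "\<dots> = s i d \<otimes> s (i + 1) y"
    using y d by (simp add: S.m_assoc)
  also have "\<dots> = s (i + 1) y \<otimes> (s (i + 1) y \<otimes> s i d \<otimes> s (i + 1) y)"
    using y d by (simp add: S.m_assoc)
  also have "s (i + 1) y \<otimes> s i d \<otimes> s (i + 1) y = s i d \<otimes> s (i + 1) y \<otimes> s i d"
    using y d by (simp only: braid_same)
  also have "s (i + 1) y \<otimes> (s i d \<otimes> s (i + 1) y \<otimes> s i d) = s i a \<otimes> ?t \<otimes> s i a \<otimes> s i d"
    unfolding E using y d by (simp add: S.m_assoc)
  finally show ?thesis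
    unfolding d_def[symmetric] using ac d by simp
qed

text \<open>The element \<open>s\<^sub>i\<^sub>+\<^sub>1(c) s\<^sub>i(1)
  s\<^sub>i\<^sub>+\<^sub>1(c)\<close> depends only on the product of its labels, so c may migrate
  to the index i. Its outer factors act trivially on x and can be inserted or deleted.\<close>

lemma cnj_swap_product:
  assumes "c \<in> carrier G" "x \<in> carrier S" "s (i + 1) c \<otimes> x = x \<otimes> s (i + 1) c"
    "s (i + 1) \<one>\<^bsub>G\<^esub> \<otimes> x = x \<otimes> s (i + 1) \<one>\<^bsub>G\<^esub>"
  shows "cnj (i + 1) c (cnj i \<one>\<^bsub>G\<^esub> x) = cnj (i + 1) \<one>\<^bsub>G\<^esub> (cnj i c x)"
proof -
  have E: "s (i + 1) c \<otimes> s i \<one>\<^bsub>G\<^esub> \<otimes> s (i + 1) c = s (i + 1) \<one>\<^bsub>G\<^esub> \<otimes> s i c \<otimes> s (i + 1) \<one>\<^bsub>G\<^esub>" (is "?E = ?F")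
    using braid_depends_on_product[of "\<one>\<^bsub>G\<^esub>" c c] assms(1) braid_same[of "\<one>\<^bsub>G\<^esub>" c] braid_same[of c "\<one>\<^bsub>G\<^esub>"]
    by simp
  have x: "cnj (i + 1) d x = x" if "s (i + 1) d \<otimes> x = x \<otimes> s (i + 1) d" "d \<in> carrier G" for d
    using that assms(2) by (simp add: cnj_eq_iff)
  have "cnj (i + 1) c (cnj i \<one>\<^bsub>G\<^esub> x) = cnj (i + 1) c (cnj i \<one>\<^bsub>G\<^esub> (cnj (i + 1) c x))"
    using assms x[of c] by simp
  also have "\<dots> = ?E \<otimes> x \<otimes> ?E"
    using assms(1,2) by (simp add: cnj_def S.m_assoc)
  also have "\<dots> = ?F \<otimes> x \<otimes> ?F"
    by (simp only: E)
  also have "\<dots> = cnj (i + 1) \<one>\<^bsub>G\<^esub> (cnj i c (cnj (i + 1) \<one>\<^bsub>G\<^esub> x))"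
    using assms(1,2) by (simp add: cnj_def S.m_assoc)
  also have "\<dots> = cnj (i + 1) \<one>\<^bsub>G\<^esub> (cnj i c x)"
    using assms x[of "\<one>\<^bsub>G\<^esub>"] by simp
  finally show ?thesis .
qed

text \<open>The braid relation carries \<open>s\<^sub>i(c)\<close> through the two conjugating
  letters and turns it into \<open>s\<^sub>i\<^sub>+\<^sub>1(c)\<close>, which commutes with
  x.\<close>

lemma cnj_shift:
  assumes "c \<in> carrier G" "x \<in> carrier S" "s (i + 1) c \<otimes> x = x \<otimes> s (i + 1) c"
  shows "cnj i c (cnj (i + 1) \<one>\<^bsub>G\<^esub> (cnj i \<one>\<^bsub>G\<^esub> x)) = cnj (i + 1) \<one>\<^bsub>G\<^esub> (cnj i \<one>\<^bsub>G\<^esub> x)"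
proof -
  let ?t = "s (i + 1) \<one>\<^bsub>G\<^esub>"
  have 1: "s i c \<otimes> ?t \<otimes> s i \<one>\<^bsub>G\<^esub> = ?t \<otimes> s i \<one>\<^bsub>G\<^esub> \<otimes> s (i + 1) c"
    using braid_rev[of "\<one>\<^bsub>G\<^esub>" "\<one>\<^bsub>G\<^esub>" c] assms by simp
  have "inv (s i c \<otimes> ?t \<otimes> s i \<one>\<^bsub>G\<^esub>) = inv (?t \<otimes> s i \<one>\<^bsub>G\<^esub> \<otimes> s (i + 1) c)"
    by (simp only: 1)
  then have 2: "s i \<one>\<^bsub>G\<^esub> \<otimes> (?t \<otimes> s i c) = s (i + 1) c \<otimes> (s i \<one>\<^bsub>G\<^esub> \<otimes> ?t)"
    using assms by (simp add: S.inv_mult_group S.m_assoc)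
  have "cnj i c (cnj (i + 1) \<one>\<^bsub>G\<^esub> (cnj i \<one>\<^bsub>G\<^esub> x)) =
    (s i c \<otimes> ?t \<otimes> s i \<one>\<^bsub>G\<^esub>) \<otimes> x \<otimes> (s i \<one>\<^bsub>G\<^esub> \<otimes> (?t \<otimes> s i c))"
    using assms by (simp add: cnj_def S.m_assoc)
  also have "\<dots> = (?t \<otimes> s i \<one>\<^bsub>G\<^esub>) \<otimes> (s (i + 1) c \<otimes> x) \<otimes> (s (i + 1) c \<otimes> (s i \<one>\<^bsub>G\<^esub> \<otimes> ?t))"
    unfolding 1 2 using assms(1,2) by (simp add: S.m_assoc)
  also have "\<dots> = cnj (i + 1) \<one>\<^bsub>G\<^esub> (cnj i \<one>\<^bsub>G\<^esub> x)"
    unfolding assms(3) using assms(1,2) by (simp add: cnj_def S.m_assoc)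
  finally show ?thesis .
qed

end

declare i_bounds [simp del]

section \<open>Symbols for arbitrary index pairs, built by conjugation\<close>

lemma triple:
  assumes "1 \<le> i" "i < n" "a \<in> carrier G" "c \<in> carrier G"
  shows "cnj i a (s i c) = s i (a \<otimes>\<^bsub>G\<^esub> inv\<^bsub>G\<^esub> c \<otimes>\<^bsub>G\<^esub> a)"
proof (cases "i + 1 < n")
  case True
  then show ?thesis using assms triple_lower by blast
next
  case False
  then obtain k where "i = k + 1" "1 \<le> k"
    using assms three_le by (cases i) auto
  then show ?thesis
    using assms triple_upper[of k a c] by simp
qed

text \<open>This is the symbol (i, i + d + 1, a): starting from (i, i + 1, a), the upper index is
  moved up by trivially labelled transpositions. Keeping the whole label in the innermost letter is
  a choice of normal form.\<close>

primrec chain :: "nat \<Rightarrow> 'a \<Rightarrow> nat \<Rightarrow> 's" where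
  "chain i a 0 = s i a"
| "chain i a (Suc d) = cnj (i + d + 1) \<one>\<^bsub>G\<^esub> (chain i a d)"

lemma chain_closed [simp]:
  "1 \<le> i \<Longrightarrow> i + d < n \<Longrightarrow> a \<in> carrier G \<Longrightarrow> chain i a d \<in> carrier S"
  by (induction d) auto

lemma chain_square:
  "1 \<le> i \<Longrightarrow> i + d < n \<Longrightarrow> a \<in> carrier G \<Longrightarrow> chain i a d \<otimes> chain i a d = \<one>"
proof (induction d)
  case (Suc d)
  let ?t = "s (i + d + 1) \<one>\<^bsub>G\<^esub>" and ?x = "chain i a d"
  have "chain i a (Suc d) \<otimes> chain i a (Suc d) = ?t \<otimes> ((?x \<otimes> ?x) \<otimes> ?t)"
    using Suc.prems by (simp add: cnj_def S.m_assoc)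
  then show ?case using Suc by simp
qed auto

lemma chain_above:
  assumes "1 \<le> i" "i + d + 1 < k" "k < n" "a \<in> carrier G" "c \<in> carrier G"
  shows "cnj k c (chain i a d) = chain i a d"
  using assms
proof (induction d)
  case 0
  then show ?case using s_commute[of i k a c] by (simp add: cnj_eq_iff)
next
  case (Suc d)
  then have "cnj k c (chain i a (Suc d)) = cnj (i + d + 1) \<one>\<^bsub>G\<^esub> (cnj k c (chain i a d))"
    using cnj_commute[of "i + d + 1" k "\<one>\<^bsub>G\<^esub>" c "chain i a d"] by simp
  then show ?case using Suc by simp
qed

lemma chain_below:
  assumes "1 \<le> k" "k + 1 < i" "i + d < n" "a \<in> carrier G" "c \<in> carrier G"
  shows "cnj k c (chain i a d) = chain i a d"
  using assms
proof (induction d)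
  case 0
  then show ?case by (simp add: cnj_eq_iff s_commute)
next
  case (Suc d)
  then have "cnj k c (chain i a (Suc d)) = cnj (i + d + 1) \<one>\<^bsub>G\<^esub> (cnj k c (chain i a d))"
    using cnj_commute[of k "i + d + 1" c "\<one>\<^bsub>G\<^esub>" "chain i a d"] by simp
  then show ?case using Suc by simp
qed

text \<open>A label c on the outermost letter is moved inwards one letter at a time by
  \<open>cnj_swap_product\<close>, until it is absorbed in the innermost label.\<close>

lemma chain_extend:
  assumes "1 \<le> i" "i + d + 1 < n" "a \<in> carrier G" "c \<in> carrier G"
  shows "cnj (i + d + 1) c (chain i a d) = chain i (a \<otimes>\<^bsub>G\<^esub> c) (Suc d)"
  using assms
proof (induction d)
  case 0
  then have i: "1 \<le> i" "i + 1 < n" by auto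
  have "s (i + 1) c \<otimes> s i a \<otimes> s (i + 1) c = s (i + 1) \<one>\<^bsub>G\<^esub> \<otimes> s i (a \<otimes>\<^bsub>G\<^esub> c) \<otimes> s (i + 1) \<one>\<^bsub>G\<^esub>"
    using braid_depends_on_product[OF i, of a c "a \<otimes>\<^bsub>G\<^esub> c"] braid_same[OF i, of a c]
      braid_same[OF i, of "a \<otimes>\<^bsub>G\<^esub> c" "\<one>\<^bsub>G\<^esub>"] 0 by (simp add: G.m_assoc)
  then show ?case by (simp add: cnj_def)
next
  case (Suc d)
  let ?j = "i + d + 1"
  have j: "1 \<le> ?j" "?j + 1 < n" using Suc.prems by auto
  have comm: "s (?j + 1) b \<otimes> chain i a d = chain i a d \<otimes> s (?j + 1) b" if "b \<in> carrier G" for b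
    using that Suc.prems chain_above[of i d "?j + 1" a b]
    by (simp add: cnj_eq_iff)
  have "cnj (i + Suc d + 1) c (chain i a (Suc d)) = cnj (?j + 1) \<one>\<^bsub>G\<^esub> (cnj ?j c (chain i a d))"
    using cnj_swap_product[OF j, of c "chain i a d"] comm Suc.prems by simp
  also have "\<dots> = cnj (?j + 1) \<one>\<^bsub>G\<^esub> (chain i (a \<otimes>\<^bsub>G\<^esub> c) (Suc d))"
    using Suc by simp
  finally show ?case by simp
qed

text \<open>A generator strictly between the end points is first moved inwards past the outer
  letters that commute with it; it then meets the two letters treated in
  \<open>cnj_shift\<close>.\<close>

lemma chain_inner:
  assumes "1 \<le> i" "i < k" "k < i + d" "i + d < n" "a \<in> carrier G" "c \<in> carrier G"
  shows "cnj k c (chain i a d) = chain i a d"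
  using assms
proof (induction d)
  case (Suc d)
  show ?case
  proof (cases "k < i + d")
    case True
    then have "cnj k c (chain i a (Suc d)) = cnj (i + d + 1) \<one>\<^bsub>G\<^esub> (cnj k c (chain i a d))"
      using Suc.prems cnj_commute[of k "i + d + 1" c "\<one>\<^bsub>G\<^esub>" "chain i a d"] by simp
    then show ?thesis using Suc True by simp
  next
    case False
    then obtain e where e: "d = Suc e" using Suc.prems by (cases d) auto
    with False Suc.prems have e: "d = Suc e" "k = i + e + 1" by auto
    have k: "1 \<le> k" "k + 1 < n" using Suc.prems e by auto
    have "s (k + 1) c \<otimes> chain i a e = chain i a e \<otimes> s (k + 1) c"
      using Suc.prems e chain_above[of i e "k + 1" a c] by (simp add: cnj_eq_iff)
    from cnj_shift[OF k _ _ this] show ?thesis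
      using Suc.prems by (simp add: e)
  qed
qed auto

text \<open>Only the innermost braid is affected by a generator at the left end; all later letters
  have indices at least i + 2 and commute with it.\<close>

lemma chain_left:
  assumes "1 \<le> i" "i + d + 1 < n" "a \<in> carrier G" "c \<in> carrier G"
  shows "cnj i c (chain i a (Suc d)) = chain (i + 1) (inv\<^bsub>G\<^esub> c \<otimes>\<^bsub>G\<^esub> a) d"
  using assms
proof (induction d)
  case 0
  then have i: "1 \<le> i" "i + 1 < n" by auto
  have "cnj (i + 1) \<one>\<^bsub>G\<^esub> (s i a) = cnj i c (s (i + 1) (inv\<^bsub>G\<^esub> c \<otimes>\<^bsub>G\<^esub> a))"
    using braid_depends_on_product[OF i, of a "\<one>\<^bsub>G\<^esub>" c] braid_same[OF i, of a "\<one>\<^bsub>G\<^esub>"] 0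
    by (simp add: cnj_def)
  then show ?case using 0 by simp
next
  case (Suc d)
  have "cnj i c (chain i a (Suc (Suc d))) = cnj (i + d + 2) \<one>\<^bsub>G\<^esub> (cnj i c (chain i a (Suc d)))"
    using Suc.prems cnj_commute[of i "i + d + 2" c "\<one>\<^bsub>G\<^esub>" "chain i a (Suc d)"] by simp
  then show ?case using Suc by simp
qed

definition symb :: "nat \<times> nat \<times> 'a \<Rightarrow> 's"
  where "symb = (\<lambda>(i, j, a). if i < j then chain i a (j - i - 1) else chain j (inv\<^bsub>G\<^esub> a) (i - j - 1))"

lemma symb_closed: "x \<in> symbols G n \<Longrightarrow> symb x \<in> carrier S"
  by (cases x) (auto simp: symb_def)

lemma symb_swap: "x \<in> symbols G n \<Longrightarrow> symb (symbol_swap G x) = symb x"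
  by (cases x) (auto simp: symb_def symbol_swap_def)

lemma symb_square: "x \<in> symbols G n \<Longrightarrow> symb x \<otimes> symb x = \<one>"
  by (cases x) (auto simp: symb_def chain_square)

lemma symb_adjacent: "symb (i, i + 1, a) = s i a"
  by (simp add: symb_def)

section \<open>Conjugation permutes the symbols\<close>

lemma wact_swap:
  assumes "w \<in> carrier (wreath_product G n)" "x \<in> symbols G n"
  shows "wact G w (symbol_swap G x) = symbol_swap G (wact G w x)"
proof -
  obtain i j a where x: "x = (i, j, a)" "i \<in> {1..n}" "j \<in> {1..n}" "i \<noteq> j" "a \<in> carrier G"
    using assms(2) by (cases x) auto
  obtain g \<sigma> where w: "w = (g, \<sigma>)"
    "\<And>i. i \<in> {1..n} \<Longrightarrow> g i \<in> carrier G" "\<And>i. i \<in> {1..n} \<Longrightarrow> \<sigma> i \<in> {1..n}"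
    using G.wreath_cases[OF assms(1)] by metis
  have "g (\<sigma> i) \<in> carrier G" "g (\<sigma> j) \<in> carrier G" using w x by blast+
  then show ?thesis
    using x(5) by (simp add: x(1) w(1) wact_eq symbol_swap_def G.inv_mult_group G.m_assoc)
qed

text \<open>Being multiplicative in the pair, this property reduces the conjugation relations of all
  symbols to conjugation by the generators.\<close>

definition conj_compatible :: "'s \<Rightarrow> (nat \<Rightarrow> 'a) \<times> (nat \<Rightarrow> nat) \<Rightarrow> bool"
  where "conj_compatible h w \<longleftrightarrow> h \<in> carrier S \<and> w \<in> carrier (wreath_product G n) \<and>
    (\<forall>y \<in> symbols G n. h \<otimes> symb y = symb (wact G w y) \<otimes> h)"

lemma conj_compatible_mult:
  assumes "conj_compatible h w" "conj_compatible h' w'"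
  shows "conj_compatible (h \<otimes> h') (w \<otimes>\<^bsub>wreath_product G n\<^esub> w')"
proof -
  interpret W: group "wreath_product G n" by (rule group_wreath) (rule G.group_axioms)
  have "h \<otimes> h' \<otimes> symb y = symb (wact G (w \<otimes>\<^bsub>wreath_product G n\<^esub> w') y) \<otimes> (h \<otimes> h')" if y: "y \<in> symbols G n" for y
  proof -
    have y': "wact G w' y \<in> symbols G n" "wact G w (wact G w' y) \<in> symbols G n"
      using assms y by (auto simp: conj_compatible_def intro!: G.wact_closed)
    have "h \<otimes> h' \<otimes> symb y = h \<otimes> (symb (wact G w' y) \<otimes> h')"
      using assms y by (simp add: conj_compatible_def S.m_assoc symb_closed)
    also have "\<dots> = symb (wact G w (wact G w' y)) \<otimes> h \<otimes> h'"
      using assms y' by (simp add: conj_compatible_def S.m_assoc[symmetric] symb_closed)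
    finally show ?thesis
      using assms y y' by (simp add: conj_compatible_def G.wact_mult S.m_assoc symb_closed)
  qed
  then show ?thesis
    using assms by (simp add: conj_compatible_def)
qed

text \<open>Each relative position of the pair i, i + 1 and the end points k, l is settled by one of
  the chain lemmas or by \<open>triple\<close>.\<close>

lemma cnj_symb_ascending:
  assumes i: "1 \<le> i" "i < n" and c: "c \<in> carrier G"
    and kl: "k \<in> {1..n}" "l \<in> {1..n}" "k < l" and b: "b \<in> carrier G"
  shows "cnj i c (symb (k, l, b)) = symb (wact G (wsym G n (i, i + 1, c)) (k, l, b))"
proof -
  consider "i + 1 < k" | "i + 1 = k" | "i = k" "l = i + 1" | "i = k" "i + 1 < l"
    | "k < i" "i + 1 < l" | "k < i" "i + 1 = l" | "i = l" | "l < i"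
    using kl by linarith
  then show ?thesis
  proof cases
    case 1
    then show ?thesis
      using i c kl b chain_below[of i k "l - k - 1" b c]
      by (simp add: symb_def wsym_def wact_eq transpose_def)
  next
    case 2
    then obtain d where d: "l = i + d + 2" using kl less_imp_Suc_add[of k l] by auto
    \<comment> \<open>\<open>chain_left\<close> shortens a chain; lengthening is its inverse, as
      conjugation by a generator is an involution.\<close>
    have "cnj i c (chain i (c \<otimes>\<^bsub>G\<^esub> b) (Suc d)) = chain (i + 1) b d"
      using 2 d i c kl b chain_left[of i d "c \<otimes>\<^bsub>G\<^esub> b" c] by (simp flip: G.m_assoc)
    then have "cnj i c (chain (i + 1) b d) = chain i (c \<otimes>\<^bsub>G\<^esub> b) (Suc d)"
      using d i c kl b cnj_cnj[of i c "chain i (c \<otimes>\<^bsub>G\<^esub> b) (Suc d)"] by simp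
    then show ?thesis
      using 2 d i c kl b by (auto simp: symb_def wsym_def wact_eq transpose_def)
  next
    case 3
    then show ?thesis
      using i c kl b triple[of i c b]
      by (simp add: symb_def wsym_def wact_eq transpose_def G.inv_mult_group G.m_assoc)
  next
    case 4
    then obtain d where d: "l = i + d + 2" using less_imp_Suc_add[of "i + 1" l] by auto
    then show ?thesis
      using 4 i c kl b chain_left[of i d b c]
      by (simp add: symb_def wsym_def wact_eq transpose_def)
  next
    case 5
    then show ?thesis
      using i c kl b chain_inner[of k i "l - k - 1" b c]
      by (simp add: symb_def wsym_def wact_eq transpose_def)
  next
    case 6
    then obtain d where d: "i = k + d + 1" using less_imp_Suc_add[of k i] by auto
    have "cnj i c (chain k (b \<otimes>\<^bsub>G\<^esub> inv\<^bsub>G\<^esub> c) d) = chain k b (Suc d)"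
      using 6 d i c kl b chain_extend[of k d "b \<otimes>\<^bsub>G\<^esub> inv\<^bsub>G\<^esub> c" c] by (simp add: G.m_assoc)
    then have "cnj i c (chain k b (Suc d)) = chain k (b \<otimes>\<^bsub>G\<^esub> inv\<^bsub>G\<^esub> c) d"
      using cnj_cnj[of i c "chain k (b \<otimes>\<^bsub>G\<^esub> inv\<^bsub>G\<^esub> c) d"] i c kl b d by simp
    moreover have "l = k + d + 2" using 6 d by simp
    ultimately show ?thesis
      using d i c kl b by (simp add: symb_def wsym_def wact_eq transpose_def)
  next
    case 7
    then obtain d where d: "l = k + d + 1" using kl less_imp_Suc_add[of k l] by auto
    then show ?thesis
      using 7 i c kl b chain_extend[of k d b c]
      by (simp add: symb_def wsym_def wact_eq transpose_def)
  next
    case 8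
    then show ?thesis
      using i c kl b chain_above[of k "l - k - 1" i b c]
      by (simp add: symb_def wsym_def wact_eq transpose_def)
  qed
qed

lemma conj_compatible_s:
  assumes "1 \<le> i" "i < n" "c \<in> carrier G"
  shows "conj_compatible (s i c) (wsym G n (i, i + 1, c))"
proof -
  let ?w = "wsym G n (i, i + 1, c)"
  have w: "?w \<in> carrier (wreath_product G n)"
    using assms by (intro G.wsym_closed) auto
  have "s i c \<otimes> symb y = symb (wact G ?w y) \<otimes> s i c" if y: "y \<in> symbols G n" for y
  proof -
    have "cnj i c (symb y) = symb (wact G ?w y)"
    proof -
      obtain k l b where y': "y = (k, l, b)" by (cases y)
      show ?thesis
      proof (cases "k < l")
        case True
        then show ?thesis using y' y assms cnj_symb_ascending by auto
      next
        case False
        then have "cnj i c (symb (symbol_swap G y)) = symb (wact G ?w (symbol_swap G y))"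
          using y y' assms cnj_symb_ascending by (auto simp: symbol_swap_def)
        then show ?thesis
          using y w by (simp add: symb_swap wact_swap G.wact_closed)
      qed
    qed
    then show ?thesis
      using assms y w by (simp add: cnj_eq_iff symb_closed G.wact_closed)
  qed
  then show ?thesis
    using w assms by (simp add: conj_compatible_def)
qed

text \<open>The chain is a product of generators, and the same product taken in the wreath product
  collapses to the matrix of (i, i + d + 1, a).\<close>

lemma conj_compatible_chain:
  assumes "1 \<le> i" "i + d < n" "a \<in> carrier G"
  shows "conj_compatible (chain i a d) (wsym G n (i, i + d + 1, a))"
  using assms
proof (induction d)
  case 0
  then show ?case using conj_compatible_s by simp
next
  case (Suc d)
  interpret W: symbol_system G "wreath_product G n" n "wsym G n"
    by (rule symbol_system_wsym) (rule G.group_axioms)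
  let ?j = "i + d + 1"
  let ?t = "wsym G n (?j, ?j + 1, \<one>\<^bsub>G\<^esub>)"
  have "conj_compatible (s ?j \<one>\<^bsub>G\<^esub>) ?t"
    using Suc.prems conj_compatible_s[of ?j "\<one>\<^bsub>G\<^esub>"] by simp
  then have 1: "conj_compatible (chain i a (Suc d))
    (?t \<otimes>\<^bsub>wreath_product G n\<^esub> wsym G n (i, ?j, a) \<otimes>\<^bsub>wreath_product G n\<^esub> ?t)"
    using Suc unfolding chain.simps cnj_def by (intro conj_compatible_mult) auto
  have act: "wact G ?t (i, ?j, a) = (i, ?j + 1, a)"
    using Suc.prems by (simp add: wsym_def wact_eq)
  have "?t \<otimes>\<^bsub>wreath_product G n\<^esub> wsym G n (i, ?j, a) = wsym G n (i, ?j + 1, a) \<otimes>\<^bsub>wreath_product G n\<^esub> ?t"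
    using Suc.prems W.sym_conj[of "(?j, ?j + 1, \<one>\<^bsub>G\<^esub>)" "(i, ?j, a)"] by (simp add: act[simplified])
  then have "?t \<otimes>\<^bsub>wreath_product G n\<^esub> wsym G n (i, ?j, a) \<otimes>\<^bsub>wreath_product G n\<^esub> ?t = wsym G n (i, ?j + 1, a)"
    using Suc.prems W.sym_square[of "(?j, ?j + 1, \<one>\<^bsub>G\<^esub>)"] by (simp add: W.H.m_assoc)
  with 1 show ?case by simp
qed

lemma symbol_system_symb: "symbol_system G S n symb"
proof
  fix x y assume x: "x \<in> symbols G n" and y: "y \<in> symbols G n"
  obtain i j a where x': "x = (i, j, a)" by (cases x)
  have "conj_compatible (symb x) (wsym G n x)"
  proof (cases "i < j")
    case True
    then have "i + (j - i - 1) < n" "1 \<le> i" "a \<in> carrier G" using x x' by auto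
    then show ?thesis
      using True x' conj_compatible_chain[of i "j - i - 1" a] by (simp add: symb_def)
  next
    case False
    interpret W: symbol_system G "wreath_product G n" n "wsym G n"
      by (rule symbol_system_wsym) (rule G.group_axioms)
    have "j + (i - j - 1) < n" "1 \<le> j" "a \<in> carrier G" "j < i" using False x x' by auto
    then show ?thesis
      using x x' conj_compatible_chain[of j "i - j - 1" "inv\<^bsub>G\<^esub> a"] W.sym_swap'[of j i a]
      by (simp add: symb_def)
  qed
  then show "symb x \<otimes> symb y = symb (wact G (wsym G n x) y) \<otimes> symb x"
    using y by (simp add: conj_compatible_def)
qed (auto simp: symb_closed symb_swap symb_square)

end

section \<open>The crossed module\<close>

lemma (in group) inv_cancel_left [simp]:
  "x \<in> carrier G \<Longrightarrow> y \<in> carrier G \<Longrightarrow> inv x \<otimes> (x \<otimes> y) = y"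
  "x \<in> carrier G \<Longrightarrow> y \<in> carrier G \<Longrightarrow> x \<otimes> (inv x \<otimes> y) = y"
  by (simp_all flip: m_assoc)

lemma (in group) conj_hom:
  assumes "g \<in> carrier G"
  shows "(\<lambda>x. g \<otimes> x \<otimes> inv g) \<in> hom G G"
  using assms by (intro homI) (auto simp: m_assoc)

locale Sn_setting = group G for G :: "('a, 'b) monoid_scheme" (structure) +
  fixes n :: nat
  assumes three_le: "3 \<le> n"
begin

abbreviation SG :: "(nat \<times> 'a) word set monoid" where "SG \<equiv> Sn_group G n"
abbreviation WG :: "((nat \<Rightarrow> 'a) \<times> (nat \<Rightarrow> nat)) monoid" where "WG \<equiv> wreath_product G n"

sublocale S: braid_system G SG n "sgen G n"
proof -
  interpret S: group SG by (rule group_Sn)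
  show "braid_system G SG n (sgen G n)"
  proof
    show "sgen G n i a \<otimes>\<^bsub>SG\<^esub> sgen G n j b = sgen G n j b \<otimes>\<^bsub>SG\<^esub> sgen G n i a"
      if "1 \<le> i" "i + 2 \<le> j" "j < n" "a \<in> carrier G" "b \<in> carrier G" for i j a b
      using that by (intro sgen_commute) auto
  qed (use three_le in \<open>auto simp: sgen_square sgen_braid[simplified]\<close>)
qed

abbreviation ssym :: "nat \<times> nat \<times> 'a \<Rightarrow> (nat \<times> 'a) word set" where "ssym \<equiv> S.symb"

sublocale S: symbol_system G SG n ssym
  by (rule S.symbol_system_symb)

sublocale W: symbol_system G WG n "wsym G n"
  by (rule symbol_system_wsym) (rule group_axioms)

lemma generate_ssym: "carrier SG = generate SG (ssym ` symbols G n)"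
proof
  have "{sgen G n i a | i a. 1 \<le> i \<and> i < n \<and> a \<in> carrier G} \<subseteq> ssym ` symbols G n"
  proof clarify
    fix i a assume "1 \<le> i" "i < n" "a \<in> carrier G"
    then show "sgen G n i a \<in> ssym ` symbols G n"
      using S.symb_adjacent[of i a] by (intro image_eqI[of _ _ "(i, i + 1, a)"]) auto
  qed
  then show "carrier SG \<subseteq> generate SG (ssym ` symbols G n)"
    unfolding generate_Sn by (rule S.S.mono_generate)
  show "generate SG (ssym ` symbols G n) \<subseteq> carrier SG"
    by (rule S.S.generate_incl) auto
qed

lemma Sn_hom_eq:
  assumes "group H" "f \<in> hom SG H" "f' \<in> hom SG H"
    and "\<And>x. x \<in> symbols G n \<Longrightarrow> f (ssym x) = f' (ssym x)" and "m \<in> carrier SG"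
  shows "f m = f' m"
proof (rule hom_eq_on_generate[OF S.S.group_axioms assms(1-3), of "ssym ` symbols G n"])
  show "m \<in> generate SG (ssym ` symbols G n)" using assms(5) by (simp only: generate_ssym)
qed (use assms(4) in auto)

text \<open>Together with \<open>symbol_system_symb\<close> this says that
  \<open>S\<^sub>n(G)\<close> is presented by all symbols. Every non-adjacent symbol is a conjugate
  of an adjacent one, both in \<open>S\<^sub>n(G)\<close> and in the target, so values on generators
  determine the rest.\<close>

lemma Sn_lift:
  fixes H :: "('h, 'd) monoid_scheme" and sym :: "nat \<times> nat \<times> 'a \<Rightarrow> 'h"
  assumes "symbol_system G H n sym"
  shows "\<exists>\<Phi>. \<Phi> \<in> hom SG H \<and> (\<forall>x \<in> symbols G n. \<Phi> (ssym x) = sym x)"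
proof -
  interpret H: symbol_system G H n sym by fact
  obtain \<Phi> where \<Phi>: "\<Phi> \<in> hom SG H"
    "\<And>i a. 1 \<le> i \<Longrightarrow> i < n \<Longrightarrow> a \<in> carrier G \<Longrightarrow> \<Phi> (sgen G n i a) = sym (i, i + 1, a)"
    using H.Sn_universal by metis
  interpret \<Phi>: group_hom SG H \<Phi>
    using \<Phi>(1) by (simp add: group_hom_def group_hom_axioms_def S.S.group_axioms H.H.group_axioms)
  have chain: "\<Phi> (S.chain i a d) = sym (i, i + d + 1, a)" if "1 \<le> i" "i + d < n" "a \<in> carrier G" for i a d
    using that
  proof (induction d)
    case 0
    then show ?case by (simp add: \<Phi>(2))
  next
    case (Suc d)
    let ?j = "i + d + 1"
    have "\<Phi> (S.chain i a (Suc d)) = sym (?j, ?j + 1, \<one>) \<otimes>\<^bsub>H\<^esub> sym (i, ?j, a) \<otimes>\<^bsub>H\<^esub> sym (?j, ?j + 1, \<one>)"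
      using Suc by (simp add: S.cnj_def \<Phi>(2))
    also have "sym (?j, ?j + 1, \<one>) \<otimes>\<^bsub>H\<^esub> sym (i, ?j, a) = sym (i, ?j + 1, a) \<otimes>\<^bsub>H\<^esub> sym (?j, ?j + 1, \<one>)"
      using Suc.prems by (subst H.sym_conj) (auto simp: wsym_def wact_eq transpose_def)
    finally show ?case
      using Suc.prems by (simp add: H.H.m_assoc H.sym_square)
  qed
  have "\<Phi> (ssym x) = sym x" if x: "x \<in> symbols G n" for x
  proof -
    obtain i j a where x': "x = (i, j, a)" by (cases x)
    show ?thesis
    proof (cases "i < j")
      case True
      then have "i + (j - i - 1) < n" "1 \<le> i" "a \<in> carrier G" using x x' by auto
      then show ?thesis
        using x' True chain[of i "j - i - 1" a] by (simp add: S.symb_def)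
    next
      case False
      then have "j + (i - j - 1) < n" "1 \<le> j" "a \<in> carrier G" "j < i" using x x' by auto
      then show ?thesis
        using x x' chain[of j "i - j - 1" "inv a"] H.sym_swap'[of j i a] by (simp add: S.symb_def)
    qed
  qed
  then show ?thesis using \<Phi>(1) by blast
qed

section \<open>The map to the wreath product and the action on symbols\<close>

definition mu :: "(nat \<times> 'a) word set \<Rightarrow> (nat \<Rightarrow> 'a) \<times> (nat \<Rightarrow> nat)"
  where "mu = (SOME \<Phi>. \<Phi> \<in> hom SG WG \<and> (\<forall>x \<in> symbols G n. \<Phi> (ssym x) = wsym G n x))"

lemma mu_spec: "mu \<in> hom SG WG \<and> (\<forall>x \<in> symbols G n. mu (ssym x) = wsym G n x)"
  unfolding mu_def by (rule someI_ex[OF Sn_lift[OF W.symbol_system_axioms]])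

lemma mu_hom: "mu \<in> hom SG WG" and mu_ssym: "x \<in> symbols G n \<Longrightarrow> mu (ssym x) = wsym G n x"
  using mu_spec by blast+

sublocale mu: group_hom SG WG mu
  using mu_hom by (simp add: group_hom_def group_hom_axioms_def S.S.group_axioms W.H.group_axioms)

text \<open>A left action, convenient for computation; the right action of the crossed module is
  obtained from it through inverses.\<close>

definition Act :: "(nat \<Rightarrow> 'a) \<times> (nat \<Rightarrow> nat) \<Rightarrow> (nat \<times> 'a) word set \<Rightarrow> (nat \<times> 'a) word set"
  where "Act w = (SOME \<Phi>. \<Phi> \<in> hom SG SG \<and> (\<forall>x \<in> symbols G n. \<Phi> (ssym x) = ssym (wact G w x)))"

text \<open>Moving symbols by w respects conjugation because the matrix of the moved symbol is the
  w-conjugate of the original matrix; the relations are therefore preserved and w induces an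
  endomorphism.\<close>

lemma symbol_system_wact:
  assumes w: "w \<in> carrier WG"
  shows "symbol_system G SG n (\<lambda>x. ssym (wact G w x))"
proof
  fix x y assume x: "x \<in> symbols G n" and y: "y \<in> symbols G n"
  have "wact G (wsym G n (wact G w x)) (wact G w y) = wact G (wsym G n (wact G w x) \<otimes>\<^bsub>WG\<^esub> w) y"
    using w x y by (simp add: wact_mult wact_closed)
  also have "\<dots> = wact G w (wact G (wsym G n x) y)"
    unfolding wsym_conj[OF w x, symmetric] using w x y by (simp add: wact_mult)
  finally show "ssym (wact G w x) \<otimes>\<^bsub>SG\<^esub> ssym (wact G w y) =
      ssym (wact G w (wact G (wsym G n x) y)) \<otimes>\<^bsub>SG\<^esub> ssym (wact G w x)"
    using w x y S.sym_conj[of "wact G w x" "wact G w y"] by (simp add: wact_closed)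
qed (use w in \<open>auto simp: wact_closed S.sym_square S.wact_swap S.sym_swap\<close>)

lemma Act_spec:
  assumes "w \<in> carrier WG"
  shows "Act w \<in> hom SG SG \<and> (\<forall>x \<in> symbols G n. Act w (ssym x) = ssym (wact G w x))"
  unfolding Act_def by (rule someI_ex[OF Sn_lift[OF symbol_system_wact[OF assms]]])

lemma Act_hom: "w \<in> carrier WG \<Longrightarrow> Act w \<in> hom SG SG"
  using Act_spec by blast

lemma Act_ssym: "w \<in> carrier WG \<Longrightarrow> x \<in> symbols G n \<Longrightarrow> Act w (ssym x) = ssym (wact G w x)"
  using Act_spec by blast

lemma Act_group_hom: "w \<in> carrier WG \<Longrightarrow> group_hom SG SG (Act w)"
  using Act_hom by (simp add: group_hom_def group_hom_axioms_def S.S.group_axioms)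

lemma Act_closed [simp]: "w \<in> carrier WG \<Longrightarrow> m \<in> carrier SG \<Longrightarrow> Act w m \<in> carrier SG"
  using Act_hom hom_in_carrier by metis

lemma Act_mult [simp]:
  "w \<in> carrier WG \<Longrightarrow> m \<in> carrier SG \<Longrightarrow> m' \<in> carrier SG \<Longrightarrow>
    Act w (m \<otimes>\<^bsub>SG\<^esub> m') = Act w m \<otimes>\<^bsub>SG\<^esub> Act w m'"
  using Act_hom hom_mult by metis

lemma Act_inv [simp]:
  "w \<in> carrier WG \<Longrightarrow> m \<in> carrier SG \<Longrightarrow> Act w (inv\<^bsub>SG\<^esub> m) = inv\<^bsub>SG\<^esub> Act w m"
  by (rule group_hom.hom_inv[OF Act_group_hom])

lemma Act_one:
  assumes "m \<in> carrier SG"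
  shows "Act \<one>\<^bsub>WG\<^esub> m = m"
proof (rule Sn_hom_eq[OF S.S.group_axioms _ _ _ assms, where f = "Act \<one>\<^bsub>WG\<^esub>" and f' = "\<lambda>m. m"])
  show "(\<lambda>m. m) \<in> hom SG SG" by (auto simp: hom_def)
qed (simp_all add: Act_hom Act_ssym wact_one)

lemma Act_Act:
  assumes "w \<in> carrier WG" "w' \<in> carrier WG" "m \<in> carrier SG"
  shows "Act w (Act w' m) = Act (w \<otimes>\<^bsub>WG\<^esub> w') m"
proof (rule Sn_hom_eq[OF S.S.group_axioms _ _ _ assms(3), where f = "\<lambda>m. Act w (Act w' m)" and f' = "Act (w \<otimes>\<^bsub>WG\<^esub> w')"])
  show "(\<lambda>m. Act w (Act w' m)) \<in> hom SG SG"
    using assms by (intro homI) auto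
qed (use assms in \<open>auto simp: Act_ssym Act_hom wact_mult wact_closed\<close>)

lemma mu_Act:
  assumes "w \<in> carrier WG" "m \<in> carrier SG"
  shows "mu (Act w m) = w \<otimes>\<^bsub>WG\<^esub> mu m \<otimes>\<^bsub>WG\<^esub> inv\<^bsub>WG\<^esub> w"
proof (rule Sn_hom_eq[OF W.H.group_axioms _ _ _ assms(2), where f = "\<lambda>m. mu (Act w m)" and f' = "\<lambda>m. w \<otimes>\<^bsub>WG\<^esub> mu m \<otimes>\<^bsub>WG\<^esub> inv\<^bsub>WG\<^esub> w"])
  show "(\<lambda>m. mu (Act w m)) \<in> hom SG WG"
    using assms by (intro homI) auto
  show "(\<lambda>m. w \<otimes>\<^bsub>WG\<^esub> mu m \<otimes>\<^bsub>WG\<^esub> inv\<^bsub>WG\<^esub> w) \<in> hom SG WG"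
    using assms(1) by (intro homI) (auto simp: W.H.m_assoc)
  show "mu (Act w (ssym x)) = w \<otimes>\<^bsub>WG\<^esub> mu (ssym x) \<otimes>\<^bsub>WG\<^esub> inv\<^bsub>WG\<^esub> w" if "x \<in> symbols G n" for x
    using that assms by (simp add: Act_ssym mu_ssym wact_closed wsym_conj W.H.m_assoc)
qed

text \<open>This is the Peiffer identity for the left action. When m' and m are symbols it is the
  conjugation relation; a homomorphism argument extends it in m, and multiplicativity of both sides
  extends it in m'.\<close>

lemma conj_eq_Act:
  assumes "m' \<in> carrier SG" "m \<in> carrier SG"
  shows "m' \<otimes>\<^bsub>SG\<^esub> m = Act (mu m') m \<otimes>\<^bsub>SG\<^esub> m'"
proof -
  have "m' \<in> generate SG (ssym ` symbols G n)" using assms(1) by (simp flip: generate_ssym)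
  then have "\<forall>m \<in> carrier SG. m' \<otimes>\<^bsub>SG\<^esub> m \<otimes>\<^bsub>SG\<^esub> inv\<^bsub>SG\<^esub> m' = Act (mu m') m"
  proof induction
    case one
    then show ?case by (simp add: Act_one)
  next
    case (incl h)
    then obtain x where x: "x \<in> symbols G n" "h = ssym x" by auto
    show ?case
    proof
      fix m assume m: "m \<in> carrier SG"
      show "h \<otimes>\<^bsub>SG\<^esub> m \<otimes>\<^bsub>SG\<^esub> inv\<^bsub>SG\<^esub> h = Act (mu h) m"
      proof (rule Sn_hom_eq[OF S.S.group_axioms _ _ _ m, where f = "\<lambda>m. h \<otimes>\<^bsub>SG\<^esub> m \<otimes>\<^bsub>SG\<^esub> inv\<^bsub>SG\<^esub> h" and f' = "Act (mu h)"])
        show "(\<lambda>m. h \<otimes>\<^bsub>SG\<^esub> m \<otimes>\<^bsub>SG\<^esub> inv\<^bsub>SG\<^esub> h) \<in> hom SG SG"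
          using x by (intro S.S.conj_hom) auto
        show "h \<otimes>\<^bsub>SG\<^esub> ssym y \<otimes>\<^bsub>SG\<^esub> inv\<^bsub>SG\<^esub> h = Act (mu h) (ssym y)" if "y \<in> symbols G n" for y
          using that x S.sym_conj[OF x(1) that] by (simp add: mu_ssym Act_ssym S.S.m_assoc wact_closed)
      qed (use x in \<open>simp add: Act_hom\<close>)
    qed
  next
    case (inv h)
    then obtain x where x: "x \<in> symbols G n" "h = ssym x" by auto
    show ?case
    proof
      fix m assume m: "m \<in> carrier SG"
      show "inv\<^bsub>SG\<^esub> h \<otimes>\<^bsub>SG\<^esub> m \<otimes>\<^bsub>SG\<^esub> inv\<^bsub>SG\<^esub> (inv\<^bsub>SG\<^esub> h) = Act (mu (inv\<^bsub>SG\<^esub> h)) m"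
      proof (rule Sn_hom_eq[OF S.S.group_axioms _ _ _ m, where f = "\<lambda>m. inv\<^bsub>SG\<^esub> h \<otimes>\<^bsub>SG\<^esub> m \<otimes>\<^bsub>SG\<^esub> inv\<^bsub>SG\<^esub> (inv\<^bsub>SG\<^esub> h)" and f' = "Act (mu (inv\<^bsub>SG\<^esub> h))"])
        show "(\<lambda>m. inv\<^bsub>SG\<^esub> h \<otimes>\<^bsub>SG\<^esub> m \<otimes>\<^bsub>SG\<^esub> inv\<^bsub>SG\<^esub> (inv\<^bsub>SG\<^esub> h)) \<in> hom SG SG"
          using x by (intro S.S.conj_hom) auto
        show "inv\<^bsub>SG\<^esub> h \<otimes>\<^bsub>SG\<^esub> ssym y \<otimes>\<^bsub>SG\<^esub> inv\<^bsub>SG\<^esub> (inv\<^bsub>SG\<^esub> h) = Act (mu (inv\<^bsub>SG\<^esub> h)) (ssym y)"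
          if "y \<in> symbols G n" for y
          using that x S.sym_conj[OF x(1) that]
          by (simp add: S.inv_sym mu_ssym Act_ssym S.S.m_assoc wact_closed S.sym_square)
      qed (use x in \<open>simp add: Act_hom\<close>)
    qed
  next
    case (eng h h')
    have h: "h \<in> carrier SG" "h' \<in> carrier SG" using eng.hyps by (simp_all flip: generate_ssym)
    show ?case
    proof
      fix m assume m: "m \<in> carrier SG"
      have "h \<otimes>\<^bsub>SG\<^esub> h' \<otimes>\<^bsub>SG\<^esub> m \<otimes>\<^bsub>SG\<^esub> inv\<^bsub>SG\<^esub> (h \<otimes>\<^bsub>SG\<^esub> h') =
        h \<otimes>\<^bsub>SG\<^esub> (h' \<otimes>\<^bsub>SG\<^esub> m \<otimes>\<^bsub>SG\<^esub> inv\<^bsub>SG\<^esub> h') \<otimes>\<^bsub>SG\<^esub> inv\<^bsub>SG\<^esub> h"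
        using h m by (simp add: S.S.m_assoc S.S.inv_mult_group)
      also have "\<dots> = Act (mu (h \<otimes>\<^bsub>SG\<^esub> h')) m"
        using h m eng.IH by (simp add: Act_Act)
      finally show "h \<otimes>\<^bsub>SG\<^esub> h' \<otimes>\<^bsub>SG\<^esub> m \<otimes>\<^bsub>SG\<^esub> inv\<^bsub>SG\<^esub> (h \<otimes>\<^bsub>SG\<^esub> h') = Act (mu (h \<otimes>\<^bsub>SG\<^esub> h')) m" .
    qed
  qed
  then have "m' \<otimes>\<^bsub>SG\<^esub> m \<otimes>\<^bsub>SG\<^esub> inv\<^bsub>SG\<^esub> m' = Act (mu m') m" using assms(2) by blast
  then have "m' \<otimes>\<^bsub>SG\<^esub> m \<otimes>\<^bsub>SG\<^esub> inv\<^bsub>SG\<^esub> m' \<otimes>\<^bsub>SG\<^esub> m' = Act (mu m') m \<otimes>\<^bsub>SG\<^esub> m'" by simp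
  then show ?thesis using assms by (simp add: S.S.m_assoc)
qed

theorem crossed_module_mu: "crossed_module SG WG mu (\<lambda>w. Act (inv\<^bsub>WG\<^esub> w))"
proof
  fix w assume w: "w \<in> carrier WG"
  show "Act (inv\<^bsub>WG\<^esub> w) \<in> iso SG SG"
  proof (rule isoI)
    have "Act (inv\<^bsub>WG\<^esub> w) (Act w m) = m" "Act w (Act (inv\<^bsub>WG\<^esub> w) m) = m" if "m \<in> carrier SG" for m
      using w that by (simp_all add: Act_Act Act_one)
    then show "bij_betw (Act (inv\<^bsub>WG\<^esub> w)) (carrier SG) (carrier SG)"
      using w by (intro bij_betw_byWitness[where f' = "Act w"]) auto
  qed (use w Act_hom in auto)
  fix m assume m: "m \<in> carrier SG"
  show "mu (Act (inv\<^bsub>WG\<^esub> w) m) = inv\<^bsub>WG\<^esub> w \<otimes>\<^bsub>WG\<^esub> mu m \<otimes>\<^bsub>WG\<^esub> w"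
    using w m by (simp add: mu_Act)
  fix w' assume w': "w' \<in> carrier WG"
  show "Act (inv\<^bsub>WG\<^esub> (w \<otimes>\<^bsub>WG\<^esub> w')) m = Act (inv\<^bsub>WG\<^esub> w') (Act (inv\<^bsub>WG\<^esub> w) m)"
    using w w' m by (simp add: Act_Act W.H.inv_mult_group)
next
  fix m m' assume m: "m \<in> carrier SG" "m' \<in> carrier SG"
  have "inv\<^bsub>SG\<^esub> m' \<otimes>\<^bsub>SG\<^esub> m = Act (inv\<^bsub>WG\<^esub> (mu m')) m \<otimes>\<^bsub>SG\<^esub> inv\<^bsub>SG\<^esub> m'"
    using conj_eq_Act[of "inv\<^bsub>SG\<^esub> m'" m] m by simp
  then show "inv\<^bsub>SG\<^esub> m' \<otimes>\<^bsub>SG\<^esub> m \<otimes>\<^bsub>SG\<^esub> m' = Act (inv\<^bsub>WG\<^esub> (mu m')) m"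
    using m by (simp add: S.S.m_assoc)
qed (simp add: Act_one)

end

section \<open>The kernel of \<open>\<mu>\<close>\<close>

definition wdiag :: "('a, 'b) monoid_scheme \<Rightarrow> nat \<Rightarrow> nat \<Rightarrow> 'a \<Rightarrow> (nat \<Rightarrow> 'a) \<times> (nat \<Rightarrow> nat)"
  where "wdiag G n i g = (\<lambda>k\<in>{1..n}. if k = i then g else \<one>\<^bsub>G\<^esub>, id)"

context group
begin

lemma wdiag_closed [simp]: "g \<in> carrier G \<Longrightarrow> wdiag G n i g \<in> carrier (wreath_product G n)"
  by (auto simp: wdiag_def carrier_wreath permutes_id)

lemma wdiag_mult:
  "g \<in> carrier G \<Longrightarrow> h \<in> carrier G \<Longrightarrow>
    wdiag G n i g \<otimes>\<^bsub>wreath_product G n\<^esub> wdiag G n i h = wdiag G n i (g \<otimes> h)"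
  by (auto simp: wdiag_def mult_wreath fun_eq_iff)

lemma wdiag_one: "wdiag G n i \<one> = \<one>\<^bsub>wreath_product G n\<^esub>"
  by (auto simp: wdiag_def one_wreath)

lemma wdiag_commute:
  "i \<noteq> j \<Longrightarrow> g \<in> carrier G \<Longrightarrow> h \<in> carrier G \<Longrightarrow>
    wdiag G n i g \<otimes>\<^bsub>wreath_product G n\<^esub> wdiag G n j h = wdiag G n j h \<otimes>\<^bsub>wreath_product G n\<^esub> wdiag G n i g"
  by (auto simp: wdiag_def mult_wreath fun_eq_iff)

lemma inv_wdiag:
  assumes "g \<in> carrier G"
  shows "inv\<^bsub>wreath_product G n\<^esub> (wdiag G n i g) = wdiag G n i (inv g)"
proof -
  interpret W: group "wreath_product G n" by (rule group_wreath) (rule group_axioms)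
  show ?thesis
    using assms by (intro W.inv_equality) (auto simp: wdiag_mult wdiag_one)
qed

lemma wsym_wsym:
  assumes "i \<in> {1..n}" "j \<in> {1..n}" "i \<noteq> j" "a \<in> carrier G"
  shows "wsym G n (i, j, a) \<otimes>\<^bsub>wreath_product G n\<^esub> wsym G n (i, j, \<one>) =
    wdiag G n i a \<otimes>\<^bsub>wreath_product G n\<^esub> wdiag G n j (inv a)"
  using assms by (auto simp: wdiag_def wsym_def mult_wreath fun_eq_iff)

end

section \<open>Lifts of diagonal matrices and of commutators\<close>

context Sn_setting
begin

abbreviation diag_act :: "nat \<Rightarrow> 'a \<Rightarrow> (nat \<times> 'a) word set \<Rightarrow> (nat \<times> 'a) word set"
  where "diag_act i g \<equiv> Act (wdiag G n i g)"

lemma diag_act_ssym: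
  assumes "i \<in> {1..n}" "k \<in> {1..n}" "l \<in> {1..n}" "k \<noteq> l" "b \<in> carrier G" "g \<in> carrier G"
  shows "diag_act i g (ssym (k, l, b)) =
    ssym (k, l, if k = i then g \<otimes> b else if l = i then b \<otimes> inv g else b)"
proof -
  have "wact G (wdiag G n i g) (k, l, b) = (k, l, if k = i then g \<otimes> b else if l = i then b \<otimes> inv g else b)"
    using assms by (auto simp: wact_eq wdiag_def)
  then show ?thesis
    using assms by (simp add: Act_ssym)
qed

text \<open>A lift of the diagonal matrix with \<open>a\<close> in position i and
  \<open>a\<inverse>\<close> in position j, in analogy with the elements
  \<open>h\<^sub>i\<^sub>j\<close> of a Steinberg group.\<close>

definition hh :: "nat \<Rightarrow> nat \<Rightarrow> 'a \<Rightarrow> (nat \<times> 'a) word set"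
  where "hh i j a = ssym (i, j, a) \<otimes>\<^bsub>SG\<^esub> ssym (i, j, \<one>)"

lemma hh_closed [simp]:
  "i \<in> {1..n} \<Longrightarrow> j \<in> {1..n} \<Longrightarrow> i \<noteq> j \<Longrightarrow> a \<in> carrier G \<Longrightarrow> hh i j a \<in> carrier SG"
  by (simp add: hh_def del: atLeastAtMost_iff)

lemma mu_hh:
  assumes "i \<in> {1..n}" "j \<in> {1..n}" "i \<noteq> j" "a \<in> carrier G"
  shows "mu (hh i j a) = wdiag G n i a \<otimes>\<^bsub>WG\<^esub> wdiag G n j (inv a)"
  using assms wsym_wsym[OF assms] by (simp add: hh_def mu_ssym)

lemma inv_hh:
  assumes "i \<in> {1..n}" "j \<in> {1..n}" "i \<noteq> j" "a \<in> carrier G"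
  shows "inv\<^bsub>SG\<^esub> hh i j a = ssym (i, j, \<one>) \<otimes>\<^bsub>SG\<^esub> ssym (i, j, a)"
  using assms by (simp add: hh_def S.S.inv_mult_group S.inv_sym)

text \<open>Conjugation by \<open>hh i j a\<close> acts by both diagonal entries; an element fixed
  by the entry at j only sees the entry at i.\<close>

lemma hh_conj:
  assumes "i \<in> {1..n}" "j \<in> {1..n}" "i \<noteq> j" "a \<in> carrier G" "m \<in> carrier SG"
    and fixed: "diag_act j (inv a) m = m"
  shows "hh i j a \<otimes>\<^bsub>SG\<^esub> m = diag_act i a m \<otimes>\<^bsub>SG\<^esub> hh i j a"
  using assms conj_eq_Act[of "hh i j a" m] by (simp add: mu_hh flip: Act_Act)

text \<open>The commutator of \<open>hh i j g\<close> with a diagonal entry y at i, formed without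
  having that entry in \<open>S\<^sub>n(G)\<close>. Its image is the commutator of g and y at
  position i, by \<open>mu_cc\<close>.\<close>

definition cc :: "nat \<Rightarrow> nat \<Rightarrow> 'a \<Rightarrow> 'a \<Rightarrow> (nat \<times> 'a) word set"
  where "cc i j g y = hh i j g \<otimes>\<^bsub>SG\<^esub> inv\<^bsub>SG\<^esub> diag_act i y (hh i j g)"

lemma diag_act_hh:
  assumes "p \<in> {1..n}" "i \<in> {1..n}" "j \<in> {1..n}" "i \<noteq> j" "a \<in> carrier G" "g \<in> carrier G" "p \<noteq> j"
  shows "diag_act p g (hh i j a) =
    (if p = i then ssym (i, j, g \<otimes> a) \<otimes>\<^bsub>SG\<^esub> ssym (i, j, g) else hh i j a)"
  using assms by (simp add: hh_def diag_act_ssym)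

lemma cc_eq:
  assumes "i \<in> {1..n}" "j \<in> {1..n}" "i \<noteq> j" "x \<in> carrier G" "y \<in> carrier G"
  shows "cc i j x y = ssym (i, j, x) \<otimes>\<^bsub>SG\<^esub> ssym (i, j, \<one>) \<otimes>\<^bsub>SG\<^esub> ssym (i, j, y) \<otimes>\<^bsub>SG\<^esub> ssym (i, j, y \<otimes> x)"
  using assms by (simp add: cc_def diag_act_hh S.S.inv_mult_group S.inv_sym)
    (simp add: hh_def S.S.m_assoc)

lemma cc_closed [simp]:
  "i \<in> {1..n} \<Longrightarrow> j \<in> {1..n} \<Longrightarrow> i \<noteq> j \<Longrightarrow> x \<in> carrier G \<Longrightarrow> y \<in> carrier G \<Longrightarrow> cc i j x y \<in> carrier SG"
  by (simp add: cc_def)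

text \<open>Both sides are the commutator of \<open>hh i j x\<close> and \<open>hh i k y\<close>.\<close>

lemma cc_commutator:
  assumes ijk: "i \<in> {1..n}" "j \<in> {1..n}" "k \<in> {1..n}" "i \<noteq> j" "i \<noteq> k" "j \<noteq> k"
    and xy: "x \<in> carrier G" "y \<in> carrier G"
  shows "cc i j x y = diag_act i x (hh i k y) \<otimes>\<^bsub>SG\<^esub> inv\<^bsub>SG\<^esub> hh i k y"
proof -
  have 1: "diag_act i y (hh i j x) \<otimes>\<^bsub>SG\<^esub> hh i k y = hh i k y \<otimes>\<^bsub>SG\<^esub> hh i j x"
    using ijk xy hh_conj[of i k y "hh i j x"] by (simp add: diag_act_hh)
  have 2: "hh i j x \<otimes>\<^bsub>SG\<^esub> hh i k y = diag_act i x (hh i k y) \<otimes>\<^bsub>SG\<^esub> hh i j x"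
    using ijk xy hh_conj[of i j x "hh i k y"] by (simp add: diag_act_hh)
  have "diag_act i y (hh i j x) = hh i k y \<otimes>\<^bsub>SG\<^esub> hh i j x \<otimes>\<^bsub>SG\<^esub> inv\<^bsub>SG\<^esub> hh i k y"
    using ijk xy by (simp add: S.S.inv_solve_right 1)
  then have "cc i j x y = hh i j x \<otimes>\<^bsub>SG\<^esub> hh i k y \<otimes>\<^bsub>SG\<^esub> inv\<^bsub>SG\<^esub> hh i j x \<otimes>\<^bsub>SG\<^esub> inv\<^bsub>SG\<^esub> hh i k y"
    using ijk xy by (simp add: cc_def S.S.inv_mult_group S.S.m_assoc)
  also have "\<dots> = diag_act i x (hh i k y) \<otimes>\<^bsub>SG\<^esub> inv\<^bsub>SG\<^esub> hh i k y"
    unfolding 2 using ijk xy by (simp add: S.S.m_assoc)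
  finally show ?thesis .
qed

lemma obtain_third:
  assumes "3 \<le> m"
  obtains k where "k \<in> {1..m}" "k \<noteq> i" "k \<noteq> (j :: nat)"
proof -
  have "1 \<in> {1..m}" "2 \<in> {1..m}" "3 \<in> {1..m}" using assms by auto
  moreover have "(1::nat) \<noteq> i \<and> 1 \<noteq> j \<or> 2 \<noteq> i \<and> 2 \<noteq> j \<or> 3 \<noteq> i \<and> 3 \<noteq> j" by arith
  ultimately show thesis using that by blast
qed

text \<open>With a third index k, the expression from \<open>cc_commutator\<close> involves only
  symbols with indices i and k, on which a diagonal entry at j acts trivially.\<close>

lemma cc_fixed:
  assumes ij: "i \<in> {1..n}" "j \<in> {1..n}" "i \<noteq> j"
    and xyz: "x \<in> carrier G" "y \<in> carrier G" "z \<in> carrier G"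
  shows "diag_act j z (cc i j x y) = cc i j x y"
proof -
  obtain k where k: "k \<in> {1..n}" "k \<noteq> i" "k \<noteq> j" using three_le obtain_third by metis
  have "diag_act j z (diag_act i x (hh i k y)) = diag_act i x (diag_act j z (hh i k y))"
    using ij k xyz by (simp add: Act_Act wdiag_commute)
  then show ?thesis
    using ij k xyz by (simp add: cc_commutator[of i j k] diag_act_hh)
qed

lemma mu_cc:
  assumes "i \<in> {1..n}" "j \<in> {1..n}" "i \<noteq> j" "x \<in> carrier G" "y \<in> carrier G"
  shows "mu (cc i j x y) = wdiag G n i (x \<otimes> y \<otimes> inv x \<otimes> inv y)"
proof -
  let ?x = "wdiag G n i x" and ?x' = "wdiag G n j (inv x)" and ?y = "wdiag G n i y"
  have comm: "?x' \<otimes>\<^bsub>WG\<^esub> (?y \<otimes>\<^bsub>WG\<^esub> w) = ?y \<otimes>\<^bsub>WG\<^esub> (?x' \<otimes>\<^bsub>WG\<^esub> w)" if "w \<in> carrier WG" for w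
  proof -
    have "?x' \<otimes>\<^bsub>WG\<^esub> ?y = ?y \<otimes>\<^bsub>WG\<^esub> ?x'"
      using assms by (intro wdiag_commute) auto
    then show ?thesis
      using assms that by (simp flip: W.H.m_assoc)
  qed
  have "mu (cc i j x y) = ?x \<otimes>\<^bsub>WG\<^esub> ?x' \<otimes>\<^bsub>WG\<^esub> inv\<^bsub>WG\<^esub> (?y \<otimes>\<^bsub>WG\<^esub> (?x \<otimes>\<^bsub>WG\<^esub> ?x') \<otimes>\<^bsub>WG\<^esub> inv\<^bsub>WG\<^esub> ?y)"
    using assms by (simp add: cc_def mu_Act mu_hh)
  also have "\<dots> = ?x \<otimes>\<^bsub>WG\<^esub> (?x' \<otimes>\<^bsub>WG\<^esub> (?y \<otimes>\<^bsub>WG\<^esub> (inv\<^bsub>WG\<^esub> ?x' \<otimes>\<^bsub>WG\<^esub> (inv\<^bsub>WG\<^esub> ?x \<otimes>\<^bsub>WG\<^esub> inv\<^bsub>WG\<^esub> ?y))))"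
    using assms by (simp add: W.H.inv_mult_group W.H.m_assoc)
  also have "\<dots> = ?x \<otimes>\<^bsub>WG\<^esub> (?y \<otimes>\<^bsub>WG\<^esub> (inv\<^bsub>WG\<^esub> ?x \<otimes>\<^bsub>WG\<^esub> inv\<^bsub>WG\<^esub> ?y))"
    using assms by (simp add: comm)
  also have "\<dots> = wdiag G n i (x \<otimes> y \<otimes> inv x \<otimes> inv y)"
    using assms by (simp add: inv_wdiag wdiag_mult m_assoc)
  finally show ?thesis .
qed

text \<open>The usual expansion of a commutator [x, yz] as [x, y] times the y-conjugate of [x, z];
  the middle terms telescope.\<close>

lemma cc_mult_right:
  assumes ij: "i \<in> {1..n}" "j \<in> {1..n}" "i \<noteq> j"
    and xyz: "x \<in> carrier G" "y \<in> carrier G" "z \<in> carrier G"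
  shows "cc i j x (y \<otimes> z) = cc i j x y \<otimes>\<^bsub>SG\<^esub> diag_act i y (cc i j x z)"
  using assms by (simp add: cc_def Act_Act wdiag_mult S.S.m_assoc)

lemma cc_self:
  assumes ij: "i \<in> {1..n}" "j \<in> {1..n}" "i \<noteq> j" "x \<in> carrier G"
  shows "cc i j x x = \<one>\<^bsub>SG\<^esub>"
proof -
  have "ssym (i, j, x) \<otimes>\<^bsub>SG\<^esub> ssym (i, j, \<one>) = ssym (i, j, x \<otimes> x) \<otimes>\<^bsub>SG\<^esub> ssym (i, j, x)"
    using assms S.sym_conj_ij[of i j x \<one>] by simp
  then show ?thesis
    using assms by (simp add: cc_eq S.S.m_assoc S.sym_square_cancel S.sym_square)
qed

text \<open>The invariance \<open>cc_fixed\<close> allows all labels to be multiplied by y on the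
  right. The shifted word can then be rearranged by the relation at a single index pair into the
  inverse of the word for y, x.\<close>

lemma cc_antisym:
  assumes ij: "i \<in> {1..n}" "j \<in> {1..n}" "i \<noteq> j" and xy: "x \<in> carrier G" "y \<in> carrier G"
  shows "cc i j x y = inv\<^bsub>SG\<^esub> cc i j y x"
proof -
  define s where "s a = ssym (i, j, a)" for a
  have s [simp]: "s a \<in> carrier SG" if "a \<in> carrier G" for a
    using that ij by (simp add: s_def)
  have s_s [simp]: "s a \<otimes>\<^bsub>SG\<^esub> (s a \<otimes>\<^bsub>SG\<^esub> m) = m" if "a \<in> carrier G" "m \<in> carrier SG" for a m
    using that ij by (simp add: s_def S.sym_square_cancel)
  have inv_s: "inv\<^bsub>SG\<^esub> s a = s a" if "a \<in> carrier G" for a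
    using that ij by (simp add: s_def S.inv_sym)
  have conj: "s a \<otimes>\<^bsub>SG\<^esub> s c = s (a \<otimes> inv c \<otimes> a) \<otimes>\<^bsub>SG\<^esub> s a" if "a \<in> carrier G" "c \<in> carrier G" for a c
    using that ij S.sym_conj_ij[of i j a c] by (simp add: s_def)
  have cc: "cc i j a b = s a \<otimes>\<^bsub>SG\<^esub> s \<one> \<otimes>\<^bsub>SG\<^esub> s b \<otimes>\<^bsub>SG\<^esub> s (b \<otimes> a)" if "a \<in> carrier G" "b \<in> carrier G" for a b
    using that ij by (simp add: s_def cc_eq)
  have twist: "diag_act j (inv y) (s a) = s (a \<otimes> y)" if "a \<in> carrier G" for a
    using that ij xy by (simp add: s_def diag_act_ssym)
  have "cc i j x y = diag_act j (inv y) (cc i j x y)"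
    using assms by (simp add: cc_fixed)
  also have "\<dots> = s (x \<otimes> y) \<otimes>\<^bsub>SG\<^esub> s y \<otimes>\<^bsub>SG\<^esub> s (y \<otimes> y) \<otimes>\<^bsub>SG\<^esub> s (y \<otimes> x \<otimes> y)"
    using xy by (simp add: cc twist)
  also have "\<dots> = s (x \<otimes> y) \<otimes>\<^bsub>SG\<^esub> (s y \<otimes>\<^bsub>SG\<^esub> s (y \<otimes> y)) \<otimes>\<^bsub>SG\<^esub> s (y \<otimes> x \<otimes> y)"
    using xy by (simp add: S.S.m_assoc)
  also have "s y \<otimes>\<^bsub>SG\<^esub> s (y \<otimes> y) = s \<one> \<otimes>\<^bsub>SG\<^esub> s y"
    using conj[of y "y \<otimes> y"] xy by (simp add: inv_mult_group m_assoc)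
  also have "s (x \<otimes> y) \<otimes>\<^bsub>SG\<^esub> (s \<one> \<otimes>\<^bsub>SG\<^esub> s y) \<otimes>\<^bsub>SG\<^esub> s (y \<otimes> x \<otimes> y) =
      s (x \<otimes> y) \<otimes>\<^bsub>SG\<^esub> (s \<one> \<otimes>\<^bsub>SG\<^esub> (s y \<otimes>\<^bsub>SG\<^esub> s (y \<otimes> x \<otimes> y)))"
    using xy by (simp add: S.S.m_assoc)
  also have "s y \<otimes>\<^bsub>SG\<^esub> s (y \<otimes> x \<otimes> y) = s (inv x) \<otimes>\<^bsub>SG\<^esub> s y"
    using conj[of y "y \<otimes> x \<otimes> y"] xy by (simp add: inv_mult_group m_assoc)
  also have "s (x \<otimes> y) \<otimes>\<^bsub>SG\<^esub> (s \<one> \<otimes>\<^bsub>SG\<^esub> (s (inv x) \<otimes>\<^bsub>SG\<^esub> s y)) =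
      s (x \<otimes> y) \<otimes>\<^bsub>SG\<^esub> ((s \<one> \<otimes>\<^bsub>SG\<^esub> s (inv x)) \<otimes>\<^bsub>SG\<^esub> s y)"
    using xy by (simp add: S.S.m_assoc)
  also have "s \<one> \<otimes>\<^bsub>SG\<^esub> s (inv x) = s x \<otimes>\<^bsub>SG\<^esub> s \<one>"
    using conj[of \<one> "inv x"] xy by simp
  also have "s (x \<otimes> y) \<otimes>\<^bsub>SG\<^esub> (s x \<otimes>\<^bsub>SG\<^esub> s \<one> \<otimes>\<^bsub>SG\<^esub> s y) = inv\<^bsub>SG\<^esub> cc i j y x"
    using xy by (simp add: cc inv_s S.S.inv_mult_group S.S.m_assoc)
  finally show ?thesis .
qed

subsection \<open>Coset representatives\<close>

definition parabolic :: "nat \<Rightarrow> (nat \<times> 'a) word set set"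
  where "parabolic m = generate SG (ssym ` symbols G m)"

lemma symbols_mono: "m \<le> m' \<Longrightarrow> symbols G m \<subseteq> symbols G m'"
  by (auto simp: symbols_def)

lemma parabolic_subgroup: "m \<le> n \<Longrightarrow> subgroup (parabolic m) SG"
  unfolding parabolic_def
  by (rule S.S.generate_is_subgroup) (use symbols_mono in auto)

lemma ssym_parabolic: "x \<in> symbols G m \<Longrightarrow> ssym x \<in> parabolic m"
  unfolding parabolic_def by (auto intro: generate.incl)

text \<open>The defect of multiplicativity of \<open>hh m j\<close> is a lifted commutator centred
  at j. Its second expression, with a third index k different from m and j, contains no symbol
  involving m. This is where \<open>3 \<le> m\<close> is needed.\<close>

lemma hh_hh_parabolic:
  assumes m: "3 \<le> m" "m \<le> n" and j: "j \<in> {1..m-1}" and uv: "u \<in> carrier G" "v \<in> carrier G"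
  obtains p where "p \<in> parabolic (m - 1)" "hh m j u \<otimes>\<^bsub>SG\<^esub> hh m j v = p \<otimes>\<^bsub>SG\<^esub> hh m j (u \<otimes> v)"
proof -
  obtain k where k: "k \<in> {1..m}" "k \<noteq> m" "k \<noteq> j" using m obtain_third by metis
  have idx: "m \<in> {1..n}" "j \<in> {1..n}" "k \<in> {1..n}" "j \<noteq> m" "k \<noteq> m" "k \<noteq> j"
    using m j k by auto
  let ?p = "cc j m (inv u) (inv v)"
  interpret P: subgroup "parabolic (m - 1)" SG
    using m by (intro parabolic_subgroup) auto
  have sp: "ssym (j, k, a) \<in> parabolic (m - 1)" if "a \<in> carrier G" for a
    using that j k m by (intro ssym_parabolic) auto
  have "?p = diag_act j (inv u) (hh j k (inv v)) \<otimes>\<^bsub>SG\<^esub> inv\<^bsub>SG\<^esub> hh j k (inv v)"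
    using idx uv by (intro cc_commutator) auto
  then have p: "?p \<in> parabolic (m - 1)"
    using sp idx uv by (simp add: diag_act_hh inv_hh del: One_nat_def)
  have swap: "ssym (j, m, a) = ssym (m, j, inv a)" if "a \<in> carrier G" for a
    using that idx by (intro S.sym_swap') auto
  have "hh m j u \<otimes>\<^bsub>SG\<^esub> hh m j v = ?p \<otimes>\<^bsub>SG\<^esub> hh m j (u \<otimes> v)"
    using idx uv
    by (simp add: cc_eq hh_def swap S.S.m_assoc inv_mult_group S.sym_square_cancel)
  with p show thesis by (rule that)
qed

lemma hh_one: "i \<in> {1..n} \<Longrightarrow> j \<in> {1..n} \<Longrightarrow> i \<noteq> j \<Longrightarrow> hh i j \<one> = \<one>\<^bsub>SG\<^esub>"
  by (simp add: hh_def S.sym_square)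

text \<open>Representatives of the right cosets of \<open>parabolic (m - 1)\<close> in
  \<open>parabolic m\<close>, sorted by what the matrix does to row m: move it to j with label g, or
  scale it by g. The same coset may be listed for several j, which is harmless.\<close>

definition coset_reps :: "nat \<Rightarrow> (nat \<times> 'a) word set set"
  where "coset_reps m = {t. \<exists>j g. j \<in> {1..m-1} \<and> g \<in> carrier G \<and> (t = ssym (m, j, g) \<or> t = hh m j g)}"

text \<open>Right multiplication by a symbol either conjugates to a symbol without m on the left, or
  replaces the representative by another one. Only products with both factors at the pair m, j are
  delicate, and they are handled by \<open>hh_hh_parabolic\<close>.\<close>

lemma coset_reps_mult:
  assumes m: "3 \<le> m" "m \<le> n" and t: "t \<in> coset_reps m" and y: "y \<in> symbols G m"
  shows "\<exists>p \<in> parabolic (m - 1). \<exists>t' \<in> coset_reps m. t \<otimes>\<^bsub>SG\<^esub> ssym y = p \<otimes>\<^bsub>SG\<^esub> t'"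
proof -
  obtain j g where j: "j \<in> {1..m-1}" and g: "g \<in> carrier G"
    and t: "t = ssym (m, j, g) \<or> t = hh m j g"
    using t by (auto simp: coset_reps_def)
  have sR: "ssym (m, i, a) \<in> coset_reps m" and hR: "hh m i a \<in> coset_reps m"
    if "i \<in> {1..m-1}" "a \<in> carrier G" for i a
    using that by (auto simp: coset_reps_def)
  interpret P: subgroup "parabolic (m - 1)" SG
    using m by (intro parabolic_subgroup) auto
  have idx: "m \<in> {1..n}" "j \<in> {1..n}" "m \<noteq> j" using m j by auto
  have sym_in: "ssym x \<in> parabolic (m - 1)" if "x \<in> symbols G (m - 1)" for x
    using that by (rule ssym_parabolic)
  have swap: "ssym (k, m, a) = ssym (m, k, inv a)" if "k \<in> {1..m-1}" "a \<in> carrier G" for k a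
    using that idx m by (intro S.sym_swap') auto
  have s1: "ssym (m, j, \<one>) \<otimes>\<^bsub>SG\<^esub> ssym (m, j, b) = hh m j (inv b)" if "b \<in> carrier G" for b
    using that idx S.sym_conj_ij[of m j \<one> b] by (simp add: hh_def)
  have h1: "hh m j b \<otimes>\<^bsub>SG\<^esub> ssym (m, j, \<one>) = ssym (m, j, b)" if "b \<in> carrier G" for b
    using that idx by (simp add: hh_def S.S.m_assoc S.sym_square)
  obtain k l b where y': "y = (k, l, b)" by (cases y)
  have kl: "k \<in> {1..m}" "l \<in> {1..m}" "k \<noteq> l" "b \<in> carrier G" using y y' by auto
  text \<open>Up to a swap, the symbol avoids \<open>m\<close>, or its first index is \<open>m\<close>.\<close>
  have sym_y: "\<exists>l b. ssym y = ssym (m, l, b) \<and> l \<in> {1..m-1} \<and> b \<in> carrier G" if "k = m \<or> l = m"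
  proof (cases "k = m")
    case True
    then show ?thesis using y' kl by (intro exI[of _ l] exI[of _ b]) auto
  next
    case False
    then show ?thesis using that y' kl swap[of k b] by (intro exI[of _ k] exI[of _ "inv b"]) auto
  qed
  from t show ?thesis
  proof
    assume t: "t = ssym (m, j, g)"
    \<comment> \<open>If the symbol avoids j, conjugation by t removes a possible m from it. A
      symbol at the pair m, j combines with t into two diagonal lifts. If it meets j but not m, it
      is moved to the left unchanged and the representative changes instead.\<close>
    consider "k \<noteq> j" "l \<noteq> j" | "k = m \<or> l = m" "k = j \<or> l = j" | "k = j" "l \<noteq> m" | "l = j" "k \<noteq> m"
      using kl by blast
    then show ?thesis
    proof cases
      case 1
      let ?z = "wact G (wsym G n (m, j, g)) (k, l, b)"
      have "?z \<in> symbols G (m - 1)"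
        using 1 kl j m g by (auto simp: wsym_def wact_eq transpose_def)
      moreover have "t \<otimes>\<^bsub>SG\<^esub> ssym y = ssym ?z \<otimes>\<^bsub>SG\<^esub> t"
        unfolding t y' using idx g kl m by (intro S.sym_conj) auto
      ultimately show ?thesis using sym_in sR[OF j g] t by blast
    next
      case 2
      then have "\<exists>b. ssym y = ssym (m, j, b) \<and> b \<in> carrier G"
        using y' kl swap[of k b] idx j by (elim disjE) auto
      then obtain b where b: "ssym y = ssym (m, j, b)" "b \<in> carrier G" by blast
      obtain p where p: "p \<in> parabolic (m - 1)" "hh m j g \<otimes>\<^bsub>SG\<^esub> hh m j (inv b) = p \<otimes>\<^bsub>SG\<^esub> hh m j (g \<otimes> inv b)"
        using hh_hh_parabolic[OF m j g inv_closed[OF b(2)]] by blast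
      have "t \<otimes>\<^bsub>SG\<^esub> ssym y = hh m j g \<otimes>\<^bsub>SG\<^esub> (ssym (m, j, \<one>) \<otimes>\<^bsub>SG\<^esub> ssym (m, j, b))"
        using idx g b by (simp add: t hh_def S.S.m_assoc S.sym_square_cancel)
      then show ?thesis using p s1[OF b(2)] hR[of j "g \<otimes> inv b"] j g b by auto
    next
      case 3
      have "ssym (j, l, b) \<otimes>\<^bsub>SG\<^esub> ssym (m, l, g \<otimes> b) = t \<otimes>\<^bsub>SG\<^esub> ssym y"
        unfolding t y' using 3 idx g kl m
        by (subst S.sym_conj) (auto simp: wsym_def wact_eq transpose_def m_assoc)
      moreover have "(j, l, b) \<in> symbols G (m - 1)" using 3 kl j by auto
      moreover have "l \<in> {1..m-1}" using 3 kl by auto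
      ultimately show ?thesis using sym_in sR[of l "g \<otimes> b"] g kl by (metis m_closed)
    next
      case 4
      have "ssym (k, j, b) \<otimes>\<^bsub>SG\<^esub> ssym (m, k, g \<otimes> inv b) = t \<otimes>\<^bsub>SG\<^esub> ssym y"
        unfolding t y' using 4 idx g kl m
        by (subst S.sym_conj) (auto simp: wsym_def wact_eq transpose_def m_assoc)
      moreover have "(k, j, b) \<in> symbols G (m - 1)" using 4 kl j by auto
      moreover have "k \<in> {1..m-1}" using 4 kl by auto
      ultimately show ?thesis using sym_in sR[of k "g \<otimes> inv b"] g kl by (metis m_closed inv_closed)
    qed
  next
    assume t: "t = hh m j g"
    have ht: "t \<otimes>\<^bsub>SG\<^esub> ssym x = ssym (wact G (wdiag G n m g \<otimes>\<^bsub>WG\<^esub> wdiag G n j (inv g)) x) \<otimes>\<^bsub>SG\<^esub> t"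
      if "x \<in> symbols G n" for x
      using that conj_eq_Act[of t "ssym x"] idx g by (simp add: t mu_hh Act_ssym)
    show ?thesis
    proof (cases "k = m \<or> l = m")
      case False
      let ?z = "wact G (wdiag G n m g \<otimes>\<^bsub>WG\<^esub> wdiag G n j (inv g)) y"
      have "?z \<in> symbols G (m - 1)"
        using False kl j m g by (auto simp: y' wdiag_def wact_eq mult_wreath)
      moreover have "y \<in> symbols G n" using y symbols_mono m by auto
      ultimately show ?thesis using sym_in hR[OF j g] t ht by blast
    next
      case True
      then obtain l b where y'': "ssym y = ssym (m, l, b)" and l: "l \<in> {1..m-1}" and b: "b \<in> carrier G"
        using sym_y by blast
      show ?thesis
      proof (cases "l = j")
        case True
        obtain p where p: "p \<in> parabolic (m - 1)" "hh m j g \<otimes>\<^bsub>SG\<^esub> hh m j b = p \<otimes>\<^bsub>SG\<^esub> hh m j (g \<otimes> b)"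
          using hh_hh_parabolic[OF m j g b] by auto
        have "t \<otimes>\<^bsub>SG\<^esub> ssym y = hh m j g \<otimes>\<^bsub>SG\<^esub> (hh m j b \<otimes>\<^bsub>SG\<^esub> ssym (m, j, \<one>))"
          using h1[OF b] by (simp add: t y'' True)
        also have "\<dots> = (hh m j g \<otimes>\<^bsub>SG\<^esub> hh m j b) \<otimes>\<^bsub>SG\<^esub> ssym (m, j, \<one>)"
          using idx g b by (simp add: S.S.m_assoc)
        also have "\<dots> = p \<otimes>\<^bsub>SG\<^esub> ssym (m, j, g \<otimes> b)"
          using p h1[of "g \<otimes> b"] idx g b by (simp add: S.S.m_assoc P.mem_carrier)
        finally show ?thesis using p sR[of j "g \<otimes> b"] j g b by blast
      next
        case False
        have idl: "l \<in> {1..n}" "m \<noteq> l" "l \<noteq> j" using l m False by auto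
        \<comment> \<open>The new symbol (m, l, gb) becomes the representative: conjugation by it
          sends the two symbols at m, j to symbols at l, j, which no longer involve m.\<close>
        have "t \<otimes>\<^bsub>SG\<^esub> ssym y = ssym (m, l, g \<otimes> b) \<otimes>\<^bsub>SG\<^esub> (ssym (m, j, g) \<otimes>\<^bsub>SG\<^esub> ssym (m, j, \<one>))"
          using idl idx g b ht[of "(m, l, b)"]
          by (simp add: y'' wact_eq wdiag_def mult_wreath hh_def t)
        also have "\<dots> = (ssym (m, l, g \<otimes> b) \<otimes>\<^bsub>SG\<^esub> ssym (m, j, g)) \<otimes>\<^bsub>SG\<^esub> ssym (m, j, \<one>)"
          using idl idx g b by (simp add: S.S.m_assoc)
        also have "\<dots> = ssym (l, j, inv (g \<otimes> b) \<otimes> g) \<otimes>\<^bsub>SG\<^esub> (ssym (m, l, g \<otimes> b) \<otimes>\<^bsub>SG\<^esub> ssym (m, j, \<one>))"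
          using idl idx g b by (subst S.sym_conj_ik) (auto simp: S.S.m_assoc)
        also have "ssym (m, l, g \<otimes> b) \<otimes>\<^bsub>SG\<^esub> ssym (m, j, \<one>) = ssym (l, j, inv (g \<otimes> b)) \<otimes>\<^bsub>SG\<^esub> ssym (m, l, g \<otimes> b)"
          using idl idx g b by (subst S.sym_conj_ik) auto
        finally have "t \<otimes>\<^bsub>SG\<^esub> ssym y =
            (ssym (l, j, inv (g \<otimes> b) \<otimes> g) \<otimes>\<^bsub>SG\<^esub> ssym (l, j, inv (g \<otimes> b))) \<otimes>\<^bsub>SG\<^esub> ssym (m, l, g \<otimes> b)"
          using idl idx g b by (simp add: S.S.m_assoc)
        moreover have "ssym (l, j, inv (g \<otimes> b) \<otimes> g) \<otimes>\<^bsub>SG\<^esub> ssym (l, j, inv (g \<otimes> b)) \<in> parabolic (m - 1)"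
          using idl l j g b by (intro P.m_closed sym_in) auto
        ultimately show ?thesis using sR[of l "g \<otimes> b"] l g b by blast
      qed
    qed
  qed
qed

lemma parabolic_cosets:
  assumes m: "3 \<le> m" "m \<le> n" and x: "x \<in> parabolic m"
  shows "\<exists>p \<in> parabolic (m - 1). \<exists>t \<in> coset_reps m. x = p \<otimes>\<^bsub>SG\<^esub> t"
proof -
  interpret P: subgroup "parabolic (m - 1)" SG
    using m by (intro parabolic_subgroup) auto
  let ?R = "{p \<otimes>\<^bsub>SG\<^esub> t | p t. p \<in> parabolic (m - 1) \<and> t \<in> coset_reps m}"
  have t_carrier: "t \<in> carrier SG" if "t \<in> coset_reps m" for t
    using that m by (auto simp: coset_reps_def)
  have gen: "r \<otimes>\<^bsub>SG\<^esub> ssym y \<in> ?R" if rR: "r \<in> ?R" and y: "y \<in> symbols G m" for r y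
  proof -
    obtain p t where r: "r = p \<otimes>\<^bsub>SG\<^esub> t" "p \<in> parabolic (m - 1)" "t \<in> coset_reps m" using rR by blast
    obtain p' t' where t': "t \<otimes>\<^bsub>SG\<^esub> ssym y = p' \<otimes>\<^bsub>SG\<^esub> t'" "p' \<in> parabolic (m - 1)" "t' \<in> coset_reps m"
      using coset_reps_mult[OF m r(3) y] by blast
    have "y \<in> symbols G n" using y symbols_mono m by blast
    then have "r \<otimes>\<^bsub>SG\<^esub> ssym y = p \<otimes>\<^bsub>SG\<^esub> (t \<otimes>\<^bsub>SG\<^esub> ssym y)"
      using r t_carrier by (simp add: S.S.m_assoc P.mem_carrier)
    also have "\<dots> = (p \<otimes>\<^bsub>SG\<^esub> p') \<otimes>\<^bsub>SG\<^esub> t'"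
      unfolding t'(1) using r t' t_carrier by (simp add: S.S.m_assoc P.mem_carrier)
    finally show ?thesis using r t' by blast
  qed
  have R_carrier: "r \<in> carrier SG" if "r \<in> ?R" for r
    using that t_carrier P.mem_carrier by auto
  have P_carrier: "parabolic m \<subseteq> carrier SG" using parabolic_subgroup[OF m(2)] subgroup.subset by blast
  have "\<forall>r \<in> ?R. r \<otimes>\<^bsub>SG\<^esub> x \<in> ?R"
    using x unfolding parabolic_def[of m]
  proof induction
    case one
    then show ?case using R_carrier by simp
  next
    case (incl h)
    then show ?case using gen by blast
  next
    case (inv h)
    then obtain y where y: "y \<in> symbols G m" "h = ssym y" by blast
    then have "inv\<^bsub>SG\<^esub> h = ssym y" using symbols_mono[OF m(2)] by (auto simp: S.inv_sym)
    then show ?case using gen y by auto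
  next
    case (eng h1 h2)
    have c: "h1 \<in> carrier SG" "h2 \<in> carrier SG" using eng.hyps P_carrier by (auto simp: parabolic_def)
    show ?case
    proof
      fix r assume r: "r \<in> ?R"
      have "r \<otimes>\<^bsub>SG\<^esub> h1 \<otimes>\<^bsub>SG\<^esub> h2 \<in> ?R" using eng.IH r by blast
      then show "r \<otimes>\<^bsub>SG\<^esub> (h1 \<otimes>\<^bsub>SG\<^esub> h2) \<in> ?R" using R_carrier[OF r] c by (simp add: S.S.m_assoc)
    qed
  qed
  moreover have "\<one>\<^bsub>SG\<^esub> \<in> ?R"
  proof -
    have "hh m 1 \<one> = \<one>\<^bsub>SG\<^esub>" using m by (intro hh_one) auto
    moreover have "hh m 1 \<one> \<in> coset_reps m" using m
      unfolding coset_reps_def by (intro CollectI exI[of _ 1] exI[of _ \<one>]) auto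
    ultimately have "\<one>\<^bsub>SG\<^esub> \<in> coset_reps m" by simp
    then show ?thesis using P.one_closed by force
  qed
  ultimately have "\<one>\<^bsub>SG\<^esub> \<otimes>\<^bsub>SG\<^esub> x \<in> ?R" by blast
  moreover have "\<one>\<^bsub>SG\<^esub> \<otimes>\<^bsub>SG\<^esub> x = x" using x P_carrier by (intro S.S.l_one) blast
  ultimately show ?thesis by auto
qed

section \<open>Descent of the kernel to the indices 1 and 2\<close>

lemma mu_parabolic_fixes:
  assumes m: "m \<in> {1..n}" and p: "p \<in> parabolic (m - 1)"
  shows "snd (mu p) m = m \<and> fst (mu p) m = \<one>"
proof -
  have c: "h \<in> carrier SG" if "h \<in> parabolic (m - 1)" for h
    using that parabolic_subgroup[of "m - 1"] m subgroup.mem_carrier by fastforce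
  have sub: "symbols G (m - 1) \<subseteq> symbols G n" using m by (intro symbols_mono) auto
  from p show ?thesis
    unfolding parabolic_def
  proof induction
    case one
    then show ?case using m by (simp add: one_wreath)
  next
    case (incl h)
    then obtain i j a where h: "h = ssym (i, j, a)" "(i, j, a) \<in> symbols G (m - 1)" by auto
    then have "mu h = wsym G n (i, j, a)" using sub mu_ssym by blast
    then show ?case using m h(2) by (auto simp: wsym_def)
  next
    case (inv h)
    then obtain i j a where h: "h = ssym (i, j, a)" "(i, j, a) \<in> symbols G (m - 1)" by auto
    then have "mu (inv\<^bsub>SG\<^esub> h) = wsym G n (i, j, a)" using sub mu_ssym S.inv_sym by (metis subsetD)
    then show ?case using m h(2) by (auto simp: wsym_def)
  next
    case (eng h1 h2)
    then have h: "h1 \<in> carrier SG" "h2 \<in> carrier SG" using c by (auto simp: parabolic_def)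
    obtain g \<sigma> where w1: "mu h1 = (g, \<sigma>)" "\<sigma> permutes {1..n}"
      using wreath_cases[OF mu.hom_closed[OF h(1)]] by metis
    obtain g' \<sigma>' where w2: "mu h2 = (g', \<sigma>')" by (cases "mu h2")
    have "inv_into UNIV \<sigma> m = m"
      using eng.IH(1) w1 permutes_bij_inv(1)[OF w1(2), of m] by simp
    then show ?case
      using eng.IH m h by (simp add: w1 w2 mult_wreath)
  qed
qed

text \<open>In x = pt the matrix of p has trivial row m, so the matrix of t must have trivial row m
  as well. That excludes a transposition and forces the diagonal label to be 1, whence t =
  1.\<close>

lemma kernel_parabolic_step:
  assumes m: "3 \<le> m" "m \<le> n" and x: "x \<in> parabolic m" and mu: "mu x = \<one>\<^bsub>WG\<^esub>"
  shows "x \<in> parabolic (m - 1)"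
proof -
  obtain p t where p: "p \<in> parabolic (m - 1)" and t: "t \<in> coset_reps m" and xpt: "x = p \<otimes>\<^bsub>SG\<^esub> t"
    using parabolic_cosets[OF m x] by blast
  obtain j g where j: "j \<in> {1..m-1}" and g: "g \<in> carrier G"
    and t: "t = ssym (m, j, g) \<or> t = hh m j g"
    using t by (auto simp: coset_reps_def)
  have idx: "m \<in> {1..n}" "j \<in> {1..n}" "m \<noteq> j" using m j by auto
  have pc: "p \<in> carrier SG"
    using p parabolic_subgroup[of "m - 1"] m subgroup.mem_carrier by fastforce
  obtain f \<sigma> where w: "mu p = (f, \<sigma>)" "\<sigma> permutes {1..n}"
    using wreath_cases[OF mu.hom_closed[OF pc]] by metis
  have fix_m: "\<sigma> m = m" "f m = \<one>" using mu_parabolic_fixes[OF idx(1) p] w by auto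
  have inv_m: "inv_into UNIV \<sigma> m = m" using fix_m permutes_bij_inv(1)[OF w(2), of m] by simp
  from t show ?thesis
  proof
    assume t: "t = ssym (m, j, g)"
    have "mu x = mu p \<otimes>\<^bsub>WG\<^esub> wsym G n (m, j, g)"
      using pc idx g by (simp add: xpt t mu_ssym)
    then have "snd (mu x) j = m"
      by (simp add: w wsym_def mult_wreath fix_m)
    then show ?thesis using mu idx by (simp add: one_wreath)
  next
    assume t: "t = hh m j g"
    have "mu x = mu p \<otimes>\<^bsub>WG\<^esub> (wdiag G n m g \<otimes>\<^bsub>WG\<^esub> wdiag G n j (inv g))"
      using pc idx g by (simp add: xpt t mu_hh)
    then have "fst (mu x) m = g"
      using idx g by (simp add: w wdiag_def mult_wreath inv_m fix_m)
    then have "g = \<one>" using mu idx by (simp add: one_wreath)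
    then show ?thesis using xpt t hh_one[OF idx] pc p by simp
  qed
qed

text \<open>The descent ends at 2, because each step from m to m - 1 uses a third index below or
  equal to m.\<close>

lemma kernel_parabolic_two:
  assumes x: "x \<in> carrier SG" and mu: "mu x = \<one>\<^bsub>WG\<^esub>"
  shows "x \<in> parabolic 2"
proof -
  have "x \<in> parabolic (n - d)" if "d \<le> n - 2" for d
    using that
  proof (induction d)
    case 0
    then show ?case using x by (simp add: parabolic_def flip: generate_ssym)
  next
    case (Suc d)
    then show ?case using kernel_parabolic_step[of "n - d" x] mu three_le by simp
  qed
  from this[of "n - 2"] show ?thesis using three_le by simp
qed

text \<open>The head of the list is the last factor, so that right multiplication by a generator is
  a \<open>Cons\<close>.\<close>

primrec hprod :: "'a list \<Rightarrow> (nat \<times> 'a) word set" where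
  "hprod [] = \<one>\<^bsub>SG\<^esub>"
| "hprod (a # as) = hprod as \<otimes>\<^bsub>SG\<^esub> hh 1 2 a"

lemma one_two_in [simp]: "Suc 0 \<in> {Suc 0..n}" "2 \<in> {Suc 0..n}" "Suc 0 \<le> n" "2 \<le> n"
  using three_le by auto

lemma hprod_closed [simp]: "set as \<subseteq> carrier G \<Longrightarrow> hprod as \<in> carrier SG"
  by (induction as) auto

text \<open>Every symbol at the pair 1, 2 is a diagonal lift times the trivially labelled
  transposition, and conjugating a symbol by that transposition inverts its label. The two shapes
  record the parity.\<close>

lemma parabolic_two:
  assumes "x \<in> parabolic 2"
  shows "\<exists>as. set as \<subseteq> carrier G \<and> (x = hprod as \<or> x = hprod as \<otimes>\<^bsub>SG\<^esub> ssym (1, 2, \<one>))"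
proof -
  let ?R = "{r. \<exists>as. set as \<subseteq> carrier G \<and> (r = hprod as \<or> r = hprod as \<otimes>\<^bsub>SG\<^esub> ssym (1, 2, \<one>))}"
  have R_carrier: "r \<in> carrier SG" if "r \<in> ?R" for r
    using that by auto
  have gen12: "r \<otimes>\<^bsub>SG\<^esub> ssym (1, 2, b) \<in> ?R" if r: "r \<in> ?R" and b: "b \<in> carrier G" for r b
  proof -
    obtain as where as: "set as \<subseteq> carrier G" "r = hprod as \<or> r = hprod as \<otimes>\<^bsub>SG\<^esub> ssym (1, 2, \<one>)"
      using r by blast
    from as(2) show ?thesis
    proof
      assume "r = hprod as"
      then have "r \<otimes>\<^bsub>SG\<^esub> ssym (1, 2, b) = hprod (b # as) \<otimes>\<^bsub>SG\<^esub> ssym (1, 2, \<one>)"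
        using as b by (simp add: hh_def S.S.m_assoc S.sym_square)
      then show ?thesis using as b by (intro CollectI exI[of _ "b # as"]) auto
    next
      assume "r = hprod as \<otimes>\<^bsub>SG\<^esub> ssym (1, 2, \<one>)"
      then have "r \<otimes>\<^bsub>SG\<^esub> ssym (1, 2, b) = hprod (inv b # as)"
        using as b S.sym_conj_ij[of 1 2 \<one> b] by (simp add: hh_def S.S.m_assoc)
      then show ?thesis using as b by (intro CollectI exI[of _ "inv b # as"]) auto
    qed
  qed
  have gen: "r \<otimes>\<^bsub>SG\<^esub> ssym y \<in> ?R" if r: "r \<in> ?R" and y: "y \<in> symbols G 2" for r y
  proof -
    obtain i j b where y': "y = (i, j, b)" by (cases y)
    then have "i = 1 \<and> j = 2 \<or> i = 2 \<and> j = 1" and b: "b \<in> carrier G" using y by auto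
    then show ?thesis
      using gen12[OF r b] gen12[OF r, of "inv b"] S.sym_swap'[of 1 2 b] y' by auto
  qed
  have sub: "symbols G 2 \<subseteq> symbols G n" using symbols_mono three_le by simp
  have "\<forall>r \<in> ?R. r \<otimes>\<^bsub>SG\<^esub> x \<in> ?R"
    using assms unfolding parabolic_def
  proof induction
    case one
    then show ?case using R_carrier by simp
  next
    case (incl h)
    then show ?case using gen by blast
  next
    case (inv h)
    then obtain y where y: "y \<in> symbols G 2" "h = ssym y" by blast
    then have "inv\<^bsub>SG\<^esub> h = ssym y" using sub by (auto simp: S.inv_sym)
    then show ?case using gen y by auto
  next
    case (eng h1 h2)
    have c: "h1 \<in> carrier SG" "h2 \<in> carrier SG"
      using eng.hyps S.S.generate_in_carrier[of "ssym ` symbols G 2"] sub S.sym_closed by blast+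
    show ?case
    proof
      fix r assume r: "r \<in> ?R"
      have "r \<otimes>\<^bsub>SG\<^esub> h1 \<otimes>\<^bsub>SG\<^esub> h2 \<in> ?R" using eng.IH r by blast
      then show "r \<otimes>\<^bsub>SG\<^esub> (h1 \<otimes>\<^bsub>SG\<^esub> h2) \<in> ?R" using R_carrier[OF r] c by (simp add: S.S.m_assoc)
    qed
  qed
  moreover have "\<one>\<^bsub>SG\<^esub> \<in> ?R" by (intro CollectI exI[of _ "[]"]) auto
  ultimately have "\<one>\<^bsub>SG\<^esub> \<otimes>\<^bsub>SG\<^esub> x \<in> ?R" by blast
  moreover have "x \<in> carrier SG"
    using assms parabolic_subgroup[of 2] subgroup.mem_carrier by fastforce
  ultimately show ?thesis by auto
qed

lemma snd_mu_hprod: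
  assumes "set as \<subseteq> carrier G"
  shows "snd (mu (hprod as)) = id"
  using assms
proof (induction as)
  case Nil
  then show ?case by (simp add: one_wreath)
next
  case (Cons a as)
  then show ?case
    by (cases "mu (hprod as)") (simp add: mu_hh wdiag_def mult_wreath)
qed

text \<open>The odd shape is excluded because its permutation part is the transposition of 1 and 2.
  No normal form in the list is claimed; different lists may give the same element.\<close>

theorem kernel_hprod:
  assumes "x \<in> carrier SG" and mu: "mu x = \<one>\<^bsub>WG\<^esub>"
  obtains as where "set as \<subseteq> carrier G" "x = hprod as"
proof -
  obtain as where as: "set as \<subseteq> carrier G" "x = hprod as \<or> x = hprod as \<otimes>\<^bsub>SG\<^esub> ssym (1, 2, \<one>)"
    using parabolic_two[OF kernel_parabolic_two[OF assms]] by blast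
  have "x \<noteq> hprod as \<otimes>\<^bsub>SG\<^esub> ssym (1, 2, \<one>)"
  proof
    assume "x = hprod as \<otimes>\<^bsub>SG\<^esub> ssym (1, 2, \<one>)"
    then have "mu x = mu (hprod as) \<otimes>\<^bsub>WG\<^esub> wsym G n (1, 2, \<one>)"
      using as by (simp add: mu_ssym)
    then have "snd (mu x) = transpose 1 2"
      using snd_mu_hprod[OF as(1)] by (cases "mu (hprod as)") (simp add: wsym_def mult_wreath)
    then have "id 1 = transpose 1 2 (1::nat)"
      using mu by (simp add: one_wreath)
    then show False by simp
  qed
  with as show thesis using that by blast
qed

end

section \<open>Extending \<open>S\<^sub>n(G)\<close> by a free abelian group\<close>

text \<open>G is arbitrary, so an order for the factors of normal forms has to come from the
  well-ordering theorem.\<close>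

lemma exists_strict_linear_order:
  obtains lt :: "'a \<Rightarrow> 'a \<Rightarrow> bool" where "transp lt" "asymp lt" "\<And>x y. x \<noteq> y \<Longrightarrow> lt x y \<or> lt y x"
proof -
  obtain r :: "'a rel" where r: "well_order_on UNIV r"
    using well_order_on[of UNIV] ..
  then have lin: "trans r" "antisym r" "total_on UNIV r"
    by (auto simp: well_order_on_def linear_order_on_def partial_order_on_def preorder_on_def)
  show thesis
  proof
    show "transp (\<lambda>x y. (x, y) \<in> r \<and> x \<noteq> y)"
      using lin(1,2) by (auto intro!: transpI dest: transD antisymD)
    show "asymp (\<lambda>x y. (x, y) \<in> r \<and> x \<noteq> y)"
      using lin(2) by (auto intro!: asympI dest: antisymD)
    show "(x, y) \<in> r \<and> x \<noteq> y \<or> (y, x) \<in> r \<and> y \<noteq> x" if "x \<noteq> y" for x y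
      using lin(3) that by (auto simp: total_on_def)
  qed
qed

lemma sorted_wrt_unique:
  assumes "asymp lt" "sorted_wrt lt xs" "sorted_wrt lt ys" "set xs = set ys"
  shows "xs = ys"
  using assms(2-)
proof (induction xs arbitrary: ys)
  case (Cons x xs)
  then obtain y ys' where ys: "ys = y # ys'" by (cases ys) auto
  have irr: "\<not> lt a a" for a using assms(1) by (meson asympD)
  have "x = y"
  proof (rule ccontr)
    assume "x \<noteq> y"
    then have "x \<in> set ys'" "y \<in> set xs" using Cons.prems ys by auto
    then have "lt y x" "lt x y" using Cons.prems ys by auto
    then show False using assms(1) by (meson asympD)
  qed
  moreover have "x \<notin> set xs" "y \<notin> set ys'" using Cons.prems ys irr by auto
  ultimately have "set xs = set ys'" using Cons.prems ys by auto
  then show ?case using Cons ys \<open>x = y\<close> by auto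
qed auto

lemma sorted_wrt_exists:
  assumes "transp lt" "asymp lt" "\<And>x y. x \<noteq> y \<Longrightarrow> lt x y \<or> lt y x" "finite A"
  shows "\<exists>xs. sorted_wrt lt xs \<and> set xs = A"
  using assms(4)
proof (induction A)
  case empty
  then show ?case by (intro exI[of _ "[]"]) auto
next
  case (insert a A)
  then obtain xs where xs: "sorted_wrt lt xs" "set xs = A" by blast
  let ?l = "filter (\<lambda>x. lt x a) xs" and ?r = "filter (\<lambda>x. lt a x) xs"
  have "sorted_wrt lt (?l @ a # ?r)"
    using xs assms(1) by (auto simp: sorted_wrt_append sorted_wrt_filter dest: transpD)
  moreover have "set (?l @ a # ?r) = insert a A"
    using xs insert assms(3) by auto
  ultimately show ?case by blast
qed

section \<open>Ordered products of powers\<close>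

context group
begin

primrec list_power_prod :: "('a \<Rightarrow>\<^sub>0 int) \<Rightarrow> 'a list \<Rightarrow> 'a" where
  "list_power_prod p [] = \<one>"
| "list_power_prod p (h # L) = h [^] poly_mapping.lookup p h \<otimes> list_power_prod p L"

lemma list_power_prod_closed [simp]:
  "set L \<subseteq> carrier G \<Longrightarrow> list_power_prod p L \<in> carrier G"
  by (induction L) auto

lemma list_power_prod_append:
  "set L \<subseteq> carrier G \<Longrightarrow> set L' \<subseteq> carrier G \<Longrightarrow>
    list_power_prod p (L @ L') = list_power_prod p L \<otimes> list_power_prod p L'"
  by (induction L) (auto simp: m_assoc)

lemma list_power_prod_filter:
  "set L \<subseteq> carrier G \<Longrightarrow> list_power_prod p (filter (\<lambda>h. h \<in> Poly_Mapping.keys p) L) = list_power_prod p L"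
  by (induction L) (auto simp: in_keys_iff)

lemma list_power_prod_add_other:
  "h \<notin> set L \<Longrightarrow> list_power_prod (p + frag_of h) L = list_power_prod p L"
  by (induction L) (auto simp: lookup_add)

text \<open>The function \<open>Y g p\<close> is the product of the powers \<open>h\<^bsup>p h\<^esup>\<close> for \<open>h\<close> below \<open>g\<close>, taken in increasing
  order.\<close>

lemma ordered_power_products:
  obtains lt :: "'a \<Rightarrow> 'a \<Rightarrow> bool" and Y :: "'a \<Rightarrow> ('a \<Rightarrow>\<^sub>0 int) \<Rightarrow> 'a"
  where "asymp lt" "\<And>x y. x \<noteq> y \<Longrightarrow> lt x y \<or> lt y x"
    "\<And>g p. Poly_Mapping.keys p \<subseteq> carrier G \<Longrightarrow> Y g p \<in> carrier G"
    "\<And>g h p. Poly_Mapping.keys p \<subseteq> carrier G \<Longrightarrow> h \<in> carrier G \<Longrightarrow> lt h g \<Longrightarrow>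
      Y g (p + frag_of h) = Y h p \<otimes> h \<otimes> inv (Y h p) \<otimes> Y g p"
    "\<And>g h p. Poly_Mapping.keys p \<subseteq> carrier G \<Longrightarrow> h \<in> carrier G \<Longrightarrow> \<not> lt h g \<Longrightarrow>
      Y g (p + frag_of h) = Y g p"
proof -
  obtain lt :: "'a \<Rightarrow> 'a \<Rightarrow> bool" where lt: "transp lt" "asymp lt" "\<And>x y. x \<noteq> y \<Longrightarrow> lt x y \<or> lt y x"
    using exists_strict_linear_order by metis
  define slist where "slist A = (SOME xs. sorted_wrt lt xs \<and> set xs = A)" for A
  have slist: "sorted_wrt lt (slist A)" "set (slist A) = A" if "finite A" for A
    using someI_ex[OF sorted_wrt_exists[OF lt that]] unfolding slist_def by auto
  define Y where "Y g p = list_power_prod p (slist {h \<in> Poly_Mapping.keys p. lt h g})" for g p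
  have fin: "finite {h \<in> Poly_Mapping.keys p. lt h g}" for p :: "'a \<Rightarrow>\<^sub>0 int" and g by simp
  \<comment> \<open>Letters outside the keys have exponent 0, so any sorted list of letters below
    \<open>g\<close> that covers the keys computes \<open>Y g p\<close>.\<close>
  have Y_eq: "Y g p = list_power_prod p L"
    if L: "sorted_wrt lt L" "{h \<in> Poly_Mapping.keys p. lt h g} \<subseteq> set L" "\<And>h. h \<in> set L \<Longrightarrow> lt h g"
      "set L \<subseteq> carrier G" for L g p
  proof -
    have "slist {h \<in> Poly_Mapping.keys p. lt h g} = filter (\<lambda>h. h \<in> Poly_Mapping.keys p) L"
      by (rule sorted_wrt_unique[OF lt(2)]) (use L slist[OF fin] in \<open>auto simp: sorted_wrt_filter\<close>)
    then show ?thesis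
      using L(4) by (simp add: Y_def list_power_prod_filter)
  qed
  have keys_add: "Poly_Mapping.keys (p + frag_of h) \<subseteq> insert h (Poly_Mapping.keys p)" for p and h :: 'a
    using Poly_Mapping.keys_add[of p "frag_of h"] by (auto simp: keys_frag_of)
  show thesis
  proof
    show "asymp lt" "\<And>x y. x \<noteq> y \<Longrightarrow> lt x y \<or> lt y x" by (fact lt)+
    fix p :: "'a \<Rightarrow>\<^sub>0 int" and g assume p: "Poly_Mapping.keys p \<subseteq> carrier G"
    show "Y g p \<in> carrier G"
      unfolding Y_def by (rule list_power_prod_closed) (use p slist[OF fin] in auto)
    fix h assume h: "h \<in> carrier G"
    \<comment> \<open>One list, with h already inserted, serves both for p and for p with h added.
      Splitting it at h shows the effect of the extra factor: the part before h is
      \<open>Y h p\<close>.\<close>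
    let ?A = "{k \<in> insert h (Poly_Mapping.keys p). lt k g}"
    have A: "finite ?A" "?A \<subseteq> carrier G" using p h by auto
    {
      assume "lt h g"
      then obtain L1 L2 where L: "slist ?A = L1 @ h # L2"
        using slist(2)[OF A(1)] by (metis (no_types, lifting) insertI1 mem_Collect_eq split_list)
      have s: "sorted_wrt lt (L1 @ h # L2)" and set: "set (L1 @ h # L2) = ?A"
        using slist[OF A(1)] by (simp_all flip: L)
      have L_carrier: "set L1 \<subseteq> carrier G" "set L2 \<subseteq> carrier G" using set A(2) by auto
      have "h \<notin> set L1" "h \<notin> set L2"
        using s lt(2) by (auto simp: sorted_wrt_append dest: asympD)
      then have other: "list_power_prod (p + frag_of h) L1 = list_power_prod p L1"
        "list_power_prod (p + frag_of h) L2 = list_power_prod p L2"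
        by (simp_all add: list_power_prod_add_other)
      have 1: "Y g p = list_power_prod p (L1 @ h # L2)" "Y g (p + frag_of h) = list_power_prod (p + frag_of h) (L1 @ h # L2)"
        by (rule Y_eq; use s set A(2) keys_add in blast)+
      have 2: "Y h p = list_power_prod p L1"
      proof (rule Y_eq)
        show "{k \<in> Poly_Mapping.keys p. lt k h} \<subseteq> set L1"
        proof clarify
          fix k assume k: "k \<in> Poly_Mapping.keys p" "lt k h"
          then have "k \<in> ?A" using \<open>lt h g\<close> lt(1) by (auto dest: transpD)
          then have "k \<in> set (L1 @ h # L2)" by (simp only: set)
          moreover have "k \<noteq> h" "\<not> lt h k" using k(2) lt(2) by (auto dest: asympD)
          ultimately show "k \<in> set L1" using s by (auto simp: sorted_wrt_append)
        qed
      qed (use s L_carrier in \<open>auto simp: sorted_wrt_append\<close>)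
      show "Y g (p + frag_of h) = Y h p \<otimes> h \<otimes> inv (Y h p) \<otimes> Y g p"
        unfolding 1 2 using L_carrier h
        by (simp add: list_power_prod_append other lookup_add int_pow_mult[of h 1, simplified] add.commute m_assoc)
    }
    {
      assume "\<not> lt h g"
      have set: "set (slist ?A) = ?A" "sorted_wrt lt (slist ?A)" using slist[OF A(1)] by auto
      have "Y g p = list_power_prod p (slist ?A)" "Y g (p + frag_of h) = list_power_prod (p + frag_of h) (slist ?A)"
        by (rule Y_eq; use set A(2) keys_add in blast)+
      moreover have "h \<notin> set (slist ?A)" using set \<open>\<not> lt h g\<close> by auto
      ultimately show "Y g (p + frag_of h) = Y g p"
        by (simp add: list_power_prod_add_other)
    }
  qed
qed

end

section \<open>The commutator cocycle and the extension group\<close>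

context Sn_setting
begin

abbreviation "c12 \<equiv> cc 1 2"

lemma c12_conj:
  assumes "x \<in> carrier G" "y \<in> carrier G" "m \<in> carrier SG"
  shows "c12 x y \<otimes>\<^bsub>SG\<^esub> m = diag_act 1 (x \<otimes> y \<otimes> inv x \<otimes> inv y) m \<otimes>\<^bsub>SG\<^esub> c12 x y"
  using assms conj_eq_Act[of "c12 x y" m] by (simp add: mu_cc)

text \<open>Since hw = [h, y] (\<open>y h y\<inverse> w\<close>), the element
  \<open>c12 g (h w)\<close> can be expanded by \<open>cc_mult_right\<close> in two ways.
  Conjugation by \<open>c12 h y\<close> realises the action of [h, y], so
  \<open>c12 g [h, y]\<close> is the quotient of \<open>c12 h y\<close> moved by g and
  \<open>c12 h y\<close>. This is the consistency condition for commuting d(g) past d(h) on normal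
  forms.\<close>

lemma c12_cocycle:
  assumes g: "g \<in> carrier G" and h: "h \<in> carrier G" and y: "y \<in> carrier G" and w: "w \<in> carrier G"
  shows "diag_act 1 g (c12 h y) \<otimes>\<^bsub>SG\<^esub> c12 g (y \<otimes> h \<otimes> inv y \<otimes> w) =
    c12 g h \<otimes>\<^bsub>SG\<^esub> diag_act 1 h (c12 g w) \<otimes>\<^bsub>SG\<^esub> c12 h y"
proof -
  let ?\<kappa> = "c12 h y" and ?x = "h \<otimes> y \<otimes> inv h \<otimes> inv y" and ?m = "y \<otimes> h \<otimes> inv y \<otimes> w"
  have \<kappa>: "?\<kappa> \<in> carrier SG" "diag_act 1 g ?\<kappa> \<in> carrier SG" using g h y by simp_all
  have xm: "?x \<otimes> ?m = h \<otimes> w" using h y w by (simp add: m_assoc)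
  have conj: "?\<kappa> \<otimes>\<^bsub>SG\<^esub> m \<otimes>\<^bsub>SG\<^esub> inv\<^bsub>SG\<^esub> ?\<kappa> = diag_act 1 ?x m" if "m \<in> carrier SG" for m
    using c12_conj[OF h y that] that h y by (simp add: S.S.m_assoc)
  have "hh 1 2 g \<otimes>\<^bsub>SG\<^esub> ?\<kappa> = diag_act 1 g ?\<kappa> \<otimes>\<^bsub>SG\<^esub> hh 1 2 g"
    using g h y by (intro hh_conj) (auto simp: cc_fixed)
  then have 1: "hh 1 2 g \<otimes>\<^bsub>SG\<^esub> ?\<kappa> \<otimes>\<^bsub>SG\<^esub> inv\<^bsub>SG\<^esub> hh 1 2 g = diag_act 1 g ?\<kappa>"
    using g \<kappa> by (simp add: S.S.m_assoc)
  have "c12 g ?x = hh 1 2 g \<otimes>\<^bsub>SG\<^esub> inv\<^bsub>SG\<^esub> (?\<kappa> \<otimes>\<^bsub>SG\<^esub> hh 1 2 g \<otimes>\<^bsub>SG\<^esub> inv\<^bsub>SG\<^esub> ?\<kappa>)"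
    unfolding cc_def[of 1 2 g] by (subst conj) (use g in auto)
  also have "\<dots> = (hh 1 2 g \<otimes>\<^bsub>SG\<^esub> ?\<kappa> \<otimes>\<^bsub>SG\<^esub> inv\<^bsub>SG\<^esub> hh 1 2 g) \<otimes>\<^bsub>SG\<^esub> inv\<^bsub>SG\<^esub> ?\<kappa>"
    using g \<kappa> by (simp add: S.S.m_assoc S.S.inv_mult_group)
  finally have 2: "c12 g ?x = diag_act 1 g ?\<kappa> \<otimes>\<^bsub>SG\<^esub> inv\<^bsub>SG\<^esub> ?\<kappa>" by (simp only: 1)
  have 3: "diag_act 1 ?x (c12 g ?m) = ?\<kappa> \<otimes>\<^bsub>SG\<^esub> c12 g ?m \<otimes>\<^bsub>SG\<^esub> inv\<^bsub>SG\<^esub> ?\<kappa>"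
    using g h y w by (intro conj[symmetric]) simp
  have "c12 g h \<otimes>\<^bsub>SG\<^esub> diag_act 1 h (c12 g w) = c12 g (h \<otimes> w)"
    using g h w by (simp add: cc_mult_right)
  also have "\<dots> = c12 g ?x \<otimes>\<^bsub>SG\<^esub> diag_act 1 ?x (c12 g ?m)"
    using g h y w by (simp only: flip: xm) (simp add: cc_mult_right)
  also have "\<dots> = diag_act 1 g ?\<kappa> \<otimes>\<^bsub>SG\<^esub> inv\<^bsub>SG\<^esub> ?\<kappa> \<otimes>\<^bsub>SG\<^esub> (?\<kappa> \<otimes>\<^bsub>SG\<^esub> c12 g ?m \<otimes>\<^bsub>SG\<^esub> inv\<^bsub>SG\<^esub> ?\<kappa>)"
    by (simp only: 2 3)
  finally show ?thesis
    using g h y w \<kappa> by (simp add: S.S.m_assoc)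
qed

text \<open>Let \<open>S\<^sub>n(G)\<close> and commuting shifts act on \<open>X = S\<^sub>n(G) \<times> \<int>[G]\<close>. The twist \<open>q g p\<close> is chosen so that
  \<open>d g\<close> acts on the normal forms \<open>s \<cdot> \<Prod> d(h)\<^bsup>p h\<^esup>\<close>, with the product in increasing order, by left multiplication.\<close>

lemma extension_group:
  obtains Q :: "((nat \<times> 'a) word set \<times> ('a \<Rightarrow>\<^sub>0 int) \<Rightarrow> (nat \<times> 'a) word set \<times> ('a \<Rightarrow>\<^sub>0 int)) monoid"
    and \<iota> d
  where "group Q" "\<iota> \<in> hom SG Q" "inj_on \<iota> (carrier SG)" "\<And>g. g \<in> carrier G \<Longrightarrow> d g \<in> carrier Q"
    "\<And>g s. g \<in> carrier G \<Longrightarrow> s \<in> carrier SG \<Longrightarrow> d g \<otimes>\<^bsub>Q\<^esub> \<iota> s = \<iota> (diag_act 1 g s) \<otimes>\<^bsub>Q\<^esub> d g"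
    "\<And>g h. g \<in> carrier G \<Longrightarrow> h \<in> carrier G \<Longrightarrow> d g \<otimes>\<^bsub>Q\<^esub> d h = \<iota> (c12 g h) \<otimes>\<^bsub>Q\<^esub> d h \<otimes>\<^bsub>Q\<^esub> d g"
proof -
  obtain lt Y where lt: "asymp lt" "\<And>x y. x \<noteq> y \<Longrightarrow> lt x y \<or> lt y x"
    and Y: "\<And>g p. Poly_Mapping.keys p \<subseteq> carrier G \<Longrightarrow> Y g p \<in> carrier G"
    and Y_less: "\<And>g h p. Poly_Mapping.keys p \<subseteq> carrier G \<Longrightarrow> h \<in> carrier G \<Longrightarrow> lt h g \<Longrightarrow>
      Y g (p + frag_of h) = Y h p \<otimes> h \<otimes> inv (Y h p) \<otimes> Y g p"
    and Y_other: "\<And>g h p. Poly_Mapping.keys p \<subseteq> carrier G \<Longrightarrow> h \<in> carrier G \<Longrightarrow> \<not> lt h g \<Longrightarrow>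
      Y g (p + frag_of h) = Y g p"
    using ordered_power_products by blast
  define P where "P = {p :: 'a \<Rightarrow>\<^sub>0 int. Poly_Mapping.keys p \<subseteq> carrier G}"
  define q where "q g p = c12 g (Y g p)" for g p
  have q [simp]: "q g p \<in> carrier SG" if "g \<in> carrier G" "p \<in> P" for g p
    using that Y by (simp add: q_def P_def)
  have P_shift: "p + frag_of g \<in> P" "p - frag_of g \<in> P" if "g \<in> carrier G" "p \<in> P" for g p
    using that keys_add[of p "frag_of g"] keys_diff[of p "frag_of g"] by (auto simp: P_def keys_frag_of)
  \<comment> \<open>As h precedes g, adding h changes the ordered product below g into
    \<open>y h y\<inverse> w\<close> with \<open>y = Y h p\<close> and \<open>w = Y g p\<close>,
    while adding g leaves the product below h alone. The claim is then
    \<open>c12_cocycle\<close>.\<close>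
  have q_less: "diag_act 1 g (q h p) \<otimes>\<^bsub>SG\<^esub> q g (p + frag_of h) =
      c12 g h \<otimes>\<^bsub>SG\<^esub> diag_act 1 h (q g p) \<otimes>\<^bsub>SG\<^esub> q h (p + frag_of g)"
    if "g \<in> carrier G" "h \<in> carrier G" "p \<in> P" "lt h g" for g h p
  proof -
    have "\<not> lt g h" using that(4) lt(1) by (meson asympD)
    then show ?thesis
      using that Y_less[of p h g] Y_other[of p g h] Y c12_cocycle[of g h "Y h p" "Y g p"]
      by (simp add: q_def P_def)
  qed
  \<comment> \<open>This compares the twists produced by d(g) d(h) and by d(h) d(g). The case of the
    opposite order follows from antisymmetry of \<open>c12\<close>, and equal arguments from
    \<open>c12 g g = 1\<close>.\<close>
  have q_flat: "diag_act 1 g (q h p) \<otimes>\<^bsub>SG\<^esub> q g (p + frag_of h) =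
      c12 g h \<otimes>\<^bsub>SG\<^esub> (diag_act 1 h (q g p) \<otimes>\<^bsub>SG\<^esub> q h (p + frag_of g))"
    if gh: "g \<in> carrier G" "h \<in> carrier G" "p \<in> P" for g h p
  proof -
    consider "lt h g" | "lt g h" | "g = h" using lt(2) by blast
    then show ?thesis
    proof cases
      case 1
      then show ?thesis using q_less[OF gh] gh P_shift by (simp add: S.S.m_assoc)
    next
      case 2
      have "c12 g h = inv\<^bsub>SG\<^esub> c12 h g" using gh by (intro cc_antisym) auto
      then show ?thesis
        using q_less[OF gh(2,1,3) 2] gh P_shift by (simp add: S.S.m_assoc)
    next
      case 3
      then show ?thesis using gh P_shift by (simp add: cc_self)
    qed
  qed
  \<comment> \<open>Working with bijections of the normal forms makes the group axioms automatic;
    only bijectivity and the prescribed commutation rules are left to check.\<close>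
  define X where "X = carrier SG \<times> P"
  define Q where "Q = BijGroup X"
  define \<iota> where "\<iota> s = (\<lambda>(t, p)\<in>X. (s \<otimes>\<^bsub>SG\<^esub> t, p))" for s
  define d where "d g = (\<lambda>(t, p)\<in>X. (diag_act 1 g t \<otimes>\<^bsub>SG\<^esub> q g p, p + frag_of g))" for g
  have \<iota>_app: "\<iota> s (t, p) = (s \<otimes>\<^bsub>SG\<^esub> t, p)" if "t \<in> carrier SG" "p \<in> P" for s t p
    using that by (simp add: \<iota>_def X_def)
  have d_app: "d g (t, p) = (diag_act 1 g t \<otimes>\<^bsub>SG\<^esub> q g p, p + frag_of g)" if "t \<in> carrier SG" "p \<in> P" for g t p
    using that by (simp add: d_def X_def)
  have \<iota>_Bij: "\<iota> s \<in> Bij X" if s: "s \<in> carrier SG" for s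
  proof -
    have "bij_betw (\<iota> s) X X"
      using s by (intro bij_betw_byWitness[where f' = "\<lambda>(t, p). (inv\<^bsub>SG\<^esub> s \<otimes>\<^bsub>SG\<^esub> t, p)"])
        (auto simp: X_def \<iota>_app)
    then show ?thesis by (simp add: Bij_def \<iota>_def)
  qed
  have diag_inverse: "diag_act 1 g (diag_act 1 (inv g) t) = t" "diag_act 1 (inv g) (diag_act 1 g t) = t"
    if "g \<in> carrier G" "t \<in> carrier SG" for g t
    using that by (simp_all add: Act_Act wdiag_mult wdiag_one Act_one)
  have d_Bij: "d g \<in> Bij X" if g: "g \<in> carrier G" for g
  proof -
    have "bij_betw (d g) X X"
      using g P_shift
      by (intro bij_betw_byWitness[where f' = "\<lambda>(t, p). (diag_act 1 (inv g) (t \<otimes>\<^bsub>SG\<^esub> inv\<^bsub>SG\<^esub> q g (p - frag_of g)), p - frag_of g)"])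
        (auto simp: X_def d_app S.S.m_assoc diag_inverse simp del: One_nat_def)
    then show ?thesis by (simp add: Bij_def d_def)
  qed
  have carrier_Q: "carrier Q = Bij X" by (simp add: Q_def BijGroup_def)
  have mult_Q: "(f \<otimes>\<^bsub>Q\<^esub> f') x = f (f' x)" if "f \<in> Bij X" "f' \<in> Bij X" "x \<in> X" for f f' x
    using that by (simp add: Q_def BijGroup_def compose_def)
  interpret Q: group Q unfolding Q_def by (rule group_BijGroup)
  have Q_eqI: "f = f'" if "f \<in> carrier Q" "f' \<in> carrier Q"
    "\<And>t p. t \<in> carrier SG \<Longrightarrow> p \<in> P \<Longrightarrow> f (t, p) = f' (t, p)" for f f'
    using that by (intro extensionalityI[of _ X]) (auto simp: carrier_Q Bij_imp_extensional X_def)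
  have \<iota>_Q: "\<iota> s \<in> carrier Q" if "s \<in> carrier SG" for s using \<iota>_Bij[OF that] by (simp add: carrier_Q)
  have d_Q: "d g \<in> carrier Q" if "g \<in> carrier G" for g using d_Bij[OF that] by (simp add: carrier_Q)
  have in_X: "(t, p) \<in> X \<longleftrightarrow> t \<in> carrier SG \<and> p \<in> P" for t p by (simp add: X_def)
  have comp: "(f \<otimes>\<^bsub>Q\<^esub> f') (t, p) = f (f' (t, p))"
    if "f \<in> carrier Q" "f' \<in> carrier Q" "t \<in> carrier SG" "p \<in> P" for f f' t p
    using that mult_Q by (simp add: carrier_Q in_X)
  show thesis
  proof
    show "group Q" by (rule Q.group_axioms)
    show "\<iota> \<in> hom SG Q"
    proof (rule homI)
      fix s s' assume s: "s \<in> carrier SG" "s' \<in> carrier SG"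
      then show "\<iota> (s \<otimes>\<^bsub>SG\<^esub> s') = \<iota> s \<otimes>\<^bsub>Q\<^esub> \<iota> s'"
        by (intro Q_eqI) (auto simp: \<iota>_Q comp \<iota>_app S.S.m_assoc)
    qed (rule \<iota>_Q)
    show "inj_on \<iota> (carrier SG)"
    proof (rule inj_onI)
      fix s s' assume s: "s \<in> carrier SG" "s' \<in> carrier SG" "\<iota> s = \<iota> s'"
      \<comment> \<open>Injectivity is read off from the orbit of the normal form with no
        d-factors.\<close>
      have "0 \<in> P" by (simp add: P_def)
      then have "\<iota> s (\<one>\<^bsub>SG\<^esub>, 0) = (s, 0)" "\<iota> s' (\<one>\<^bsub>SG\<^esub>, 0) = (s', 0)" using s(1,2) by (simp_all add: \<iota>_app)
      with s(3) show "s = s'" by (metis prod.inject)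
    qed
    show "d g \<in> carrier Q" if "g \<in> carrier G" for g using that by (rule d_Q)
    show "d g \<otimes>\<^bsub>Q\<^esub> \<iota> s = \<iota> (diag_act 1 g s) \<otimes>\<^bsub>Q\<^esub> d g" if "g \<in> carrier G" "s \<in> carrier SG" for g s
      using that by (intro Q_eqI) (auto simp: \<iota>_Q d_Q comp \<iota>_app d_app S.S.m_assoc P_shift)
    show "d g \<otimes>\<^bsub>Q\<^esub> d h = \<iota> (c12 g h) \<otimes>\<^bsub>Q\<^esub> d h \<otimes>\<^bsub>Q\<^esub> d g" if gh: "g \<in> carrier G" "h \<in> carrier G" for g h
    proof (rule Q_eqI)
      show "d g \<otimes>\<^bsub>Q\<^esub> d h \<in> carrier Q" "\<iota> (c12 g h) \<otimes>\<^bsub>Q\<^esub> d h \<otimes>\<^bsub>Q\<^esub> d g \<in> carrier Q"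
        using gh by (simp_all add: d_Q \<iota>_Q)
      fix t p assume t: "t \<in> carrier SG" and p: "p \<in> P"
      have *: "c12 g h \<otimes>\<^bsub>SG\<^esub> diag_act 1 (h \<otimes> g) t = diag_act 1 (g \<otimes> h) t \<otimes>\<^bsub>SG\<^esub> c12 g h"
        \<comment> \<open>\<open>c12 g h\<close> acts as the commutator of g and h, and that
          commutator times hg is gh.\<close>
        using gh t c12_conj[of g h "diag_act 1 (h \<otimes> g) t"] by (simp add: Act_Act wdiag_mult m_assoc)
      have "(d g \<otimes>\<^bsub>Q\<^esub> d h) (t, p) =
        (diag_act 1 (g \<otimes> h) t \<otimes>\<^bsub>SG\<^esub> (diag_act 1 g (q h p) \<otimes>\<^bsub>SG\<^esub> q g (p + frag_of h)), p + frag_of h + frag_of g)"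
        using gh t p P_shift by (simp add: comp d_Q d_app S.S.m_assoc Act_Act wdiag_mult)
      also have "\<dots> = (c12 g h \<otimes>\<^bsub>SG\<^esub> diag_act 1 (h \<otimes> g) t \<otimes>\<^bsub>SG\<^esub> (diag_act 1 h (q g p) \<otimes>\<^bsub>SG\<^esub> q h (p + frag_of g)),
          p + frag_of g + frag_of h)"
        unfolding * q_flat[OF gh p] using gh t p P_shift by (simp add: S.S.m_assoc add_ac)
      also have "\<dots> = (\<iota> (c12 g h) \<otimes>\<^bsub>Q\<^esub> d h \<otimes>\<^bsub>Q\<^esub> d g) (t, p)"
      proof -
        have "d g (t, p) \<in> X" "d h (d g (t, p)) \<in> X" using gh t p P_shift by (simp_all add: d_app in_X)
        then have "(\<iota> (c12 g h) \<otimes>\<^bsub>Q\<^esub> d h \<otimes>\<^bsub>Q\<^esub> d g) (t, p) = \<iota> (c12 g h) (d h (d g (t, p)))"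
          using gh t p by (simp add: mult_Q flip: carrier_Q add: d_Q \<iota>_Q in_X)
        then show ?thesis
          using gh t p P_shift by (simp add: d_app \<iota>_app S.S.m_assoc Act_Act wdiag_mult)
      qed
      finally show "(d g \<otimes>\<^bsub>Q\<^esub> d h) (t, p) = (\<iota> (c12 g h) \<otimes>\<^bsub>Q\<^esub> d h \<otimes>\<^bsub>Q\<^esub> d g) (t, p)" .
    qed
  qed
qed

end

section \<open>The universal central extension with abelian kernel\<close>

text \<open>The cocycle is not assumed normalised, since the bar complex in use is unnormalised. The
  value at (1, 1) therefore appears as a correction in the unit of the extension and in the
  embedding of the kernel.\<close>

locale group_cocycle = G: group G + A: comm_group A
  for G :: "('a, 'b) monoid_scheme" (structure) and A :: "('c, 'd) monoid_scheme" +
  fixes f :: "'a \<Rightarrow> 'a \<Rightarrow> 'c"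
  assumes f_closed [simp]: "a \<in> carrier G \<Longrightarrow> b \<in> carrier G \<Longrightarrow> f a b \<in> carrier A"
    and cocycle: "a \<in> carrier G \<Longrightarrow> b \<in> carrier G \<Longrightarrow> c \<in> carrier G \<Longrightarrow>
      f a b \<otimes>\<^bsub>A\<^esub> f (a \<otimes> b) c = f b c \<otimes>\<^bsub>A\<^esub> f a (b \<otimes> c)"
begin

definition ext :: "('c \<times> 'a) monoid"
  where "ext = \<lparr>carrier = carrier A \<times> carrier G,
    monoid.mult = (\<lambda>(\<alpha>, g) (\<beta>, h). (\<alpha> \<otimes>\<^bsub>A\<^esub> \<beta> \<otimes>\<^bsub>A\<^esub> f g h, g \<otimes> h)),
    one = (inv\<^bsub>A\<^esub> f \<one> \<one>, \<one>)\<rparr>"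

lemma carrier_ext: "carrier ext = carrier A \<times> carrier G"
  by (simp add: ext_def)

lemma mult_ext: "(\<alpha>, g) \<otimes>\<^bsub>ext\<^esub> (\<beta>, h) = (\<alpha> \<otimes>\<^bsub>A\<^esub> \<beta> \<otimes>\<^bsub>A\<^esub> f g h, g \<otimes> h)"
  by (simp add: ext_def)

lemma one_ext: "\<one>\<^bsub>ext\<^esub> = (inv\<^bsub>A\<^esub> f \<one> \<one>, \<one>)"
  by (simp add: ext_def)

lemma f_one_left: "g \<in> carrier G \<Longrightarrow> f \<one> g = f \<one> \<one>"
  using cocycle[of \<one> \<one> g] by simp

lemma f_one_right: "g \<in> carrier G \<Longrightarrow> f g \<one> = f \<one> \<one>"
  using cocycle[of g \<one> \<one>] by simp

lemma group_ext: "group ext"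
proof (rule groupI)
  fix x assume "x \<in> carrier ext"
  then obtain \<alpha> g where x: "x = (\<alpha>, g)" "\<alpha> \<in> carrier A" "g \<in> carrier G" by (auto simp: carrier_ext)
  have "inv\<^bsub>A\<^esub> f \<one> \<one> \<otimes>\<^bsub>A\<^esub> \<alpha> \<otimes>\<^bsub>A\<^esub> f \<one> \<one> = \<alpha>"
    using x by (simp add: A.m_assoc A.m_comm[of \<alpha>])
  then show "\<one>\<^bsub>ext\<^esub> \<otimes>\<^bsub>ext\<^esub> x = x"
    using x by (simp add: one_ext mult_ext f_one_left[of g])
  let ?y = "(inv\<^bsub>A\<^esub> (f \<one> \<one> \<otimes>\<^bsub>A\<^esub> \<alpha> \<otimes>\<^bsub>A\<^esub> f (inv g) g), inv g)"
  have "?y \<otimes>\<^bsub>ext\<^esub> x = \<one>\<^bsub>ext\<^esub>"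
  proof -
    let ?F = "\<alpha> \<otimes>\<^bsub>A\<^esub> f (inv g) g"
    have "inv\<^bsub>A\<^esub> (f \<one> \<one> \<otimes>\<^bsub>A\<^esub> ?F) \<otimes>\<^bsub>A\<^esub> ?F = inv\<^bsub>A\<^esub> f \<one> \<one> \<otimes>\<^bsub>A\<^esub> (inv\<^bsub>A\<^esub> ?F \<otimes>\<^bsub>A\<^esub> ?F)"
      using x A.inv_mult[of "f \<one> \<one>" ?F] by (simp only: A.m_assoc A.m_closed A.inv_closed f_closed G.one_closed G.inv_closed)
    then show ?thesis using x by (simp add: one_ext mult_ext A.m_assoc)
  qed
  moreover have "?y \<in> carrier ext" using x by (simp add: carrier_ext)
  ultimately show "\<exists>y\<in>carrier ext. y \<otimes>\<^bsub>ext\<^esub> x = \<one>\<^bsub>ext\<^esub>" by blast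
next
  fix x y z assume "x \<in> carrier ext" "y \<in> carrier ext" "z \<in> carrier ext"
  then obtain \<alpha> g \<beta> h \<gamma> k where x: "x = (\<alpha>, g)" "\<alpha> \<in> carrier A" "g \<in> carrier G"
    "y = (\<beta>, h)" "\<beta> \<in> carrier A" "h \<in> carrier G" "z = (\<gamma>, k)" "\<gamma> \<in> carrier A" "k \<in> carrier G"
    by (auto simp: carrier_ext)
  have "\<alpha> \<otimes>\<^bsub>A\<^esub> \<beta> \<otimes>\<^bsub>A\<^esub> f g h \<otimes>\<^bsub>A\<^esub> \<gamma> \<otimes>\<^bsub>A\<^esub> f (g \<otimes> h) k = \<alpha> \<otimes>\<^bsub>A\<^esub> \<beta> \<otimes>\<^bsub>A\<^esub> \<gamma> \<otimes>\<^bsub>A\<^esub> (f g h \<otimes>\<^bsub>A\<^esub> f (g \<otimes> h) k)"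
    using x by (simp add: A.m_ac)
  also have "\<dots> = \<alpha> \<otimes>\<^bsub>A\<^esub> (\<beta> \<otimes>\<^bsub>A\<^esub> \<gamma> \<otimes>\<^bsub>A\<^esub> f h k) \<otimes>\<^bsub>A\<^esub> f g (h \<otimes> k)"
    using x by (simp add: cocycle A.m_assoc)
  finally show "x \<otimes>\<^bsub>ext\<^esub> y \<otimes>\<^bsub>ext\<^esub> z = x \<otimes>\<^bsub>ext\<^esub> (y \<otimes>\<^bsub>ext\<^esub> z)"
    using x by (simp add: mult_ext G.m_assoc)
qed (auto simp: carrier_ext one_ext mult_ext)

text \<open>The factor \<open>inv f(1, 1)\<close> compensates for the unnormalised cocycle and makes
  this a homomorphism.\<close>

definition ext_in :: "'c \<Rightarrow> 'c \<times> 'a" where "ext_in \<alpha> = (\<alpha> \<otimes>\<^bsub>A\<^esub> inv\<^bsub>A\<^esub> f \<one> \<one>, \<one>)"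

definition ext_lift :: "'a \<Rightarrow> 'c \<times> 'a" where "ext_lift g = (\<one>\<^bsub>A\<^esub>, g)"

lemma ext_lift_closed [simp]: "g \<in> carrier G \<Longrightarrow> ext_lift g \<in> carrier ext"
  by (simp add: ext_lift_def carrier_ext)

lemma ext_in_closed [simp]: "\<alpha> \<in> carrier A \<Longrightarrow> ext_in \<alpha> \<in> carrier ext"
  by (simp add: ext_in_def carrier_ext)

lemma ext_in_hom: "ext_in \<in> hom A ext"
proof (rule homI)
  fix \<alpha> \<beta> assume "\<alpha> \<in> carrier A" "\<beta> \<in> carrier A"
  then show "ext_in (\<alpha> \<otimes>\<^bsub>A\<^esub> \<beta>) = ext_in \<alpha> \<otimes>\<^bsub>ext\<^esub> ext_in \<beta>"
    by (simp add: ext_in_def mult_ext A.m_ac)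
qed simp

lemma snd_hom: "snd \<in> hom ext G"
  by (rule homI) (auto simp: carrier_ext mult_ext)

lemma ext_decompose:
  assumes "\<gamma> \<in> carrier ext"
  shows "\<gamma> = ext_in (fst \<gamma>) \<otimes>\<^bsub>ext\<^esub> ext_lift (snd \<gamma>)"
  using assms f_one_left[of "snd \<gamma>"] by (auto simp: carrier_ext ext_in_def ext_lift_def mult_ext A.m_assoc)

lemma ext_lift_mult:
  "g \<in> carrier G \<Longrightarrow> h \<in> carrier G \<Longrightarrow> ext_lift g \<otimes>\<^bsub>ext\<^esub> ext_lift h = ext_in (f g h) \<otimes>\<^bsub>ext\<^esub> ext_lift (g \<otimes> h)"
  by (simp add: ext_in_def ext_lift_def mult_ext f_one_left[of "g \<otimes> h"] A.m_assoc)

lemma snd_eq_one_iff: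
  "\<gamma> \<in> carrier ext \<Longrightarrow> snd \<gamma> = \<one> \<longleftrightarrow> (\<exists>\<alpha> \<in> carrier A. \<gamma> = ext_in \<alpha>)"
proof
  assume \<gamma>: "\<gamma> \<in> carrier ext" "snd \<gamma> = \<one>"
  then have "\<gamma> = ext_in (fst \<gamma> \<otimes>\<^bsub>A\<^esub> f \<one> \<one>)"
    by (auto simp: carrier_ext ext_in_def A.m_assoc)
  moreover have "fst \<gamma> \<otimes>\<^bsub>A\<^esub> f \<one> \<one> \<in> carrier A" using \<gamma> by (auto simp: carrier_ext)
  ultimately show "\<exists>\<alpha> \<in> carrier A. \<gamma> = ext_in \<alpha>" by blast
qed (auto simp: ext_in_def)

lemma ext_central:
  assumes "z \<in> carrier ext" "\<gamma> \<in> carrier ext" "snd z = \<one>"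
  shows "z \<otimes>\<^bsub>ext\<^esub> \<gamma> = \<gamma> \<otimes>\<^bsub>ext\<^esub> z"
proof -
  have "snd \<gamma> \<in> carrier G" using assms by (auto simp: carrier_ext)
  then show ?thesis
    using assms f_one_left[of "snd \<gamma>"] f_one_right[of "snd \<gamma>"]
    by (auto simp: carrier_ext mult_ext A.m_ac)
qed

lemma ext_in_inj: "inj_on ext_in (carrier A)"
  by (rule inj_onI) (simp add: ext_in_def)

end

section \<open>The bar complex in degrees up to three\<close>

context group
begin

abbreviation bar :: "nat \<Rightarrow> ('a list \<Rightarrow>\<^sub>0 int) monoid" where "bar k \<equiv> bar_chain_group G k"
abbreviation bd :: "nat \<Rightarrow> ('a list \<Rightarrow>\<^sub>0 int) \<Rightarrow> ('a list \<Rightarrow>\<^sub>0 int)" where "bd k \<equiv> bar_boundary G k"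

lemma comm_group_bar: "comm_group (bar k)"
  by (simp add: bar_chain_group_def abelian_free_Abelian_group)

lemma bar_simps [simp]:
  "c \<in> carrier (bar k) \<longleftrightarrow> Poly_Mapping.keys c \<subseteq> {gs. length gs = k \<and> set gs \<subseteq> carrier G}"
  "\<one>\<^bsub>bar k\<^esub> = 0" "c \<otimes>\<^bsub>bar k\<^esub> c' = c + c'"
  by (simp_all add: bar_chain_group_def)

lemma bd_frag_of_1: "bd 1 (frag_of [a]) = 0"
  by (simp add: bar_boundary_def bar_face_def frag_extend_of)

lemma bd_frag_of_2: "bd 2 (frag_of [a, b]) = frag_of [b] - frag_of [a \<otimes> b] + frag_of [a]"
  by (simp add: bar_boundary_def bar_face_def frag_extend_of numeral_2_eq_2)

lemma bd_frag_of_3: "bd 3 (frag_of [a, b, c]) =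
    frag_of [b, c] - frag_of [a \<otimes> b, c] + frag_of [a, b \<otimes> c] - frag_of [a, b]"
  by (simp add: bar_boundary_def bar_face_def frag_extend_of numeral_3_eq_3 numeral_2_eq_2)

lemma bd_add: "bd k (c + c') = bd k c + bd k c'"
  by (simp add: bar_boundary_def frag_extend_add)

lemma bd_diff: "bd k (c - c') = bd k c - bd k c'"
  by (simp add: bar_boundary_def frag_extend_diff)

lemma bd_0 [simp]: "bd k 0 = 0"
  by (simp add: bar_boundary_def)

lemma bar_1_induct [consumes 1, case_names zero diff frag]:
  assumes "c \<in> carrier (bar 1)" "P 0"
    "\<And>x y. x \<in> carrier (bar 1) \<Longrightarrow> y \<in> carrier (bar 1) \<Longrightarrow> P x \<Longrightarrow> P y \<Longrightarrow> P (x - y)"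
    "\<And>a. a \<in> carrier G \<Longrightarrow> P (frag_of [a])"
  shows "P c"
proof (rule free_Abelian_group_induct[of c "{gs. length gs = 1 \<and> set gs \<subseteq> carrier G}" P])
  fix gs assume "gs \<in> {gs. length gs = 1 \<and> set gs \<subseteq> carrier G}"
  then obtain a where "gs = [a]" "a \<in> carrier G" by (auto simp: length_Suc_conv)
  then show "P (frag_of gs)" using assms(4) by simp
qed (use assms(1-3) in auto)

lemma bar_2_induct [consumes 1, case_names zero diff frag]:
  assumes "c \<in> carrier (bar 2)" "P 0"
    "\<And>x y. x \<in> carrier (bar 2) \<Longrightarrow> y \<in> carrier (bar 2) \<Longrightarrow> P x \<Longrightarrow> P y \<Longrightarrow> P (x - y)"
    "\<And>a b. a \<in> carrier G \<Longrightarrow> b \<in> carrier G \<Longrightarrow> P (frag_of [a, b])"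
  shows "P c"
proof (rule free_Abelian_group_induct[of c "{gs. length gs = 2 \<and> set gs \<subseteq> carrier G}" P])
  fix gs assume "gs \<in> {gs. length gs = 2 \<and> set gs \<subseteq> carrier G}"
  then obtain a b where "gs = [a, b]" "a \<in> carrier G" "b \<in> carrier G"
    by (auto simp: length_Suc_conv numeral_2_eq_2)
  then show "P (frag_of gs)" using assms(4) by simp
qed (use assms(1-3) in auto)

lemma bar_3_induct [consumes 1, case_names zero diff frag]:
  assumes "c \<in> carrier (bar 3)" "P 0"
    "\<And>x y. x \<in> carrier (bar 3) \<Longrightarrow> y \<in> carrier (bar 3) \<Longrightarrow> P x \<Longrightarrow> P y \<Longrightarrow> P (x - y)"
    "\<And>a b d. a \<in> carrier G \<Longrightarrow> b \<in> carrier G \<Longrightarrow> d \<in> carrier G \<Longrightarrow> P (frag_of [a, b, d])"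
  shows "P c"
proof (rule free_Abelian_group_induct[of c "{gs. length gs = 3 \<and> set gs \<subseteq> carrier G}" P])
  fix gs assume "gs \<in> {gs. length gs = 3 \<and> set gs \<subseteq> carrier G}"
  then obtain a b d where "gs = [a, b, d]" "a \<in> carrier G" "b \<in> carrier G" "d \<in> carrier G"
    by (auto simp: length_Suc_conv numeral_3_eq_3)
  then show "P (frag_of gs)" using assms(4) by simp
qed (use assms(1-3) in auto)

lemma bar_diff_closed:
  "x \<in> carrier (bar k) \<Longrightarrow> y \<in> carrier (bar k) \<Longrightarrow> x - y \<in> carrier (bar k)"
  using keys_diff[of x y] unfolding bar_simps by blast

lemma bar_add_closed:
  "x \<in> carrier (bar k) \<Longrightarrow> y \<in> carrier (bar k) \<Longrightarrow> x + y \<in> carrier (bar k)"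
  using keys_add[of x y] unfolding bar_simps by blast

lemma bd_1: "c \<in> carrier (bar 1) \<Longrightarrow> bd 1 c = 0"
  by (induction c rule: bar_1_induct) (simp_all only: bd_0 bd_diff bd_frag_of_1 diff_self)

lemma bd_2_closed: "c \<in> carrier (bar 2) \<Longrightarrow> bd 2 c \<in> carrier (bar 1)"
proof (induction c rule: bar_2_induct)
  case (frag a b)
  then have "frag_of [b] \<in> carrier (bar 1)" "frag_of [a \<otimes> b] \<in> carrier (bar 1)" "frag_of [a] \<in> carrier (bar 1)"
    by auto
  then show ?case unfolding bd_frag_of_2 by (intro bar_add_closed bar_diff_closed)
qed (simp_all only: bd_0 bd_diff bar_diff_closed, simp)

lemma bd_3_closed: "c \<in> carrier (bar 3) \<Longrightarrow> bd 3 c \<in> carrier (bar 2)"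
proof (induction c rule: bar_3_induct)
  case (frag a b d)
  then have "frag_of [b, d] \<in> carrier (bar 2)" "frag_of [a \<otimes> b, d] \<in> carrier (bar 2)"
    "frag_of [a, b \<otimes> d] \<in> carrier (bar 2)" "frag_of [a, b] \<in> carrier (bar 2)"
    by auto
  then show ?case unfolding bd_frag_of_3 by (intro bar_add_closed bar_diff_closed)
qed (simp_all only: bd_0 bd_diff bar_diff_closed, simp)

lemma bd_2_bd_3: "c \<in> carrier (bar 3) \<Longrightarrow> bd 2 (bd 3 c) = 0"
proof (induction c rule: bar_3_induct)
  case (frag a b d)
  then show ?case by (simp add: bd_frag_of_3 bd_frag_of_2 bd_add bd_diff m_assoc)
qed (simp_all only: bd_0 bd_diff diff_self)

lemma bd_2_hom: "bd 2 \<in> hom (bar 2) (bar 1)"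
  by (rule homI) (simp_all only: bd_2_closed bd_add bar_simps(3))

lemma bd_3_hom: "bd 3 \<in> hom (bar 3) (bar 2)"
  by (rule homI) (simp_all only: bd_3_closed bd_add bar_simps(3))

definition bdry :: "nat \<Rightarrow> ('a list \<Rightarrow>\<^sub>0 int) set" where "bdry k = bd (k + 1) ` carrier (bar (k + 1))"

lemma subgroup_bdry_1: "subgroup (bdry 1) (bar 1)"
proof -
  interpret C2: comm_group "bar 2" by (rule comm_group_bar)
  interpret C1: comm_group "bar 1" by (rule comm_group_bar)
  interpret h: group_hom "bar 2" "bar 1" "bd 2"
    using bd_2_hom by (simp only: group_hom_def group_hom_axioms_def C1.group_axioms C2.group_axioms simp_thms)
  have "bdry 1 = bd 2 ` carrier (bar 2)" by (simp add: bdry_def numeral_2_eq_2)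
  then show ?thesis using h.img_is_subgroup by simp
qed

lemma subgroup_bdry_2: "subgroup (bdry 2) (bar 2)"
proof -
  interpret C3: comm_group "bar 3" by (rule comm_group_bar)
  interpret C2: comm_group "bar 2" by (rule comm_group_bar)
  interpret h: group_hom "bar 3" "bar 2" "bd 3"
    using bd_3_hom by (simp add: group_hom_def group_hom_axioms_def C3.group_axioms C2.group_axioms)
  have "bdry 2 = bd 3 ` carrier (bar 3)" by (simp add: bdry_def)
  then show ?thesis using h.img_is_subgroup by simp
qed

text \<open>\<open>bar2_mod\<close> is \<open>C\<^sub>2 / B\<^sub>2\<close>, in which \<open>[a|b]\<close> is the universal 2-cocycle.\<close>

definition bar2_mod :: "('a list \<Rightarrow>\<^sub>0 int) set monoid"
  where "bar2_mod = bar 2 Mod bdry 2"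

definition bar2_cls :: "('a list \<Rightarrow>\<^sub>0 int) \<Rightarrow> ('a list \<Rightarrow>\<^sub>0 int) set"
  where "bar2_cls c = bdry 2 #>\<^bsub>bar 2\<^esub> c"

lemma comm_group_bar2_mod: "comm_group bar2_mod"
  unfolding bar2_mod_def by (rule comm_group.abelian_FactGroup[OF comm_group_bar subgroup_bdry_2])

lemma normal_bdry_2: "bdry 2 \<lhd> bar 2"
  by (rule comm_group.subgroup_imp_normal[OF comm_group_bar subgroup_bdry_2])

lemma bar2_cls_hom: "bar2_cls \<in> hom (bar 2) bar2_mod"
  unfolding bar2_cls_def bar2_mod_def by (rule normal.r_coset_hom_Mod[OF normal_bdry_2])

lemma carrier_bar2_mod: "carrier bar2_mod = bar2_cls ` carrier (bar 2)"
  by (simp add: bar2_mod_def bar2_cls_def carrier_FactGroup)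

lemma bar2_cls_add: "c \<in> carrier (bar 2) \<Longrightarrow> c' \<in> carrier (bar 2) \<Longrightarrow>
    bar2_cls (c + c') = bar2_cls c \<otimes>\<^bsub>bar2_mod\<^esub> bar2_cls c'"
  using hom_mult[OF bar2_cls_hom] by simp

lemma bar2_cls_eq_one_iff:
  assumes "c \<in> carrier (bar 2)"
  shows "bar2_cls c = \<one>\<^bsub>bar2_mod\<^esub> \<longleftrightarrow> c \<in> bdry 2"
proof -
  interpret C2: comm_group "bar 2" by (rule comm_group_bar)
  interpret B: subgroup "bdry 2" "bar 2" by (rule subgroup_bdry_2)
  show ?thesis
    using assms C2.coset_join1[OF _ assms subgroup_bdry_2] C2.coset_join2[OF assms subgroup_bdry_2]
    by (auto simp: bar2_mod_def bar2_cls_def)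
qed

lemma bar2_mod_factor:
  assumes "group H" "h \<in> hom (bar 2) H" "\<And>c. c \<in> carrier (bar 3) \<Longrightarrow> h (bd 3 c) = \<one>\<^bsub>H\<^esub>"
  obtains h' where "h' \<in> hom bar2_mod H" "\<And>c. c \<in> carrier (bar 2) \<Longrightarrow> h' (bar2_cls c) = h c"
proof -
  interpret C2: comm_group "bar 2" by (rule comm_group_bar)
  interpret h: group_hom "bar 2" H h
    using assms by (simp add: group_hom_def group_hom_axioms_def C2.group_axioms)
  have "bdry 2 \<subseteq> kernel (bar 2) H h"
    using assms(3) bd_3_closed by (auto simp: bdry_def kernel_def simp del: bar_simps)
  from h.FactGroup_universal_kernel[OF normal_bdry_2 this] show thesis
    using that unfolding bar2_mod_def bar2_cls_def by metis
qed

text \<open>The centre is taken relative to a subgroup H of G, as elements may commute with H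
  without being central in the ambient group.\<close>

lemma subgroup_center:
  assumes "subgroup H G"
  shows "comm_group (G\<lparr>carrier := {z \<in> H. \<forall>h \<in> H. z \<otimes> h = h \<otimes> z}\<rparr>)" (is "comm_group ?Z")
    and "subgroup {z \<in> H. \<forall>h \<in> H. z \<otimes> h = h \<otimes> z} G"
proof -
  interpret H: subgroup H G by fact
  show sub: "subgroup {z \<in> H. \<forall>h \<in> H. z \<otimes> h = h \<otimes> z} G"
  proof
    fix x y assume "x \<in> {z \<in> H. \<forall>h \<in> H. z \<otimes> h = h \<otimes> z}" "y \<in> {z \<in> H. \<forall>h \<in> H. z \<otimes> h = h \<otimes> z}"
    then have xy: "x \<in> H" "y \<in> H" "\<And>h. h \<in> H \<Longrightarrow> x \<otimes> h = h \<otimes> x" "\<And>h. h \<in> H \<Longrightarrow> y \<otimes> h = h \<otimes> y" by auto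
    have "x \<otimes> y \<otimes> h = h \<otimes> (x \<otimes> y)" if h: "h \<in> H" for h
    proof -
      have c: "x \<in> carrier G" "y \<in> carrier G" "h \<in> carrier G" using xy h by auto
      have "x \<otimes> y \<otimes> h = x \<otimes> h \<otimes> y" using c xy(4)[OF h] by (simp add: m_assoc)
      then show ?thesis using c xy(3)[OF h] by (simp add: m_assoc)
    qed
    then show "x \<otimes> y \<in> {z \<in> H. \<forall>h \<in> H. z \<otimes> h = h \<otimes> z}" using H.m_closed[OF xy(1,2)] by blast
  next
    fix x assume "x \<in> {z \<in> H. \<forall>h \<in> H. z \<otimes> h = h \<otimes> z}"
    then have x: "x \<in> H" "\<And>h. h \<in> H \<Longrightarrow> x \<otimes> h = h \<otimes> x" by auto
    have "inv x \<otimes> h = h \<otimes> inv x" if h: "h \<in> H" for h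
    proof -
      have c: "x \<in> carrier G" "h \<in> carrier G" using x h by auto
      then have "inv x \<otimes> (x \<otimes> h) \<otimes> inv x = inv x \<otimes> (h \<otimes> x) \<otimes> inv x" using x(2)[OF h] by simp
      then show ?thesis using c by (simp add: m_assoc)
    qed
    then show "inv x \<in> {z \<in> H. \<forall>h \<in> H. z \<otimes> h = h \<otimes> z}" using H.m_inv_closed[OF x(1)] by blast
  qed auto
  show "comm_group ?Z"
  proof (rule group.group_comm_groupI[OF subgroup_imp_group[OF sub]])
    fix x y assume "x \<in> carrier ?Z" "y \<in> carrier ?Z"
    then have "x \<in> {z \<in> H. \<forall>h \<in> H. z \<otimes> h = h \<otimes> z}" "y \<in> H" by simp_all
    then have "x \<otimes> y = y \<otimes> x" by blast
    then show "x \<otimes>\<^bsub>?Z\<^esub> y = y \<otimes>\<^bsub>?Z\<^esub> x" by simp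
  qed
qed

end

section \<open>The extension by \<open>C\<^sub>2 / B\<^sub>2\<close> and its universal
  property\<close>

locale bar_group = group
begin

definition bar_f :: "'a \<Rightarrow> 'a \<Rightarrow> ('a list \<Rightarrow>\<^sub>0 int) set" where "bar_f a b = bar2_cls (frag_of [a, b])"

sublocale U: group_cocycle G bar2_mod bar_f
proof -
  interpret A: comm_group bar2_mod by (rule comm_group_bar2_mod)
  show "group_cocycle G bar2_mod bar_f"
  proof
    fix a b assume "a \<in> carrier G" "b \<in> carrier G"
    then show "bar_f a b \<in> carrier bar2_mod"
      using hom_in_carrier[OF bar2_cls_hom] by (simp add: bar_f_def)
  next
    fix a b c assume abc: "a \<in> carrier G" "b \<in> carrier G" "c \<in> carrier G"
    let ?x = "frag_of [a, b] + frag_of [a \<otimes> b, c]" and ?y = "frag_of [b, c] + frag_of [a, b \<otimes> c]"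
    have fr: "frag_of [a, b] \<in> carrier (bar 2)" "frag_of [a \<otimes> b, c] \<in> carrier (bar 2)"
      "frag_of [b, c] \<in> carrier (bar 2)" "frag_of [a, b \<otimes> c] \<in> carrier (bar 2)" "frag_of [a, b, c] \<in> carrier (bar 3)"
      using abc by auto
    have xy: "?x \<in> carrier (bar 2)" "?y \<in> carrier (bar 2)"
      using fr by (simp_all only: bar_add_closed)
    \<comment> \<open>The two sides of the cocycle identity differ by the boundary of
      [a|b|c].\<close>
    have "?y - ?x = bd 3 (frag_of [a, b, c])" by (simp add: bd_frag_of_3)
    then have b: "?y - ?x \<in> bdry 2" using fr by (auto simp: bdry_def simp del: bar_simps)
    have "bar2_cls ?y = bar2_cls ((?y - ?x) + ?x)" by simp
    also have "\<dots> = bar2_cls (?y - ?x) \<otimes>\<^bsub>bar2_mod\<^esub> bar2_cls ?x"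
      using xy by (intro bar2_cls_add bar_diff_closed)
    also have "\<dots> = bar2_cls ?x"
      using b xy bar2_cls_eq_one_iff[of "?y - ?x"] hom_in_carrier[OF bar2_cls_hom]
      by (simp add: bar_diff_closed del: bar_simps)
    finally show "bar_f a b \<otimes>\<^bsub>bar2_mod\<^esub> bar_f (a \<otimes> b) c = bar_f b c \<otimes>\<^bsub>bar2_mod\<^esub> bar_f a (b \<otimes> c)"
      using fr by (simp add: bar_f_def bar2_cls_add del: bar_simps)
  qed
qed

text \<open>The class of [a|b] is the product of the lifts of a and b divided by the lift of ab, so
  the lifts also generate the kernel. Homomorphisms out of the extension are thus determined by
  their values on lifts.\<close>

lemma generate_ext_lift: "carrier U.ext = generate U.ext (U.ext_lift ` carrier G)" (is "_ = ?gen")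
proof
  interpret E: group U.ext by (rule U.group_ext)
  interpret in_h: group_hom bar2_mod U.ext U.ext_in
    using U.ext_in_hom by (simp add: group_hom_def group_hom_axioms_def E.group_axioms U.A.group_axioms)
  interpret cls: group_hom "bar 2" bar2_mod bar2_cls
    using bar2_cls_hom comm_group_bar
    by (simp add: group_hom_def group_hom_axioms_def U.A.group_axioms comm_group.axioms)
  have lift_carrier: "U.ext_lift ` carrier G \<subseteq> carrier U.ext" by auto
  interpret gen: subgroup ?gen U.ext by (rule E.generate_is_subgroup[OF lift_carrier])
  have lift_gen: "U.ext_lift g \<in> ?gen" if "g \<in> carrier G" for g
    using that by (auto intro: generate.incl)
  have "U.ext_in (bar2_cls c) \<in> ?gen" if "c \<in> carrier (bar 2)" for c
    using that
  proof (induction c rule: bar_2_induct)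
    case zero
    have "bar2_cls 0 = \<one>\<^bsub>bar2_mod\<^esub>" using cls.hom_one by simp
    then show ?case by simp
  next
    case (diff x y)
    have "bar2_cls (x - y) \<otimes>\<^bsub>bar2_mod\<^esub> bar2_cls y = bar2_cls x"
      using diff bar2_cls_add[of "x - y" y] by (simp add: bar_diff_closed del: bar_simps)
    then have "bar2_cls (x - y) = bar2_cls x \<otimes>\<^bsub>bar2_mod\<^esub> inv\<^bsub>bar2_mod\<^esub> bar2_cls y"
      using diff by (metis U.A.inv_solve_right cls.hom_closed bar_diff_closed)
    then show ?case using diff by (simp del: bar_simps)
  next
    case (frag a b)
    then have f: "bar2_cls (frag_of [a, b]) \<in> carrier bar2_mod" by (intro cls.hom_closed) auto
    have "U.ext_in (bar2_cls (frag_of [a, b])) =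
        U.ext_lift a \<otimes>\<^bsub>U.ext\<^esub> U.ext_lift b \<otimes>\<^bsub>U.ext\<^esub> inv\<^bsub>U.ext\<^esub> U.ext_lift (a \<otimes> b)"
      using frag f U.ext_lift_mult[of a b] by (simp add: bar_f_def E.m_assoc)
    then show ?case using frag by (simp add: lift_gen)
  qed
  then have in_gen: "U.ext_in \<alpha> \<in> ?gen" if "\<alpha> \<in> carrier bar2_mod" for \<alpha>
    using that by (auto simp: carrier_bar2_mod simp del: bar_simps)
  show "carrier U.ext \<subseteq> ?gen"
  proof
    fix \<gamma> assume \<gamma>: "\<gamma> \<in> carrier U.ext"
    then have "fst \<gamma> \<in> carrier bar2_mod" "snd \<gamma> \<in> carrier G" by (auto simp: U.carrier_ext)
    then have "U.ext_in (fst \<gamma>) \<otimes>\<^bsub>U.ext\<^esub> U.ext_lift (snd \<gamma>) \<in> ?gen"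
      by (intro gen.m_closed in_gen lift_gen)
    then show "\<gamma> \<in> ?gen" using U.ext_decompose[OF \<gamma>] by simp
  qed
  show "?gen \<subseteq> carrier U.ext" by (rule E.generate_incl[OF lift_carrier])
qed

definition bd2_mod :: "('a list \<Rightarrow>\<^sub>0 int) set \<Rightarrow> ('a list \<Rightarrow>\<^sub>0 int)"
  where "bd2_mod = (SOME h. h \<in> hom bar2_mod (bar 1) \<and> (\<forall>c \<in> carrier (bar 2). h (bar2_cls c) = bd 2 c))"

lemma bd2_mod_spec: "bd2_mod \<in> hom bar2_mod (bar 1) \<and> (\<forall>c \<in> carrier (bar 2). bd2_mod (bar2_cls c) = bd 2 c)"
proof -
  have "group (bar 1)" using comm_group_bar comm_group.axioms by blast
  from bar2_mod_factor[OF this bd_2_hom] obtain h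
    where "h \<in> hom bar2_mod (bar 1)" "\<And>c. c \<in> carrier (bar 2) \<Longrightarrow> h (bar2_cls c) = bd 2 c"
    using bd_2_bd_3 unfolding bar_simps(2) by blast
  then have "\<exists>h. h \<in> hom bar2_mod (bar 1) \<and> (\<forall>c \<in> carrier (bar 2). h (bar2_cls c) = bd 2 c)" by blast
  then show ?thesis
    unfolding bd2_mod_def by (rule someI_ex)
qed

lemma bd2_mod_hom: "bd2_mod \<in> hom bar2_mod (bar 1)"
  and bd2_mod_cls: "c \<in> carrier (bar 2) \<Longrightarrow> bd2_mod (bar2_cls c) = bd 2 c"
  using bd2_mod_spec by blast+

text \<open>The contribution to the determinant of a single entry. It is a homomorphism because the
  boundary of [g|h] is exactly [g] + [h] - [gh], which cancels the failure of g to [g] to be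
  additive.\<close>

definition ext_del :: "('a list \<Rightarrow>\<^sub>0 int) set \<times> 'a \<Rightarrow> ('a list \<Rightarrow>\<^sub>0 int)"
  where "ext_del \<gamma> = bd2_mod (fst \<gamma>) + frag_of [snd \<gamma>]"

lemma bd2_mod_f: "a \<in> carrier G \<Longrightarrow> b \<in> carrier G \<Longrightarrow>
    bd2_mod (bar_f a b) = frag_of [b] - frag_of [a \<otimes> b] + frag_of [a]"
  by (simp add: bar_f_def bd2_mod_cls bd_frag_of_2)

lemma ext_del_hom: "ext_del \<in> hom U.ext (bar 1)"
proof (rule homI)
  fix x assume "x \<in> carrier U.ext"
  then have "bd2_mod (fst x) \<in> carrier (bar 1)" "frag_of [snd x] \<in> carrier (bar 1)"
    using hom_in_carrier[OF bd2_mod_hom] by (auto simp: U.carrier_ext simp del: bar_simps) auto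
  then show "ext_del x \<in> carrier (bar 1)" unfolding ext_del_def by (rule bar_add_closed)
next
  fix x y assume "x \<in> carrier U.ext" "y \<in> carrier U.ext"
  then obtain \<alpha> g \<beta> h where x: "x = (\<alpha>, g)" "\<alpha> \<in> carrier bar2_mod" "g \<in> carrier G"
    "y = (\<beta>, h)" "\<beta> \<in> carrier bar2_mod" "h \<in> carrier G"
    by (auto simp: U.carrier_ext)
  have "bd2_mod (\<alpha> \<otimes>\<^bsub>bar2_mod\<^esub> \<beta> \<otimes>\<^bsub>bar2_mod\<^esub> bar_f g h) = bd2_mod \<alpha> + bd2_mod \<beta> + bd2_mod (bar_f g h)"
    using x by (simp add: hom_mult[OF bd2_mod_hom])
  then show "ext_del (x \<otimes>\<^bsub>U.ext\<^esub> y) = ext_del x \<otimes>\<^bsub>bar 1\<^esub> ext_del y"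
    using x by (simp add: ext_del_def U.mult_ext bd2_mod_f)
qed

lemma ext_del_lift: "ext_del (U.ext_lift g) = frag_of [g]"
proof -
  have "group (bar 1)" using comm_group_bar comm_group.axioms by blast
  then show ?thesis
    using hom_one[OF bd2_mod_hom U.A.group_axioms] by (simp add: ext_del_def U.ext_lift_def)
qed

lemma ext_del_in:
  assumes "\<alpha> \<in> carrier bar2_mod"
  shows "ext_del (U.ext_in \<alpha>) = bd2_mod \<alpha>"
proof -
  have "bd2_mod (\<alpha> \<otimes>\<^bsub>bar2_mod\<^esub> inv\<^bsub>bar2_mod\<^esub> bar_f \<one> \<one>) + bd2_mod (bar_f \<one> \<one>) =
    bd2_mod (\<alpha> \<otimes>\<^bsub>bar2_mod\<^esub> inv\<^bsub>bar2_mod\<^esub> bar_f \<one> \<one> \<otimes>\<^bsub>bar2_mod\<^esub> bar_f \<one> \<one>)"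
    using assms by (subst hom_mult[OF bd2_mod_hom]) auto
  then show ?thesis
    using assms by (simp add: ext_del_def U.ext_in_def bd2_mod_f U.A.m_assoc)
qed

text \<open>The defects d(a) d(b) \<open>d(ab)\<inverse>\<close> commute with all d(c), hence lie in
  the centre of the subgroup they generate together with the d(c). Sending [a|b] to its defect gives
  a homomorphism on 2-chains, and associativity of d(a) d(b) d(c) makes it vanish on
  boundaries.\<close>

lemma U_universal:
  assumes Q: "group Q" and d: "\<And>g. g \<in> carrier G \<Longrightarrow> d g \<in> carrier Q"
    and central: "\<And>a b c. a \<in> carrier G \<Longrightarrow> b \<in> carrier G \<Longrightarrow> c \<in> carrier G \<Longrightarrow>
      d a \<otimes>\<^bsub>Q\<^esub> d b \<otimes>\<^bsub>Q\<^esub> inv\<^bsub>Q\<^esub> d (a \<otimes> b) \<otimes>\<^bsub>Q\<^esub> d c = d c \<otimes>\<^bsub>Q\<^esub> (d a \<otimes>\<^bsub>Q\<^esub> d b \<otimes>\<^bsub>Q\<^esub> inv\<^bsub>Q\<^esub> d (a \<otimes> b))"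
  obtains \<Omega> where "\<Omega> \<in> hom U.ext Q" "\<And>g. g \<in> carrier G \<Longrightarrow> \<Omega> (U.ext_lift g) = d g"
proof -
  interpret Q: group Q by fact
  define z where "z a b = d a \<otimes>\<^bsub>Q\<^esub> d b \<otimes>\<^bsub>Q\<^esub> inv\<^bsub>Q\<^esub> d (a \<otimes> b)" for a b
  define H where "H = generate Q (d ` carrier G)"
  \<comment> \<open>The centre of \<open>H\<close> is used, not that of \<open>Q\<close>: the
    defects are only known to commute with the \<open>d c\<close>. It supplies the abelian target
    required by the free abelian group of chains.\<close>
  define Z where "Z = {z \<in> H. \<forall>h \<in> H. z \<otimes>\<^bsub>Q\<^esub> h = h \<otimes>\<^bsub>Q\<^esub> z}"
  have dQ: "d ` carrier G \<subseteq> carrier Q" using d by blast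
  have H: "subgroup H Q" unfolding H_def by (rule Q.generate_is_subgroup[OF dQ])
  interpret H: subgroup H Q by (rule H)
  interpret Z: comm_group "Q\<lparr>carrier := Z\<rparr>" unfolding Z_def by (rule Q.subgroup_center(1)[OF H])
  interpret Zs: subgroup Z Q unfolding Z_def by (rule Q.subgroup_center(2)[OF H])
  have dH: "d g \<in> H" if "g \<in> carrier G" for g using that by (auto simp: H_def intro: generate.incl)
  have zZ: "z a b \<in> Z" if ab: "a \<in> carrier G" "b \<in> carrier G" for a b
  proof -
    have zH: "z a b \<in> H" using ab dH by (simp add: z_def)
    have "z a b \<otimes>\<^bsub>Q\<^esub> h = h \<otimes>\<^bsub>Q\<^esub> z a b" if "h \<in> H" for h
      using that unfolding H_def
    proof induction
      case one
      then show ?case using zH by simp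
    next
      case (incl h)
      then show ?case using central ab by (auto simp: z_def)
    next
      case (inv h)
      then obtain c where c: "c \<in> carrier G" "h = d c" by auto
      then have "z a b \<otimes>\<^bsub>Q\<^esub> h = h \<otimes>\<^bsub>Q\<^esub> z a b" using central ab by (auto simp: z_def)
      then show ?case
        using c d zH by (metis H.mem_carrier Q.inv_closed Q.inv_solve_left Q.inv_solve_right Q.m_assoc Q.m_closed)
    next
      case (eng h1 h2)
      then have "h1 \<in> carrier Q" "h2 \<in> carrier Q" using Q.generate_in_carrier[OF dQ] by auto
      then show ?case using eng.IH zH by (metis H.mem_carrier Q.m_assoc)
    qed
    then show ?thesis using zH by (simp add: Z_def)
  qed
  have Zcomm: "x \<otimes>\<^bsub>Q\<^esub> h = h \<otimes>\<^bsub>Q\<^esub> x" if "x \<in> Z" "h \<in> H" for x h using that by (simp add: Z_def)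
  define S where "S = {gs. length gs = 2 \<and> set gs \<subseteq> carrier G}"
  have "(\<lambda>gs. z (gs ! 0) (gs ! 1)) ` S \<subseteq> carrier (Q\<lparr>carrier := Z\<rparr>)"
    using zZ by (auto simp: S_def length_Suc_conv numeral_2_eq_2)
  then obtain \<omega> where \<omega>: "\<omega> \<in> hom (free_Abelian_group S) (Q\<lparr>carrier := Z\<rparr>)"
    "\<And>gs. gs \<in> S \<Longrightarrow> \<omega> (frag_of gs) = z (gs ! 0) (gs ! 1)"
    using Z.free_Abelian_group_universal[of "\<lambda>gs. z (gs ! 0) (gs ! 1)" S] by blast
  have \<omega>_hom: "\<omega> \<in> hom (bar 2) (Q\<lparr>carrier := Z\<rparr>)"
    using \<omega>(1) by (simp add: bar_chain_group_def S_def)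
  have \<omega>_z: "\<omega> (frag_of [a, b]) = z a b" if "a \<in> carrier G" "b \<in> carrier G" for a b
    using that \<omega>(2)[of "[a, b]"] by (simp add: S_def)
  interpret C2: comm_group "bar 2" by (rule comm_group_bar)
  interpret \<omega>: group_hom "bar 2" "Q\<lparr>carrier := Z\<rparr>" \<omega>
    using \<omega>_hom by (simp add: group_hom_def group_hom_axioms_def C2.group_axioms Z.group_axioms)
  have \<omega>_add: "\<omega> (x + y) = \<omega> x \<otimes>\<^bsub>Q\<^esub> \<omega> y" if "x \<in> carrier (bar 2)" "y \<in> carrier (bar 2)" for x y
    using \<omega>.hom_mult[OF that] by simp
  have \<omega>_Z: "\<omega> x \<in> Z" if "x \<in> carrier (bar 2)" for x
    using \<omega>.hom_closed[OF that] by simp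
  have \<omega>_diff: "\<omega> (x - y) = \<one>\<^bsub>Q\<^esub>" if xy: "x \<in> carrier (bar 2)" "y \<in> carrier (bar 2)" "\<omega> x = \<omega> y" for x y
  proof -
    have "\<omega> (x - y) \<otimes>\<^bsub>Q\<^esub> \<omega> y = \<omega> y"
      using \<omega>_add[of "x - y" y] xy by (simp add: bar_diff_closed del: bar_simps)
    then show ?thesis
      using \<omega>_Z[OF xy(2)] \<omega>_Z[OF bar_diff_closed[OF xy(1,2)]] Zs.mem_carrier by (simp add: Q.r_cancel_one)
  qed
  have "\<omega> (bd 3 c) = \<one>\<^bsub>Q\<lparr>carrier := Z\<rparr>\<^esub>" if "c \<in> carrier (bar 3)" for c
    using that
  proof (induction c rule: bar_3_induct)
    case zero
    then show ?case using \<omega>.hom_one by simp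
  next
    case (diff x y)
    then show ?case using \<omega>_diff[of "bd 3 x" "bd 3 y"] by (simp add: bd_diff bd_3_closed del: bar_simps)
  next
    case (frag a b c)
    let ?x = "frag_of [b, c] + frag_of [a, b \<otimes> c]" and ?y = "frag_of [a, b] + frag_of [a \<otimes> b, c]"
    have fr: "frag_of [a, b] \<in> carrier (bar 2)" "frag_of [a \<otimes> b, c] \<in> carrier (bar 2)"
      "frag_of [b, c] \<in> carrier (bar 2)" "frag_of [a, b \<otimes> c] \<in> carrier (bar 2)"
      using frag by auto
    \<comment> \<open>Both groupings of the triple product are shown to equal d(a) d(b) d(c)
      \<open>d(abc)\<inverse>\<close>; centrality moves z(b, c) past d(a).\<close>
    have "\<omega> ?x = z b c \<otimes>\<^bsub>Q\<^esub> (d a \<otimes>\<^bsub>Q\<^esub> (d (b \<otimes> c) \<otimes>\<^bsub>Q\<^esub> inv\<^bsub>Q\<^esub> d (a \<otimes> b \<otimes> c)))"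
      using fr frag d by (simp add: \<omega>_add \<omega>_z z_def[of a "b \<otimes> c"] m_assoc Q.m_assoc del: bar_simps)
    also have "\<dots> = d a \<otimes>\<^bsub>Q\<^esub> z b c \<otimes>\<^bsub>Q\<^esub> (d (b \<otimes> c) \<otimes>\<^bsub>Q\<^esub> inv\<^bsub>Q\<^esub> d (a \<otimes> b \<otimes> c))"
      using Zcomm[OF zZ[OF frag(2,3)] dH[OF frag(1)]] Zs.mem_carrier[OF zZ[OF frag(2,3)]] frag d
      by (simp flip: Q.m_assoc)
    also have "\<dots> = d a \<otimes>\<^bsub>Q\<^esub> d b \<otimes>\<^bsub>Q\<^esub> d c \<otimes>\<^bsub>Q\<^esub> inv\<^bsub>Q\<^esub> d (a \<otimes> b \<otimes> c)"
      using frag d by (simp add: z_def Q.m_assoc)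
    also have "\<dots> = \<omega> ?y"
      using fr frag d by (simp add: \<omega>_add \<omega>_z z_def Q.m_assoc del: bar_simps)
    finally have "\<omega> (?x - ?y) = \<one>\<^bsub>Q\<^esub>"
      using fr by (intro \<omega>_diff) (auto simp: bar_add_closed simp del: bar_simps)
    moreover have "?x - ?y = bd 3 (frag_of [a, b, c])" by (simp add: bd_frag_of_3)
    ultimately show ?case by simp
  qed
  from bar2_mod_factor[OF Z.group_axioms \<omega>_hom this] obtain \<omega>' where
    \<omega>': "\<omega>' \<in> hom bar2_mod (Q\<lparr>carrier := Z\<rparr>)" "\<And>c. c \<in> carrier (bar 2) \<Longrightarrow> \<omega>' (bar2_cls c) = \<omega> c" by blast
  have \<omega>'_Z: "\<omega>' \<alpha> \<in> Z" if "\<alpha> \<in> carrier bar2_mod" for \<alpha>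
    using hom_in_carrier[OF \<omega>'(1) that] by simp
  have \<omega>'_Q: "\<omega>' \<alpha> \<in> carrier Q" if "\<alpha> \<in> carrier bar2_mod" for \<alpha>
    using \<omega>'_Z[OF that] Zs.mem_carrier by blast
  have \<omega>'_mult: "\<omega>' (\<alpha> \<otimes>\<^bsub>bar2_mod\<^esub> \<beta>) = \<omega>' \<alpha> \<otimes>\<^bsub>Q\<^esub> \<omega>' \<beta>"
    if "\<alpha> \<in> carrier bar2_mod" "\<beta> \<in> carrier bar2_mod" for \<alpha> \<beta>
    using hom_mult[OF \<omega>'(1) that] by simp
  have \<omega>'_f: "\<omega>' (bar_f a b) = z a b" if "a \<in> carrier G" "b \<in> carrier G" for a b
    using that \<omega>'(2)[of "frag_of [a, b]"] \<omega>_z by (simp add: bar_f_def)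
  define \<Omega> where "\<Omega> \<gamma> = \<omega>' (fst \<gamma>) \<otimes>\<^bsub>Q\<^esub> d (snd \<gamma>)" for \<gamma>
  show thesis
  proof
    show "\<Omega> \<in> hom U.ext Q"
    proof (rule homI)
      fix x assume "x \<in> carrier U.ext"
      then show "\<Omega> x \<in> carrier Q" using \<omega>'_Q d by (auto simp: \<Omega>_def U.carrier_ext)
    next
      fix x y assume "x \<in> carrier U.ext" "y \<in> carrier U.ext"
      then obtain \<alpha> g \<beta> h where x: "x = (\<alpha>, g)" "\<alpha> \<in> carrier bar2_mod" "g \<in> carrier G"
        "y = (\<beta>, h)" "\<beta> \<in> carrier bar2_mod" "h \<in> carrier G"
        by (auto simp: U.carrier_ext)
      have "\<Omega> (x \<otimes>\<^bsub>U.ext\<^esub> y) = \<omega>' \<alpha> \<otimes>\<^bsub>Q\<^esub> \<omega>' \<beta> \<otimes>\<^bsub>Q\<^esub> (z g h \<otimes>\<^bsub>Q\<^esub> d (g \<otimes> h))"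
        using x \<omega>'_Q d zZ Zs.mem_carrier by (simp add: \<Omega>_def U.mult_ext \<omega>'_mult \<omega>'_f Q.m_assoc)
      also have "z g h \<otimes>\<^bsub>Q\<^esub> d (g \<otimes> h) = d g \<otimes>\<^bsub>Q\<^esub> d h"
        using x d by (simp add: z_def Q.m_assoc)
      also have "\<omega>' \<alpha> \<otimes>\<^bsub>Q\<^esub> \<omega>' \<beta> \<otimes>\<^bsub>Q\<^esub> (d g \<otimes>\<^bsub>Q\<^esub> d h) = \<omega>' \<alpha> \<otimes>\<^bsub>Q\<^esub> (\<omega>' \<beta> \<otimes>\<^bsub>Q\<^esub> d g) \<otimes>\<^bsub>Q\<^esub> d h"
        using x \<omega>'_Q d by (simp add: Q.m_assoc)
      also have "\<omega>' \<beta> \<otimes>\<^bsub>Q\<^esub> d g = d g \<otimes>\<^bsub>Q\<^esub> \<omega>' \<beta>"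
        using x \<omega>'_Z dH by (intro Zcomm)
      also have "\<omega>' \<alpha> \<otimes>\<^bsub>Q\<^esub> (d g \<otimes>\<^bsub>Q\<^esub> \<omega>' \<beta>) \<otimes>\<^bsub>Q\<^esub> d h = \<Omega> x \<otimes>\<^bsub>Q\<^esub> \<Omega> y"
        using x \<omega>'_Q d by (simp add: \<Omega>_def Q.m_assoc)
      finally show "\<Omega> (x \<otimes>\<^bsub>U.ext\<^esub> y) = \<Omega> x \<otimes>\<^bsub>Q\<^esub> \<Omega> y" .
    qed
    show "\<Omega> (U.ext_lift g) = d g" if "g \<in> carrier G" for g
      using that d hom_one[OF \<omega>'(1) U.A.group_axioms Z.group_axioms]
      by (simp add: \<Omega>_def U.ext_lift_def)
  qed
qed

end

section \<open>The subgroup generated by the monomial symbols\<close>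

context group
begin

lemma wreath_interp: "symbol_system G (wreath_product G n) n (wsym G n)"
  by (rule symbol_system_wsym) (rule group_axioms)

definition wsym_group :: "nat \<Rightarrow> ((nat \<Rightarrow> 'a) \<times> (nat \<Rightarrow> nat)) set"
  where "wsym_group n = generate (wreath_product G n) (wsym G n ` symbols G n)"

text \<open>The generating set is stable under conjugation by monomial matrices, through
  \<open>wact\<close>.\<close>

lemma normal_wsym_group: "wsym_group n \<lhd> wreath_product G n"
proof -
  interpret W: symbol_system G "wreath_product G n" n "wsym G n" by (rule wreath_interp)
  show ?thesis
    unfolding wsym_group_def
  proof (rule W.H.normal_generateI)
    show "wsym G n ` symbols G n \<subseteq> carrier (wreath_product G n)" by auto
    fix h w assume "h \<in> wsym G n ` symbols G n" and w: "w \<in> carrier (wreath_product G n)"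
    then obtain x where x: "x \<in> symbols G n" "h = wsym G n x" by blast
    have "w \<otimes>\<^bsub>wreath_product G n\<^esub> h \<otimes>\<^bsub>wreath_product G n\<^esub> inv\<^bsub>wreath_product G n\<^esub> w = wsym G n (wact G w x)"
      using x w wsym_conj[OF w x(1)] by (simp add: W.H.m_assoc wact_closed)
    then show "w \<otimes>\<^bsub>wreath_product G n\<^esub> h \<otimes>\<^bsub>wreath_product G n\<^esub> inv\<^bsub>wreath_product G n\<^esub> w \<in> wsym G n ` symbols G n"
      using wact_closed[OF w x(1)] by blast
  qed
qed

lemma wsym_in_group: "x \<in> symbols G n \<Longrightarrow> wsym G n x \<in> wsym_group n"
  unfolding wsym_group_def by (auto intro: generate.incl)

lemma wdiag_wdiag_in_group:
  assumes "i \<in> {1..n}" "j \<in> {1..n}" "i \<noteq> j" "a \<in> carrier G"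
  shows "wdiag G n i a \<otimes>\<^bsub>wreath_product G n\<^esub> wdiag G n j (inv a) \<in> wsym_group n"
proof -
  interpret T: normal "wsym_group n" "wreath_product G n" by (rule normal_wsym_group)
  have "wsym G n (i, j, a) \<in> wsym_group n" "wsym G n (i, j, \<one>) \<in> wsym_group n"
    using assms by (auto intro!: wsym_in_group)
  then show ?thesis by (simp flip: wsym_wsym[OF assms])
qed

text \<open>A diagonal entry g at i equals the matrix with g at i and \<open>g\<inverse>\<close> at
  1, which is a product of symbols, times an entry g at 1. Permutation matrices are products of
  trivially labelled symbols, so everything collects at position 1.\<close>

lemma wreath_reduce:
  assumes n: "1 \<le> n" and w: "w \<in> carrier (wreath_product G n)"
  obtains t a where "t \<in> wsym_group n" "a \<in> carrier G" "w = t \<otimes>\<^bsub>wreath_product G n\<^esub> wdiag G n 1 a"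
proof -
  let ?W = "wreath_product G n"
  interpret W: symbol_system G ?W n "wsym G n" by (rule wreath_interp)
  interpret T: normal "wsym_group n" ?W by (rule normal_wsym_group)
  define U where "U = {t \<otimes>\<^bsub>?W\<^esub> wdiag G n 1 a | t a. t \<in> wsym_group n \<and> a \<in> carrier G}"
  have U_carrier: "u \<in> carrier ?W" if "u \<in> U" for u using that by (auto simp: U_def)
  have T_U: "t \<otimes>\<^bsub>?W\<^esub> u \<in> U" if t: "t \<in> wsym_group n" and u: "u \<in> U" for t u
  proof -
    obtain t' a where u': "u = t' \<otimes>\<^bsub>?W\<^esub> wdiag G n 1 a" "t' \<in> wsym_group n" "a \<in> carrier G"
      using u by (auto simp: U_def)
    then have "t \<otimes>\<^bsub>?W\<^esub> u = (t \<otimes>\<^bsub>?W\<^esub> t') \<otimes>\<^bsub>?W\<^esub> wdiag G n 1 a" using t by (simp add: W.H.m_assoc)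
    then show ?thesis using u' t T.m_closed unfolding U_def by blast
  qed
  have d1_U: "wdiag G n 1 g \<otimes>\<^bsub>?W\<^esub> u \<in> U" if g: "g \<in> carrier G" and u: "u \<in> U" for g u
  proof -
    obtain t a where u': "u = t \<otimes>\<^bsub>?W\<^esub> wdiag G n 1 a" "t \<in> wsym_group n" "a \<in> carrier G"
      using u by (auto simp: U_def)
    let ?t = "wdiag G n 1 g \<otimes>\<^bsub>?W\<^esub> t \<otimes>\<^bsub>?W\<^esub> inv\<^bsub>?W\<^esub> wdiag G n 1 g"
    have "?t \<in> wsym_group n" using u' g by (intro T.inv_op_closed2) auto
    moreover have "wdiag G n 1 g \<otimes>\<^bsub>?W\<^esub> u = ?t \<otimes>\<^bsub>?W\<^esub> wdiag G n 1 (g \<otimes> a)"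
      using u' g by (simp add: W.H.m_assoc flip: wdiag_mult)
    moreover have "g \<otimes> a \<in> carrier G" using u' g by simp
    ultimately show ?thesis unfolding U_def by blast
  qed
  have d_U: "wdiag G n i g \<otimes>\<^bsub>?W\<^esub> u \<in> U" if i: "i \<in> {1..n}" and g: "g \<in> carrier G" and u: "u \<in> U" for i g u
  proof (cases "i = 1")
    case True
    then show ?thesis using d1_U g u by simp
  next
    case False
    have "wdiag G n i g \<otimes>\<^bsub>?W\<^esub> wdiag G n 1 (inv g) \<otimes>\<^bsub>?W\<^esub> (wdiag G n 1 g \<otimes>\<^bsub>?W\<^esub> u) \<in> U"
      using i g u n False by (intro T_U d1_U wdiag_wdiag_in_group) auto
    moreover have "wdiag G n i g \<otimes>\<^bsub>?W\<^esub> wdiag G n 1 (inv g) \<otimes>\<^bsub>?W\<^esub> (wdiag G n 1 g \<otimes>\<^bsub>?W\<^esub> u) = wdiag G n i g \<otimes>\<^bsub>?W\<^esub> u"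
      using g U_carrier[OF u] by (simp add: W.H.m_assoc flip: inv_wdiag)
    ultimately show ?thesis by simp
  qed
  obtain g \<sigma> where w': "w = (g, \<sigma>)" "g \<in> {1..n} \<rightarrow>\<^sub>E carrier G" "\<sigma> permutes {1..n}"
    "\<And>i. i \<in> {1..n} \<Longrightarrow> g i \<in> carrier G"
    using wreath_cases[OF w] by metis
  define e where "e = (\<lambda>i\<in>{1..n}. \<one>)"
  have perm: "(e, \<sigma>) \<in> wsym_group n"
    using w'(3) finite_atLeastAtMost
  proof (induction rule: permutes_induct)
    case id
    show ?case using T.one_closed unfolding one_wreath e_def .
  next
    case (swap a b p)
    have "wsym G n (a, b, \<one>) \<in> wsym_group n" using swap by (intro wsym_in_group) auto
    then have "wsym G n (a, b, \<one>) \<otimes>\<^bsub>?W\<^esub> (e, p) \<in> wsym_group n" using swap by simp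
    moreover have "wsym G n (a, b, \<one>) \<otimes>\<^bsub>?W\<^esub> (e, p) = (e, transpose a b \<circ> p)"
      using swap by (auto simp: e_def wsym_def mult_wreath fun_eq_iff transpose_def)
    ultimately show ?case by (simp only:)
  qed
  \<comment> \<open>The diagonal matrix with the entries of \<open>w\<close> up to position
    \<open>m\<close> and 1 afterwards; \<open>cut n\<close> times the permutation matrix of
    \<open>w\<close> is \<open>w\<close> itself.\<close>
  define cut where "cut m = ((\<lambda>i\<in>{1..n}. if i \<le> m then g i else \<one>), id :: nat \<Rightarrow> nat)" for m
  have cut_carrier: "cut m \<in> carrier ?W" for m
    using w'(4) by (auto simp: cut_def carrier_wreath permutes_id)
  have "cut m \<otimes>\<^bsub>?W\<^esub> u \<in> U" if "m \<le> n" "u \<in> U" for m u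
    using that
  proof (induction m)
    case 0
    have "cut 0 = \<one>\<^bsub>?W\<^esub>" by (auto simp: cut_def one_wreath fun_eq_iff)
    then show ?case using 0 U_carrier by simp
  next
    case (Suc m)
    have "cut (Suc m) = wdiag G n (Suc m) (g (Suc m)) \<otimes>\<^bsub>?W\<^esub> cut m"
      using Suc.prems w'(4) by (auto simp: cut_def wdiag_def mult_wreath fun_eq_iff le_Suc_eq)
    then have "cut (Suc m) \<otimes>\<^bsub>?W\<^esub> u = wdiag G n (Suc m) (g (Suc m)) \<otimes>\<^bsub>?W\<^esub> (cut m \<otimes>\<^bsub>?W\<^esub> u)"
      using Suc.prems w'(4) U_carrier cut_carrier by (simp add: W.H.m_assoc)
    then show ?case using Suc w'(4) d_U by auto
  qed
  moreover have "(e, \<sigma>) \<in> U"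
  proof -
    have "(e, \<sigma>) \<otimes>\<^bsub>?W\<^esub> wdiag G n 1 \<one> \<in> U" using perm by (auto simp: U_def)
    moreover have "(e, \<sigma>) \<otimes>\<^bsub>?W\<^esub> wdiag G n 1 \<one> = (e, \<sigma>)"
      using T.mem_carrier[OF perm] by (simp add: wdiag_one)
    ultimately show ?thesis by simp
  qed
  ultimately have "cut n \<otimes>\<^bsub>?W\<^esub> (e, \<sigma>) \<in> U" by blast
  moreover have "cut n \<otimes>\<^bsub>?W\<^esub> (e, \<sigma>) = w"
    using w' by (auto simp: e_def cut_def mult_wreath PiE_iff extensional_def fun_eq_iff)
  ultimately have "w \<in> U" by simp
  then show thesis using that by (auto simp: U_def)
qed

text \<open>Modulo the symbols, \<open>wdiag i a\<close> does not depend on \<open>i\<close>, hence the quotient is abelian.\<close>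

lemma wdiag_quotient:
  assumes n: "2 \<le> n"
  defines "\<kappa> \<equiv> \<lambda>a. wsym_group n #>\<^bsub>wreath_product G n\<^esub> wdiag G n 1 a"
  shows "\<kappa> \<in> hom G (wreath_product G n Mod wsym_group n)"
    and "a \<in> carrier G \<Longrightarrow> b \<in> carrier G \<Longrightarrow> \<kappa> a \<otimes>\<^bsub>wreath_product G n Mod wsym_group n\<^esub> \<kappa> b =
      \<kappa> b \<otimes>\<^bsub>wreath_product G n Mod wsym_group n\<^esub> \<kappa> a"
    and "a \<in> carrier G \<Longrightarrow> \<kappa> a = \<one>\<^bsub>wreath_product G n Mod wsym_group n\<^esub> \<Longrightarrow> wdiag G n 1 a \<in> wsym_group n"
proof -
  let ?W = "wreath_product G n" and ?T = "wsym_group n"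
  interpret W: symbol_system G ?W n "wsym G n" by (rule wreath_interp)
  interpret T: normal ?T ?W by (rule normal_wsym_group)
  show "\<kappa> \<in> hom G (?W Mod ?T)"
  proof (rule homI)
    fix a b assume "a \<in> carrier G" "b \<in> carrier G"
    then show "\<kappa> (a \<otimes> b) = \<kappa> a \<otimes>\<^bsub>?W Mod ?T\<^esub> \<kappa> b"
      by (simp add: \<kappa>_def T.rcos_sum wdiag_mult)
  qed (auto simp: \<kappa>_def carrier_FactGroup)
  have \<kappa>2: "\<kappa> a = ?T #>\<^bsub>?W\<^esub> wdiag G n 2 a" if a: "a \<in> carrier G" for a
  proof -
    have "wdiag G n 1 a \<otimes>\<^bsub>?W\<^esub> wdiag G n 2 (inv a) \<in> ?T"
      using a n by (intro wdiag_wdiag_in_group) auto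
    then have "wdiag G n 1 a \<otimes>\<^bsub>?W\<^esub> inv\<^bsub>?W\<^esub> wdiag G n 2 a \<in> ?T" using a by (simp add: inv_wdiag)
    then have "wdiag G n 1 a \<in> ?T #>\<^bsub>?W\<^esub> wdiag G n 2 a"
      using a by (intro T.rcos_module_rev W.H.group_axioms) auto
    then show ?thesis
      unfolding \<kappa>_def using a by (intro W.H.repr_independence[symmetric] T.subgroup_axioms) auto
  qed
  show "\<kappa> a \<otimes>\<^bsub>?W Mod ?T\<^esub> \<kappa> b = \<kappa> b \<otimes>\<^bsub>?W Mod ?T\<^esub> \<kappa> a" if ab: "a \<in> carrier G" "b \<in> carrier G"
  proof -
    have "\<kappa> a \<otimes>\<^bsub>?W Mod ?T\<^esub> \<kappa> b = ?T #>\<^bsub>?W\<^esub> (wdiag G n 1 a \<otimes>\<^bsub>?W\<^esub> wdiag G n 2 b)"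
      using ab by (simp add: \<kappa>2[OF ab(2)]) (simp add: \<kappa>_def T.rcos_sum)
    also have "wdiag G n 1 a \<otimes>\<^bsub>?W\<^esub> wdiag G n 2 b = wdiag G n 2 b \<otimes>\<^bsub>?W\<^esub> wdiag G n 1 a"
      using ab by (intro wdiag_commute) auto
    also have "?T #>\<^bsub>?W\<^esub> (wdiag G n 2 b \<otimes>\<^bsub>?W\<^esub> wdiag G n 1 a) = \<kappa> b \<otimes>\<^bsub>?W Mod ?T\<^esub> \<kappa> a"
      using ab by (simp add: \<kappa>2[OF ab(2)]) (simp add: \<kappa>_def T.rcos_sum)
    finally show ?thesis .
  qed
  show "wdiag G n 1 a \<in> ?T" if "a \<in> carrier G" "\<kappa> a = \<one>\<^bsub>?W Mod ?T\<^esub>"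
    using that W.H.rcos_self[OF _ T.subgroup_axioms, of "wdiag G n 1 a"] by (simp add: \<kappa>_def)
qed

section \<open>A determinant with values in an abelian group\<close>

definition wdet :: "nat \<Rightarrow> ('a \<Rightarrow> 'z::ab_group_add) \<Rightarrow> (nat \<Rightarrow> 'a) \<times> (nat \<Rightarrow> nat) \<Rightarrow> 'z"
  where "wdet n \<delta> w = (\<Sum>i=1..n. \<delta> (fst w i))"

text \<open>The permutation only reorders the summands of the second factor, which is invisible in
  an abelian group. No sign is recorded, so permutation matrices have determinant 0.\<close>

lemma wdet_mult:
  assumes \<delta>: "\<And>a b. a \<in> carrier G \<Longrightarrow> b \<in> carrier G \<Longrightarrow> \<delta> (a \<otimes> b) = \<delta> a + \<delta> b"
    and "w \<in> carrier (wreath_product G n)" "w' \<in> carrier (wreath_product G n)"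
  shows "wdet n \<delta> (w \<otimes>\<^bsub>wreath_product G n\<^esub> w') = wdet n \<delta> w + wdet n \<delta> w'"
proof -
  obtain g \<sigma> where w: "w = (g, \<sigma>)" "\<sigma> permutes {1..n}" "\<And>i. i \<in> {1..n} \<Longrightarrow> g i \<in> carrier G"
    using wreath_cases[OF assms(2)] by metis
  obtain h \<tau> where w': "w' = (h, \<tau>)" "\<And>i. i \<in> {1..n} \<Longrightarrow> h i \<in> carrier G"
    using wreath_cases[OF assms(3)] by metis
  have inv: "inv_into UNIV \<sigma> i \<in> {1..n}" if "i \<in> {1..n}" for i
    using that w(2) by (simp only: permutes_inv_in)
  have "wdet n \<delta> (w \<otimes>\<^bsub>wreath_product G n\<^esub> w') = (\<Sum>i=1..n. \<delta> (g i) + \<delta> (h (inv_into UNIV \<sigma> i)))"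
    unfolding wdet_def w w' mult_wreath fst_conv
    by (rule sum.cong[OF HOL.refl]) (use w(3) w'(2) inv in \<open>simp add: \<delta> del: atLeastAtMost_iff\<close>)
  also have "\<dots> = (\<Sum>i=1..n. \<delta> (g i)) + (\<Sum>i=1..n. \<delta> (h (inv_into UNIV \<sigma> i)))"
    by (rule sum.distrib)
  also have "(\<Sum>i=1..n. \<delta> (h (inv_into UNIV \<sigma> i))) = (\<Sum>i=1..n. \<delta> (h i))"
    using sum.reindex_bij_betw[OF permutes_imp_bij[OF permutes_inv[OF w(2)]], of "\<lambda>i. \<delta> (h i)"] .
  finally show ?thesis by (simp add: wdet_def w w')
qed

text \<open>The entries \<open>a\<close> and \<open>a\<inverse>\<close> of a symbol cancel, and the
  other entries contribute the value at 1, which is 0.\<close>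

lemma wdet_wsym_group:
  fixes \<delta> :: "'a \<Rightarrow> 'z::ab_group_add"
  assumes \<delta>: "\<And>a b. a \<in> carrier G \<Longrightarrow> b \<in> carrier G \<Longrightarrow> \<delta> (a \<otimes> b) = \<delta> a + \<delta> b"
    and w: "w \<in> wsym_group n"
  shows "wdet n \<delta> w = 0"
proof -
  interpret W: symbol_system G "wreath_product G n" n "wsym G n" by (rule wreath_interp)
  have \<delta>1: "\<delta> \<one> = 0" using \<delta>[of \<one> \<one>] by simp
  have \<delta>_inv: "\<delta> (inv a) = - \<delta> a" if "a \<in> carrier G" for a
    using \<delta>[of "inv a" a] that \<delta>1 by (simp add: eq_neg_iff_add_eq_0)
  have sym: "wdet n \<delta> (wsym G n x) = 0" if x: "x \<in> symbols G n" for x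
  proof -
    obtain i j a where x': "x = (i, j, a)" by (cases x)
    have "wdet n \<delta> (wsym G n x) = (\<Sum>k=1..n. (if k = i then \<delta> a else 0) + (if k = j then - \<delta> a else 0))"
      unfolding wdet_def by (rule sum.cong) (use x x' in \<open>auto simp: wsym_def \<delta>1 \<delta>_inv\<close>)
    then show ?thesis using x x' by (simp add: sum.distrib)
  qed
  from w show ?thesis
    unfolding wsym_group_def
  proof induction
    case one
    then show ?case by (simp add: wdet_def one_wreath \<delta>1)
  next
    case (incl h)
    then show ?case using sym by blast
  next
    case (inv h)
    then show ?case using sym W.inv_sym by auto
  next
    case (eng h1 h2)
    have "wsym G n ` symbols G n \<subseteq> carrier (wreath_product G n)" by auto
    then have "h1 \<in> carrier (wreath_product G n)" "h2 \<in> carrier (wreath_product G n)"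
      using eng.hyps W.H.generate_in_carrier by blast+
    then show ?case using eng.IH wdet_mult[OF \<delta>] by simp
  qed
qed

lemma wdet_wdiag:
  fixes \<delta> :: "'a \<Rightarrow> 'z::ab_group_add"
  assumes "\<delta> \<one> = 0" "i \<in> {1..n}"
  shows "wdet n \<delta> (wdiag G n i a) = \<delta> a"
proof -
  have "wdet n \<delta> (wdiag G n i a) = (\<Sum>k=1..n. if k = i then \<delta> a else 0)"
    unfolding wdet_def by (rule sum.cong) (use assms in \<open>auto simp: wdiag_def\<close>)
  then show ?thesis using assms by simp
qed

end

section \<open>The lift of \<open>\<mu>\<close> to the universal extension\<close>

sublocale Sn_setting \<subseteq> bar_group ..

context Sn_setting
begin

abbreviation EG where "EG \<equiv> U.ext"
abbreviation WE where "WE \<equiv> wreath_product EG n"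

sublocale E: group EG by (rule U.group_ext)

sublocale WE: symbol_system EG WE n "wsym EG n"
  by (rule E.wreath_interp)

sublocale sndE: group_hom EG G snd
  using U.snd_hom by (simp add: group_hom_def group_hom_axioms_def E.group_axioms group_axioms)

lemma ext_del_mult: "x \<in> carrier EG \<Longrightarrow> y \<in> carrier EG \<Longrightarrow> ext_del (x \<otimes>\<^bsub>EG\<^esub> y) = ext_del x + ext_del y"
  using hom_mult[OF ext_del_hom] by simp

lemma ext_del_one: "ext_del \<one>\<^bsub>EG\<^esub> = 0"
  using ext_del_mult[of "\<one>\<^bsub>EG\<^esub>" "\<one>\<^bsub>EG\<^esub>"] by simp

abbreviation "det_E \<equiv> E.wdet n ext_del"

text \<open>Modulo symbols, w is an entry \<open>\<gamma>\<close> at position 1 with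
  \<open>ext_del \<gamma> = 0\<close>. The map from the extension to the quotient by the symbols has
  abelian image, so it factors through \<open>ext_del\<close>, and \<open>\<gamma>\<close> becomes
  trivial there.\<close>

lemma kernel_det_E:
  assumes w: "w \<in> carrier WE" and det: "det_E w = 0"
  shows "w \<in> E.wsym_group n"
proof -
  interpret T: normal "E.wsym_group n" WE by (rule E.normal_wsym_group)
  have n: "1 \<le> n" "2 \<le> n" using three_le by auto
  obtain t \<gamma> where t: "t \<in> E.wsym_group n" and \<gamma>: "\<gamma> \<in> carrier EG" and wt: "w = t \<otimes>\<^bsub>WE\<^esub> wdiag EG n 1 \<gamma>"
    using E.wreath_reduce[OF n(1) w] by blast
  have "det_E w = det_E t + det_E (wdiag EG n 1 \<gamma>)"
    unfolding wt using t \<gamma> by (intro E.wdet_mult ext_del_mult) auto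
  moreover have "det_E t = 0" using ext_del_mult t by (rule E.wdet_wsym_group)
  moreover have "det_E (wdiag EG n 1 \<gamma>) = ext_del \<gamma>"
    using n by (intro E.wdet_wdiag) (auto simp: ext_del_one)
  ultimately have del: "ext_del \<gamma> = 0" using det by simp
  define \<kappa> where "\<kappa> \<equiv> \<lambda>a. E.wsym_group n #>\<^bsub>WE\<^esub> wdiag EG n 1 a"
  let ?D = "WE Mod E.wsym_group n"
  have \<kappa>: "\<kappa> \<in> hom EG ?D" "\<And>a b. a \<in> carrier EG \<Longrightarrow> b \<in> carrier EG \<Longrightarrow> \<kappa> a \<otimes>\<^bsub>?D\<^esub> \<kappa> b = \<kappa> b \<otimes>\<^bsub>?D\<^esub> \<kappa> a"
    "\<And>a. a \<in> carrier EG \<Longrightarrow> \<kappa> a = \<one>\<^bsub>?D\<^esub> \<Longrightarrow> wdiag EG n 1 a \<in> E.wsym_group n"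
    using E.wdiag_quotient[OF n(2)] unfolding \<kappa>_def by blast+
  interpret D: group ?D by (rule T.factorgroup_is_group)
  interpret \<kappa>: group_hom EG ?D \<kappa>
    using \<kappa>(1) by (simp add: group_hom_def group_hom_axioms_def E.group_axioms D.group_axioms)
  let ?K = "?D\<lparr>carrier := \<kappa> ` carrier EG\<rparr>"
  have sub: "subgroup (\<kappa> ` carrier EG) ?D" by (rule \<kappa>.img_is_subgroup)
  interpret K: comm_group ?K
    by (rule group.group_comm_groupI[OF D.subgroup_imp_group[OF sub]]) (use \<kappa>(2) in auto)
  define S1 where "S1 = {gs. length gs = 1 \<and> set gs \<subseteq> carrier G}"
  have "(\<lambda>gs. \<kappa> (U.ext_lift (gs ! 0))) ` S1 \<subseteq> carrier ?K"
    by (auto simp: S1_def length_Suc_conv)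
  \<comment> \<open>\<open>C\<^sub>1\<close> is free abelian on the symbols [g] and
    \<open>ext_del\<close> sends the lift of g to [g], so \<psi> is forced on generators; the
    agreement of \<open>\<kappa>\<close> with the composite then only has to be checked on
    lifts.\<close>
  then obtain \<psi> where \<psi>: "\<psi> \<in> hom (free_Abelian_group S1) ?K"
    "\<And>gs. gs \<in> S1 \<Longrightarrow> \<psi> (frag_of gs) = \<kappa> (U.ext_lift (gs ! 0))"
    using K.free_Abelian_group_universal[of "\<lambda>gs. \<kappa> (U.ext_lift (gs ! 0))" S1] by blast
  have bar1: "bar 1 = free_Abelian_group S1" by (simp add: bar_chain_group_def S1_def)
  have \<psi>_hom: "\<psi> \<in> hom (bar 1) ?D"
  proof (rule homI)
    fix x assume "x \<in> carrier (bar 1)"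
    then have "\<psi> x \<in> carrier ?K" using hom_in_carrier[OF \<psi>(1)] unfolding bar1 by blast
    then show "\<psi> x \<in> carrier ?D" using subgroup.subset[OF sub] by auto
  next
    fix x y assume "x \<in> carrier (bar 1)" "y \<in> carrier (bar 1)"
    then show "\<psi> (x \<otimes>\<^bsub>bar 1\<^esub> y) = \<psi> x \<otimes>\<^bsub>?D\<^esub> \<psi> y"
      using hom_mult[OF \<psi>(1)] unfolding bar1 by simp
  qed
  have comp_hom: "(\<lambda>\<gamma>. \<psi> (ext_del \<gamma>)) \<in> hom EG ?D"
    using Group.hom_compose[OF ext_del_hom \<psi>_hom] by (simp add: comp_def)
  have "\<kappa> \<gamma> = \<psi> (ext_del \<gamma>)"
  proof (rule hom_eq_on_generate[OF E.group_axioms D.group_axioms \<kappa>(1) comp_hom])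
    show "\<gamma> \<in> generate EG (U.ext_lift ` carrier G)" using \<gamma> by (simp only: generate_ext_lift)
    fix x assume "x \<in> U.ext_lift ` carrier G"
    then obtain g where g: "g \<in> carrier G" "x = U.ext_lift g" by blast
    then show "\<kappa> x = \<psi> (ext_del x)" using \<psi>(2)[of "[g]"] by (simp add: ext_del_lift S1_def)
  qed auto
  also have "\<dots> = \<one>\<^bsub>?D\<^esub>"
    using del hom_one[OF \<psi>_hom comm_group.axioms(2)[OF comm_group_bar] D.group_axioms] by simp
  finally have "wdiag EG n 1 \<gamma> \<in> E.wsym_group n" using \<kappa>(3) \<gamma> by blast
  then show ?thesis using t wt by simp
qed

section \<open>Projection to matrices over G and the quotient by \<open>A0\<close>\<close>

definition wproj :: "(nat \<Rightarrow> ('a list \<Rightarrow>\<^sub>0 int) set \<times> 'a) \<times> (nat \<Rightarrow> nat) \<Rightarrow> (nat \<Rightarrow> 'a) \<times> (nat \<Rightarrow> nat)"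
  where "wproj w = (\<lambda>i\<in>{1..n}. snd (fst w i), snd w)"

lemma wproj_closed: "w \<in> carrier WE \<Longrightarrow> wproj w \<in> carrier WG"
proof -
  assume "w \<in> carrier WE"
  then obtain g \<sigma> where w: "w = (g, \<sigma>)" "\<sigma> permutes {1..n}" "\<And>i. i \<in> {1..n} \<Longrightarrow> g i \<in> carrier EG"
    using E.wreath_cases by metis
  then show ?thesis by (auto simp: wproj_def carrier_wreath simp del: atLeastAtMost_iff)
qed

lemma wproj_hom: "wproj \<in> hom WE WG"
proof (rule homI)
  fix w w' assume "w \<in> carrier WE" "w' \<in> carrier WE"
  then obtain g \<sigma> h \<tau> where w: "w = (g, \<sigma>)" "\<sigma> permutes {1..n}" "\<And>i. i \<in> {1..n} \<Longrightarrow> g i \<in> carrier EG"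
    and w': "w' = (h, \<tau>)" "\<And>i. i \<in> {1..n} \<Longrightarrow> h i \<in> carrier EG"
    using E.wreath_cases by metis
  have inv: "inv_into UNIV \<sigma> i \<in> {1..n}" if "i \<in> {1..n}" for i
    using that w(2) by (simp only: permutes_inv_in)
  show "wproj (w \<otimes>\<^bsub>WE\<^esub> w') = wproj w \<otimes>\<^bsub>WG\<^esub> wproj w'"
    using w(3) w'(2) inv by (auto simp: wproj_def w(1) w'(1) mult_wreath fun_eq_iff simp del: atLeastAtMost_iff)
qed (rule wproj_closed)

definition px :: "nat \<times> nat \<times> ('a list \<Rightarrow>\<^sub>0 int) set \<times> 'a \<Rightarrow> nat \<times> nat \<times> 'a"
  where "px = (\<lambda>(i, j, \<gamma>). (i, j, snd \<gamma>))"

definition lx :: "nat \<times> nat \<times> 'a \<Rightarrow> nat \<times> nat \<times> ('a list \<Rightarrow>\<^sub>0 int) set \<times> 'a"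
  where "lx = (\<lambda>(i, j, a). (i, j, U.ext_lift a))"

lemma px_lx [simp]: "px (lx x) = x"
  by (cases x) (simp add: px_def lx_def U.ext_lift_def)

lemma lx_symbols [simp]: "x \<in> symbols G n \<Longrightarrow> lx x \<in> symbols EG n"
  by (cases x) (simp add: lx_def)

lemma px_symbols [simp]: "x \<in> symbols EG n \<Longrightarrow> px x \<in> symbols G n"
  by (cases x) (auto simp: px_def U.carrier_ext)

lemma wproj_wsym: "x \<in> symbols EG n \<Longrightarrow> wproj (wsym EG n x) = wsym G n (px x)"
  by (cases x) (auto simp: wproj_def wsym_def px_def fun_eq_iff simp del: split_paired_All)

lemma px_wact:
  assumes "w \<in> carrier WE" "x \<in> symbols EG n"
  shows "px (wact EG w x) = wact G (wproj w) (px x)"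
proof -
  obtain i j a where x: "x = (i, j, a)" "i \<in> {1..n}" "j \<in> {1..n}" "i \<noteq> j" "a \<in> carrier EG"
    using assms(2) by (cases x) auto
  obtain g \<sigma> where w: "w = (g, \<sigma>)"
    "\<And>i. i \<in> {1..n} \<Longrightarrow> g i \<in> carrier EG" "\<And>i. i \<in> {1..n} \<Longrightarrow> \<sigma> i \<in> {1..n}"
    using E.wreath_cases[OF assms(1)] by metis
  have "\<sigma> i \<in> {1..n}" "\<sigma> j \<in> {1..n}" "g (\<sigma> i) \<in> carrier EG" "g (\<sigma> j) \<in> carrier EG"
    using w x by blast+
  then show ?thesis
    using x(5) by (simp add: w(1) x(1) wact_eq px_def wproj_def del: atLeastAtMost_iff)
qed

abbreviation KE where "KE \<equiv> EG\<lparr>carrier := {z \<in> carrier EG. snd z = \<one>}\<rparr>"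

lemma subgroup_KE: "subgroup {z \<in> carrier EG. snd z = \<one>} EG"
  using sndE.subgroup_kernel by (simp add: kernel_def)

sublocale KE: comm_group KE
  by (rule group.group_comm_groupI[OF E.subgroup_imp_group[OF subgroup_KE]]) (auto intro: U.ext_central)

text \<open>Dividing by \<open>A0\<close> removes the ambiguity in lifting a symbol from \<open>G\<close> to the extension.\<close>

definition A0 :: "((nat \<Rightarrow> ('a list \<Rightarrow>\<^sub>0 int) set \<times> 'a) \<times> (nat \<Rightarrow> nat)) set"
  where "A0 = {w \<in> carrier WE. snd w = id \<and> (\<forall>i\<in>{1..n}. snd (fst w i) = \<one>) \<and>
    finprod KE (fst w) {1..n} = \<one>\<^bsub>EG\<^esub>}"

lemma A0_I:
  assumes "w = (\<lambda>i\<in>{1..n}. z i, id)" "\<And>i. i \<in> {1..n} \<Longrightarrow> z i \<in> carrier KE" "finprod KE z {1..n} = \<one>\<^bsub>EG\<^esub>"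
  shows "w \<in> A0"
proof -
  have "finprod KE (\<lambda>i\<in>{1..n}. z i) {1..n} = finprod KE z {1..n}"
    by (rule KE.finprod_cong') (use assms in auto)
  then show ?thesis
    using assms by (auto simp: A0_def carrier_wreath permutes_id)
qed

lemma A0_D:
  assumes "w \<in> A0"
  shows "\<exists>z. w = (\<lambda>i\<in>{1..n}. z i, id) \<and> (\<forall>i\<in>{1..n}. z i \<in> carrier KE) \<and> finprod KE z {1..n} = \<one>\<^bsub>EG\<^esub>"
proof (intro exI[of _ "fst w"] conjI ballI)
  have f: "fst w \<in> {1..n} \<rightarrow>\<^sub>E carrier EG" using assms by (auto simp: A0_def carrier_wreath)
  have "restrict (fst w) {1..n} = fst w"
    using f by (intro PiE_restrict)
  then show "w = (\<lambda>i\<in>{1..n}. fst w i, id)" using assms by (cases w) (simp add: A0_def)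
  show "\<And>i. i \<in> {1..n} \<Longrightarrow> fst w i \<in> carrier KE"
    using f assms by (auto simp: A0_def PiE_iff)
qed (use assms in \<open>simp add: A0_def\<close>)

text \<open>The entries are central in the extension, so conjugation by a monomial matrix merely
  permutes them, and their product in the commutative group \<open>KE\<close> does not
  change.\<close>

lemma normal_A0: "A0 \<lhd> WE"
proof (rule WE.H.normal_invI)
  have mult: "(\<lambda>i\<in>{1..n}. z i, id) \<otimes>\<^bsub>WE\<^esub> (\<lambda>i\<in>{1..n}. z' i, id) = (\<lambda>i\<in>{1..n}. z i \<otimes>\<^bsub>EG\<^esub> z' i, id)" for z z'
    by (auto simp: mult_wreath)
  have one: "\<one>\<^bsub>WE\<^esub> = (\<lambda>i\<in>{1..n}. \<one>\<^bsub>EG\<^esub>, id)" by (rule one_wreath)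
  show "subgroup A0 WE"
  proof
    show "A0 \<subseteq> carrier WE" by (auto simp: A0_def)
    show "\<one>\<^bsub>WE\<^esub> \<in> A0"
      unfolding one by (rule A0_I[OF HOL.refl]) (use KE.finprod_one in auto)
  next
    fix x y assume "x \<in> A0" "y \<in> A0"
    note xy = this
    obtain z where x: "x = (\<lambda>i\<in>{1..n}. z i, id)" "\<And>i. i \<in> {1..n} \<Longrightarrow> z i \<in> carrier KE"
      "finprod KE z {1..n} = \<one>\<^bsub>EG\<^esub>"
      using A0_D[OF xy(1)] by blast
    obtain z' where y: "y = (\<lambda>i\<in>{1..n}. z' i, id)" "\<And>i. i \<in> {1..n} \<Longrightarrow> z' i \<in> carrier KE"
      "finprod KE z' {1..n} = \<one>\<^bsub>EG\<^esub>"
      using A0_D[OF xy(2)] by blast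
    show "x \<otimes>\<^bsub>WE\<^esub> y \<in> A0"
      unfolding x(1) y(1) mult
    proof (rule A0_I[OF HOL.refl])
      show "z i \<otimes>\<^bsub>EG\<^esub> z' i \<in> carrier KE" if "i \<in> {1..n}" for i
        using KE.m_closed[OF x(2)[OF that] y(2)[OF that]] by simp
      have "finprod KE (\<lambda>i. z i \<otimes>\<^bsub>KE\<^esub> z' i) {1..n} = finprod KE z {1..n} \<otimes>\<^bsub>KE\<^esub> finprod KE z' {1..n}"
        by (rule KE.finprod_multf) (use x y in blast)+
      then show "finprod KE (\<lambda>i. z i \<otimes>\<^bsub>EG\<^esub> z' i) {1..n} = \<one>\<^bsub>EG\<^esub>" using x y by simp
    qed
  next
    fix x assume "x \<in> A0"
    then obtain z where x: "x = (\<lambda>i\<in>{1..n}. z i, id)" "\<And>i. i \<in> {1..n} \<Longrightarrow> z i \<in> carrier KE"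
      "finprod KE z {1..n} = \<one>\<^bsub>EG\<^esub>"
      using A0_D by blast
    define z' where "z' i = inv\<^bsub>KE\<^esub> z i" for i
    have z': "z' i \<in> carrier KE" "z' i \<otimes>\<^bsub>EG\<^esub> z i = \<one>\<^bsub>EG\<^esub>" if "i \<in> {1..n}" for i
      using KE.inv_closed[OF x(2)[OF that]] KE.l_inv[OF x(2)[OF that]] by (simp_all add: z'_def)
    have "finprod KE (\<lambda>i. z' i \<otimes>\<^bsub>KE\<^esub> z i) {1..n} = finprod KE z' {1..n} \<otimes>\<^bsub>KE\<^esub> finprod KE z {1..n}"
      by (rule KE.finprod_multf) (use x z' in blast)+
    moreover have "finprod KE (\<lambda>i. z' i \<otimes>\<^bsub>KE\<^esub> z i) {1..n} = \<one>\<^bsub>KE\<^esub>"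
      by (rule KE.finprod_one_eqI) (use z' in simp)
    moreover have "finprod KE z' {1..n} \<in> carrier KE" by (rule KE.finprod_closed) (use z' in blast)
    ultimately have "finprod KE z' {1..n} = \<one>\<^bsub>EG\<^esub>" using x(3) by simp
    then have A: "(\<lambda>i\<in>{1..n}. z' i, id) \<in> A0" using z' by (intro A0_I[OF HOL.refl]) auto
    have "(\<lambda>i\<in>{1..n}. z' i, id) \<otimes>\<^bsub>WE\<^esub> x = \<one>\<^bsub>WE\<^esub>"
      unfolding x(1) mult one using z'(2) by (auto simp: fun_eq_iff)
    then have "inv\<^bsub>WE\<^esub> x = (\<lambda>i\<in>{1..n}. z' i, id)"
      using A \<open>x \<in> A0\<close> by (intro WE.H.inv_equality) (auto simp: A0_def)
    then show "inv\<^bsub>WE\<^esub> x \<in> A0" using A by simp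
  qed
  fix w x assume "w \<in> carrier WE" "x \<in> A0"
  note w = this(1) and xA = this(2)
  obtain z where x: "x = (\<lambda>i\<in>{1..n}. z i, id)" "\<And>i. i \<in> {1..n} \<Longrightarrow> z i \<in> carrier KE"
      "finprod KE z {1..n} = \<one>\<^bsub>EG\<^esub>"
      using A0_D[OF xA] by blast
  obtain g \<sigma> where w': "w = (g, \<sigma>)" "\<sigma> permutes {1..n}" "\<And>i. i \<in> {1..n} \<Longrightarrow> g i \<in> carrier EG"
    using E.wreath_cases[OF w] by metis
  let ?z = "\<lambda>i. z (inv_into UNIV \<sigma> i)"
  have inv: "inv_into UNIV \<sigma> i \<in> {1..n}" if "i \<in> {1..n}" for i
    using that w'(2) by (simp only: permutes_inv_in)
  have "finprod KE z ((inv_into UNIV \<sigma>) ` {1..n}) = finprod KE ?z {1..n}"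
    by (rule KE.finprod_reindex)
      (use x(2) inv permutes_inj_on[OF permutes_inv[OF w'(2)]] in auto)
  then have "finprod KE ?z {1..n} = \<one>\<^bsub>EG\<^esub>"
    using x(3) permutes_image[OF permutes_inv[OF w'(2)]] by simp
  then have A: "(\<lambda>i\<in>{1..n}. ?z i, id) \<in> A0" using x(2) inv by (intro A0_I[OF HOL.refl]) blast+
  have "g i \<otimes>\<^bsub>EG\<^esub> ?z i = ?z i \<otimes>\<^bsub>EG\<^esub> g i" if "i \<in> {1..n}" for i
    using x(2)[OF inv[OF that]] w'(3)[OF that] by (intro U.ext_central[symmetric]) auto
  then have "w \<otimes>\<^bsub>WE\<^esub> x = (\<lambda>i\<in>{1..n}. ?z i, id) \<otimes>\<^bsub>WE\<^esub> w"
    unfolding w'(1) x(1) mult_wreath using inv by (auto simp: fun_eq_iff simp del: atLeastAtMost_iff)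
  moreover have "(\<lambda>i\<in>{1..n}. ?z i, id) \<in> carrier WE" using A by (simp add: A0_def)
  ultimately have "w \<otimes>\<^bsub>WE\<^esub> x \<otimes>\<^bsub>WE\<^esub> inv\<^bsub>WE\<^esub> w = (\<lambda>i\<in>{1..n}. ?z i, id)"
    using w by (simp add: WE.H.m_assoc)
  then show "w \<otimes>\<^bsub>WE\<^esub> x \<otimes>\<^bsub>WE\<^esub> inv\<^bsub>WE\<^esub> w \<in> A0" using A by simp
qed

lemma wdiag_wdiag_A0:
  assumes ij: "i \<in> {1..n}" "j \<in> {1..n}" "i \<noteq> j" and x: "x \<in> carrier EG" and y: "y \<in> carrier EG"
  shows "wdiag EG n i x \<otimes>\<^bsub>WE\<^esub> wdiag EG n j y \<in> A0 \<longleftrightarrow>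
    snd x = \<one> \<and> snd y = \<one> \<and> x \<otimes>\<^bsub>EG\<^esub> y = \<one>\<^bsub>EG\<^esub>"
proof -
  let ?f = "\<lambda>k. if k = i then x else \<one>\<^bsub>EG\<^esub>" and ?h = "\<lambda>k. if k = j then y else \<one>\<^bsub>EG\<^esub>"
  have eq: "wdiag EG n i x \<otimes>\<^bsub>WE\<^esub> wdiag EG n j y = (\<lambda>k\<in>{1..n}. ?f k \<otimes>\<^bsub>EG\<^esub> ?h k, id)"
    by (auto simp: wdiag_def mult_wreath fun_eq_iff)
  have prod: "finprod KE (\<lambda>k. ?f k \<otimes>\<^bsub>EG\<^esub> ?h k) {1..n} = x \<otimes>\<^bsub>EG\<^esub> y" if "snd x = \<one>" "snd y = \<one>"
  proof -
    have xy: "x \<in> carrier KE" "y \<in> carrier KE" using that x y by auto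
    have one_KE: "\<one>\<^bsub>KE\<^esub> = \<one>\<^bsub>EG\<^esub>" by simp
    have f: "?f \<in> {1..n} \<rightarrow> carrier KE" and h: "?h \<in> {1..n} \<rightarrow> carrier KE" using xy by auto
    have "finprod KE (\<lambda>k. ?f k \<otimes>\<^bsub>KE\<^esub> ?h k) {1..n} = finprod KE ?f {1..n} \<otimes>\<^bsub>KE\<^esub> finprod KE ?h {1..n}"
      by (rule KE.finprod_multf[OF f h])
    moreover have "finprod KE ?f {1..n} = x" "finprod KE ?h {1..n} = y"
      using KE.finprod_singleton_swap[OF ij(1), of "\<lambda>_. x"] KE.finprod_singleton_swap[OF ij(2), of "\<lambda>_. y"] xy
      unfolding one_KE by simp_all
    ultimately show ?thesis by simp
  qed
  show ?thesis
  proof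
    assume A: "wdiag EG n i x \<otimes>\<^bsub>WE\<^esub> wdiag EG n j y \<in> A0"
    then have "\<forall>k\<in>{1..n}. snd (?f k \<otimes>\<^bsub>EG\<^esub> ?h k) = \<one>"
      unfolding eq by (auto simp: A0_def)
    from bspec[OF this ij(1)] bspec[OF this ij(2)] have "snd x = \<one>" "snd y = \<one>" using ij x y by auto
    moreover have "finprod KE (\<lambda>k\<in>{1..n}. ?f k \<otimes>\<^bsub>EG\<^esub> ?h k) {1..n} = finprod KE (\<lambda>k. ?f k \<otimes>\<^bsub>EG\<^esub> ?h k) {1..n}"
      by (rule KE.finprod_cong') (use x y calculation in auto)
    ultimately show "snd x = \<one> \<and> snd y = \<one> \<and> x \<otimes>\<^bsub>EG\<^esub> y = \<one>\<^bsub>EG\<^esub>"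
      using A prod unfolding eq by (auto simp: A0_def)
  next
    assume xy: "snd x = \<one> \<and> snd y = \<one> \<and> x \<otimes>\<^bsub>EG\<^esub> y = \<one>\<^bsub>EG\<^esub>"
    show "wdiag EG n i x \<otimes>\<^bsub>WE\<^esub> wdiag EG n j y \<in> A0"
      unfolding eq by (rule A0_I[OF HOL.refl]) (use xy x y prod in auto)
  qed
qed

sublocale A0: normal A0 WE by (rule normal_A0)

abbreviation WQ where "WQ \<equiv> WE Mod A0"

definition cls :: "(nat \<Rightarrow> ('a list \<Rightarrow>\<^sub>0 int) set \<times> 'a) \<times> (nat \<Rightarrow> nat) \<Rightarrow> ((nat \<Rightarrow> ('a list \<Rightarrow>\<^sub>0 int) set \<times> 'a) \<times> (nat \<Rightarrow> nat)) set"
  where "cls w = A0 #>\<^bsub>WE\<^esub> w"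

sublocale WQ: group WQ by (rule A0.factorgroup_is_group)

sublocale cls: group_hom WE WQ cls
  using A0.r_coset_hom_Mod unfolding cls_def[abs_def]
  by (simp add: group_hom_def group_hom_axioms_def WE.H.group_axioms WQ.group_axioms)

lemma cls_eq_one_iff:
  assumes "w \<in> carrier WE"
  shows "cls w = \<one>\<^bsub>WQ\<^esub> \<longleftrightarrow> w \<in> A0"
  using WE.H.coset_join1[OF _ assms A0.subgroup_axioms] WE.H.coset_join2[OF assms A0.subgroup_axioms]
  unfolding cls_def one_FactGroup by blast

lemma (in group) wsym_mult_wsym:
  assumes "i \<in> {1..n}" "j \<in> {1..n}" "i \<noteq> j" "a \<in> carrier G" "b \<in> carrier G"
  shows "wsym G n (i, j, a) \<otimes>\<^bsub>wreath_product G n\<^esub> wsym G n (i, j, b) =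
    wdiag G n i (a \<otimes> inv b) \<otimes>\<^bsub>wreath_product G n\<^esub> wdiag G n j (inv a \<otimes> b)"
  using assms by (auto simp: wdiag_def wsym_def mult_wreath fun_eq_iff)

text \<open>Two lifts of the same symbol differ by a central element z. The product of the two
  matrices is diagonal with central, mutually inverse entries, hence lies in \<open>A0\<close>; as
  the matrices are involutions their classes agree.\<close>

lemma cls_wsym_eq:
  assumes xy: "x \<in> symbols EG n" "y \<in> symbols EG n" and px: "px x = px y"
  shows "cls (wsym EG n x) = cls (wsym EG n y)"
proof -
  obtain i j \<gamma> \<gamma>' where x: "x = (i, j, \<gamma>)" and y: "y = (i, j, \<gamma>')" and snd: "snd \<gamma> = snd \<gamma>'"
    using px by (cases x; cases y) (auto simp: px_def)
  have idx: "i \<in> {1..n}" "j \<in> {1..n}" "i \<noteq> j" and \<gamma>: "\<gamma> \<in> carrier EG" "\<gamma>' \<in> carrier EG"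
    using xy x y by auto
  let ?z = "\<gamma> \<otimes>\<^bsub>EG\<^esub> inv\<^bsub>EG\<^esub> \<gamma>'" and ?z' = "inv\<^bsub>EG\<^esub> \<gamma> \<otimes>\<^bsub>EG\<^esub> \<gamma>'"
  have sndz: "snd ?z = \<one>" "snd ?z' = \<one>"
    using \<gamma> snd sndE.hom_closed[of \<gamma>'] by simp_all
  have "?z \<otimes>\<^bsub>EG\<^esub> ?z' = ?z' \<otimes>\<^bsub>EG\<^esub> ?z" using \<gamma> sndz by (intro U.ext_central) auto
  also have "\<dots> = inv\<^bsub>EG\<^esub> \<gamma> \<otimes>\<^bsub>EG\<^esub> (\<gamma>' \<otimes>\<^bsub>EG\<^esub> ?z)" using \<gamma> by (simp add: E.m_assoc)
  also have "\<gamma>' \<otimes>\<^bsub>EG\<^esub> ?z = ?z \<otimes>\<^bsub>EG\<^esub> \<gamma>'" using \<gamma> sndz by (intro U.ext_central[symmetric]) auto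
  also have "inv\<^bsub>EG\<^esub> \<gamma> \<otimes>\<^bsub>EG\<^esub> (?z \<otimes>\<^bsub>EG\<^esub> \<gamma>') = \<one>\<^bsub>EG\<^esub>" using \<gamma> by (simp add: E.m_assoc)
  finally have "wsym EG n x \<otimes>\<^bsub>WE\<^esub> wsym EG n y \<in> A0"
    using idx \<gamma> sndz unfolding x y E.wsym_mult_wsym[OF idx \<gamma>]
    by (subst wdiag_wdiag_A0) auto
  then have "cls (wsym EG n x) \<otimes>\<^bsub>WQ\<^esub> cls (wsym EG n y) = \<one>\<^bsub>WQ\<^esub>"
    using xy cls_eq_one_iff[of "wsym EG n x \<otimes>\<^bsub>WE\<^esub> wsym EG n y"] by (simp del: Coset.mult_FactGroup one_FactGroup)
  moreover have "cls (wsym EG n y) \<otimes>\<^bsub>WQ\<^esub> cls (wsym EG n y) = \<one>\<^bsub>WQ\<^esub>"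
    using xy(2) WE.sym_square[OF xy(2)] cls.hom_mult[of "wsym EG n y" "wsym EG n y"] cls.hom_one
    by (simp del: Coset.mult_FactGroup one_FactGroup)
  ultimately show ?thesis
    using xy WQ.right_cancel[of "cls (wsym EG n y)" "cls (wsym EG n x)" "cls (wsym EG n y)"]
    by (simp del: Coset.mult_FactGroup one_FactGroup)
qed

lemma cls_wsym_lift: "x \<in> symbols EG n \<Longrightarrow> cls (wsym EG n (lx (px x))) = cls (wsym EG n x)"
  by (rule cls_wsym_eq) auto

text \<open>Lifting commutes neither with inversion nor with the action, but the discrepancy is
  central, and \<open>cls_wsym_eq\<close> shows that it disappears modulo \<open>A0\<close>.\<close>

lemma symbol_system_lift: "symbol_system G WQ n (\<lambda>x. cls (wsym EG n (lx x)))"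
proof
  fix x assume x: "x \<in> symbols G n"
  have sw: "symbol_swap G x \<in> symbols G n" "symbol_swap EG (lx x) \<in> symbols EG n"
    using x by (cases x; auto simp: symbol_swap_def lx_def)+
  have "cls (wsym EG n (lx (symbol_swap G x))) = cls (wsym EG n (symbol_swap EG (lx x)))"
  proof (rule cls_wsym_eq)
    show "px (lx (symbol_swap G x)) = px (symbol_swap EG (lx x))"
      using x by (cases x) (simp add: symbol_swap_def lx_def px_def U.ext_lift_def[of "inv _"], simp add: U.ext_lift_def)
  qed (use sw in auto)
  then show "cls (wsym EG n (lx (symbol_swap G x))) = cls (wsym EG n (lx x))"
    using x by (simp add: WE.sym_swap)
  show "cls (wsym EG n (lx x)) \<otimes>\<^bsub>WQ\<^esub> cls (wsym EG n (lx x)) = \<one>\<^bsub>WQ\<^esub>"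
    using x WE.sym_square[of "lx x"] cls.hom_mult[of "wsym EG n (lx x)" "wsym EG n (lx x)"] cls.hom_one
    by (simp del: Coset.mult_FactGroup one_FactGroup)
  fix y assume y: "y \<in> symbols G n"
  let ?z = "wact EG (wsym EG n (lx x)) (lx y)"
  have z: "?z \<in> symbols EG n" using x y by (intro E.wact_closed) auto
  have pz: "px ?z = wact G (wsym G n x) y" using x y by (simp add: px_wact wproj_wsym)
  have "cls (wsym EG n (lx x)) \<otimes>\<^bsub>WQ\<^esub> cls (wsym EG n (lx y)) = cls (wsym EG n (lx x) \<otimes>\<^bsub>WE\<^esub> wsym EG n (lx y))"
    using x y by (intro cls.hom_mult[symmetric]) auto
  also have "\<dots> = cls (wsym EG n ?z \<otimes>\<^bsub>WE\<^esub> wsym EG n (lx x))"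
    using x y by (subst WE.sym_conj) auto
  also have "\<dots> = cls (wsym EG n ?z) \<otimes>\<^bsub>WQ\<^esub> cls (wsym EG n (lx x))"
    using x z by (intro cls.hom_mult) auto
  also have "cls (wsym EG n ?z) = cls (wsym EG n (lx (wact G (wsym G n x) y)))"
    using cls_wsym_lift[OF z] by (simp add: pz)
  finally show "cls (wsym EG n (lx x)) \<otimes>\<^bsub>WQ\<^esub> cls (wsym EG n (lx y)) =
    cls (wsym EG n (lx (wact G (wsym G n x) y))) \<otimes>\<^bsub>WQ\<^esub> cls (wsym EG n (lx x))" .
qed (auto intro: cls.hom_closed)

section \<open>The lift \<open>Phi\<close> and its relation to \<open>mu\<close>\<close>

definition Phi :: "(nat \<times> 'a) word set \<Rightarrow> ((nat \<Rightarrow> ('a list \<Rightarrow>\<^sub>0 int) set \<times> 'a) \<times> (nat \<Rightarrow> nat)) set"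
  where "Phi = (SOME \<Phi>. \<Phi> \<in> hom SG WQ \<and> (\<forall>x \<in> symbols G n. \<Phi> (ssym x) = cls (wsym EG n (lx x))))"

lemma Phi_spec: "Phi \<in> hom SG WQ \<and> (\<forall>x \<in> symbols G n. Phi (ssym x) = cls (wsym EG n (lx x)))"
  unfolding Phi_def by (rule someI_ex[OF Sn_lift[OF symbol_system_lift]])

lemma Phi_hom: "Phi \<in> hom SG WQ"
  and Phi_ssym: "x \<in> symbols G n \<Longrightarrow> Phi (ssym x) = cls (wsym EG n (lx x))"
  using Phi_spec by blast+

sublocale Phi: group_hom SG WQ Phi
  using Phi_hom by (simp add: group_hom_def group_hom_axioms_def S.S.group_axioms WQ.group_axioms)

sublocale wproj: group_hom WE WG wproj
  using wproj_hom by (simp add: group_hom_def group_hom_axioms_def WE.H.group_axioms W.H.group_axioms)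

abbreviation "TE \<equiv> E.wsym_group n"

lemma TE_carrier: "w \<in> TE \<Longrightarrow> w \<in> carrier WE"
  using E.normal_wsym_group normal_imp_subgroup subgroup.mem_carrier by metis

text \<open>A product of symbols over the extension is matched, factor by factor, with the product
  of the underlying symbols in \<open>S\<^sub>n(G)\<close>. Tracking \<open>Phi\<close> and
  \<open>mu\<close> together is what later links the kernel and the image of \<open>mu\<close> to
  determinants.\<close>

lemma TE_to_SG:
  assumes "w \<in> TE"
  shows "\<exists>s \<in> carrier SG. Phi s = cls w \<and> mu s = wproj w"
  using assms unfolding E.wsym_group_def
proof induction
  case one
  have "Phi \<one>\<^bsub>SG\<^esub> = cls \<one>\<^bsub>WE\<^esub>" "mu \<one>\<^bsub>SG\<^esub> = wproj \<one>\<^bsub>WE\<^esub>"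
    by (simp_all only: Phi.hom_one cls.hom_one mu.hom_one wproj.hom_one)
  then show ?case by blast
next
  case (incl h)
  then obtain x where x: "x \<in> symbols EG n" "h = wsym EG n x" by blast
  then have "Phi (ssym (px x)) = cls h" "mu (ssym (px x)) = wproj h"
    by (simp_all add: Phi_ssym cls_wsym_lift mu_ssym wproj_wsym)
  moreover have "ssym (px x) \<in> carrier SG" using x by simp
  ultimately show ?case by blast
next
  case (inv h)
  then obtain x where x: "x \<in> symbols EG n" "h = wsym EG n x" by blast
  then have "Phi (ssym (px x)) = cls (inv\<^bsub>WE\<^esub> h)" "mu (ssym (px x)) = wproj (inv\<^bsub>WE\<^esub> h)"
    by (simp_all add: WE.inv_sym Phi_ssym cls_wsym_lift mu_ssym wproj_wsym)
  moreover have "ssym (px x) \<in> carrier SG" using x by simp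
  ultimately show ?case by blast
next
  case (eng h1 h2)
  have h: "h1 \<in> carrier WE" "h2 \<in> carrier WE"
    using eng.hyps TE_carrier by (simp_all add: E.wsym_group_def)
  obtain s1 s2 where s: "s1 \<in> carrier SG" "Phi s1 = cls h1" "mu s1 = wproj h1"
    "s2 \<in> carrier SG" "Phi s2 = cls h2" "mu s2 = wproj h2"
    using eng.IH by blast
  then have "Phi (s1 \<otimes>\<^bsub>SG\<^esub> s2) = cls (h1 \<otimes>\<^bsub>WE\<^esub> h2)" "mu (s1 \<otimes>\<^bsub>SG\<^esub> s2) = wproj (h1 \<otimes>\<^bsub>WE\<^esub> h2)"
    using h by (simp_all only: Phi.hom_mult cls.hom_mult mu.hom_mult wproj.hom_mult)
  moreover have "s1 \<otimes>\<^bsub>SG\<^esub> s2 \<in> carrier SG" using s by simp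
  ultimately show ?case by blast
qed

text \<open>The converse correspondence: every element of \<open>S\<^sub>n(G)\<close> has a
  companion matrix of determinant zero, obtained by lifting the labels of a word for it.\<close>

lemma SG_to_TE:
  assumes "s \<in> carrier SG"
  shows "\<exists>w \<in> TE. Phi s = cls w \<and> mu s = wproj w"
proof -
  interpret T: normal TE WE by (rule E.normal_wsym_group)
  have sym: "wsym EG n (lx x) \<in> TE" if "x \<in> symbols G n" for x
    using that by (intro E.wsym_in_group) simp
  have "s \<in> generate SG (ssym ` symbols G n)" using assms by (simp flip: generate_ssym)
  then show ?thesis
  proof induction
    case one
    have "Phi \<one>\<^bsub>SG\<^esub> = cls \<one>\<^bsub>WE\<^esub>" "mu \<one>\<^bsub>SG\<^esub> = wproj \<one>\<^bsub>WE\<^esub>"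
      by (simp_all only: Phi.hom_one cls.hom_one mu.hom_one wproj.hom_one)
    then show ?case using T.one_closed by blast
  next
    case (incl h)
    then obtain x where x: "x \<in> symbols G n" "h = ssym x" by blast
    then have "Phi h = cls (wsym EG n (lx x))" "mu h = wproj (wsym EG n (lx x))"
      by (simp_all add: Phi_ssym mu_ssym wproj_wsym)
    then show ?case using sym x by blast
  next
    case (inv h)
    then obtain x where x: "x \<in> symbols G n" "h = ssym x" by blast
    then have "Phi (inv\<^bsub>SG\<^esub> h) = cls (wsym EG n (lx x))" "mu (inv\<^bsub>SG\<^esub> h) = wproj (wsym EG n (lx x))"
      by (simp_all add: S.inv_sym Phi_ssym mu_ssym wproj_wsym)
    then show ?case using sym x by blast
  next
    case (eng h1 h2)
    have h: "h1 \<in> carrier SG" "h2 \<in> carrier SG" using eng.hyps by (simp_all flip: generate_ssym)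
    obtain w1 w2 where w: "w1 \<in> TE" "Phi h1 = cls w1" "mu h1 = wproj w1"
      "w2 \<in> TE" "Phi h2 = cls w2" "mu h2 = wproj w2"
      using eng.IH by blast
    then have "Phi (h1 \<otimes>\<^bsub>SG\<^esub> h2) = cls (w1 \<otimes>\<^bsub>WE\<^esub> w2)" "mu (h1 \<otimes>\<^bsub>SG\<^esub> h2) = wproj (w1 \<otimes>\<^bsub>WE\<^esub> w2)"
      using h TE_carrier by (simp_all only: Phi.hom_mult cls.hom_mult mu.hom_mult wproj.hom_mult)
    then show ?case using w by blast
  qed
qed

section \<open>Injectivity of the lift\<close>

lemma wproj_A0:
  assumes "w \<in> A0"
  shows "wproj w = \<one>\<^bsub>WG\<^esub>"
proof -
  have "snd w = id" "\<forall>i\<in>{1..n}. snd (fst w i) = \<one>" using assms unfolding A0_def by blast+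
  then show ?thesis unfolding wproj_def one_wreath by (auto simp: fun_eq_iff)
qed

primrec lift_prod :: "'a list \<Rightarrow> ('a list \<Rightarrow>\<^sub>0 int) set \<times> 'a" where
  "lift_prod [] = \<one>\<^bsub>EG\<^esub>"
| "lift_prod (a # as) = lift_prod as \<otimes>\<^bsub>EG\<^esub> U.ext_lift a"

text \<open>The inverses are multiplied in the same order as in \<open>lift_prod\<close>, so this is
  in general not the inverse of \<open>lift_prod\<close>.\<close>

primrec lift_inv_prod :: "'a list \<Rightarrow> ('a list \<Rightarrow>\<^sub>0 int) set \<times> 'a" where
  "lift_inv_prod [] = \<one>\<^bsub>EG\<^esub>"
| "lift_inv_prod (a # as) = lift_inv_prod as \<otimes>\<^bsub>EG\<^esub> inv\<^bsub>EG\<^esub> U.ext_lift a"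

lemma lift_prod_closed [simp]:
  "set as \<subseteq> carrier G \<Longrightarrow> lift_prod as \<in> carrier EG"
  "set as \<subseteq> carrier G \<Longrightarrow> lift_inv_prod as \<in> carrier EG"
  by (induction as) auto

lemma Phi_hprod:
  assumes "set as \<subseteq> carrier G"
  shows "Phi (hprod as) = cls (wdiag EG n 1 (lift_prod as) \<otimes>\<^bsub>WE\<^esub> wdiag EG n 2 (lift_inv_prod as))"
  using assms
proof (induction as)
  case Nil
  have "wdiag EG n 1 \<one>\<^bsub>EG\<^esub> \<otimes>\<^bsub>WE\<^esub> wdiag EG n 2 \<one>\<^bsub>EG\<^esub> = \<one>\<^bsub>WE\<^esub>" by (simp add: E.wdiag_one)
  then show ?case by (simp only: hprod.simps lift_prod.simps lift_inv_prod.simps Phi.hom_one cls.hom_one)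
next
  case (Cons a as)
  have idx: "(1::nat) \<in> {1..n}" "(2::nat) \<in> {1..n}" "(1::nat) \<noteq> 2" using three_le by auto
  have a: "a \<in> carrier G" and as: "set as \<subseteq> carrier G" using Cons.prems by auto
  let ?l = "U.ext_lift a" and ?p = "lift_prod as" and ?q = "lift_inv_prod as"
  have sym: "(1, 2, \<one>\<^bsub>EG\<^esub>) \<in> symbols EG n" "(1, 2, ?l) \<in> symbols EG n" using a idx by auto
  have "Phi (ssym (1, 2, \<one>)) = cls (wsym EG n (lx (1, 2, \<one>)))"
    using idx by (intro Phi_ssym) auto
  also have "\<dots> = cls (wsym EG n (1, 2, \<one>\<^bsub>EG\<^esub>))"
  proof (rule cls_wsym_eq)
    show "px (lx (1, 2, \<one>)) = px (1, 2, \<one>\<^bsub>EG\<^esub>)" unfolding px_lx by (simp add: px_def)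
  qed (use sym idx lx_symbols[of "(1, 2, \<one>)"] in auto)
  finally have 1: "Phi (ssym (1, 2, \<one>)) = cls (wsym EG n (1, 2, \<one>\<^bsub>EG\<^esub>))" .
  have "Phi (hh 1 2 a) = cls (wsym EG n (1, 2, ?l)) \<otimes>\<^bsub>WQ\<^esub> cls (wsym EG n (1, 2, \<one>\<^bsub>EG\<^esub>))"
    unfolding hh_def using a idx by (subst Phi.hom_mult) (auto simp: 1 Phi_ssym lx_def simp del: Coset.mult_FactGroup One_nat_def)
  also have "\<dots> = cls (wsym EG n (1, 2, ?l) \<otimes>\<^bsub>WE\<^esub> wsym EG n (1, 2, \<one>\<^bsub>EG\<^esub>))"
    using sym by (intro cls.hom_mult[symmetric] E.wsym_closed)
  also have "wsym EG n (1, 2, ?l) \<otimes>\<^bsub>WE\<^esub> wsym EG n (1, 2, \<one>\<^bsub>EG\<^esub>) = wdiag EG n 1 ?l \<otimes>\<^bsub>WE\<^esub> wdiag EG n 2 (inv\<^bsub>EG\<^esub> ?l)"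
    using a idx by (intro E.wsym_wsym) auto
  finally have hh: "Phi (hh 1 2 a) = cls (wdiag EG n 1 ?l \<otimes>\<^bsub>WE\<^esub> wdiag EG n 2 (inv\<^bsub>EG\<^esub> ?l))" .
  have comm: "wdiag EG n 2 ?q \<otimes>\<^bsub>WE\<^esub> wdiag EG n 1 ?l = wdiag EG n 1 ?l \<otimes>\<^bsub>WE\<^esub> wdiag EG n 2 ?q"
    using a as by (intro E.wdiag_commute) auto
  have "wdiag EG n 1 ?p \<otimes>\<^bsub>WE\<^esub> wdiag EG n 2 ?q \<otimes>\<^bsub>WE\<^esub> (wdiag EG n 1 ?l \<otimes>\<^bsub>WE\<^esub> wdiag EG n 2 (inv\<^bsub>EG\<^esub> ?l)) =
    wdiag EG n 1 ?p \<otimes>\<^bsub>WE\<^esub> (wdiag EG n 2 ?q \<otimes>\<^bsub>WE\<^esub> wdiag EG n 1 ?l) \<otimes>\<^bsub>WE\<^esub> wdiag EG n 2 (inv\<^bsub>EG\<^esub> ?l)"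
    using a as by (simp add: WE.H.m_assoc)
  also have "\<dots> = (wdiag EG n 1 ?p \<otimes>\<^bsub>WE\<^esub> wdiag EG n 1 ?l) \<otimes>\<^bsub>WE\<^esub> (wdiag EG n 2 ?q \<otimes>\<^bsub>WE\<^esub> wdiag EG n 2 (inv\<^bsub>EG\<^esub> ?l))"
    unfolding comm using a as by (simp add: WE.H.m_assoc)
  also have "\<dots> = wdiag EG n 1 (lift_prod (a # as)) \<otimes>\<^bsub>WE\<^esub> wdiag EG n 2 (lift_inv_prod (a # as))"
    using a as by (simp add: E.wdiag_mult)
  finally have prod: "wdiag EG n 1 ?p \<otimes>\<^bsub>WE\<^esub> wdiag EG n 2 ?q \<otimes>\<^bsub>WE\<^esub> (wdiag EG n 1 ?l \<otimes>\<^bsub>WE\<^esub> wdiag EG n 2 (inv\<^bsub>EG\<^esub> ?l)) =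
    wdiag EG n 1 (lift_prod (a # as)) \<otimes>\<^bsub>WE\<^esub> wdiag EG n 2 (lift_inv_prod (a # as))" .
  have "Phi (hprod (a # as)) = Phi (hprod as) \<otimes>\<^bsub>WQ\<^esub> Phi (hh 1 2 a)"
    using a as idx by (simp del: Coset.mult_FactGroup One_nat_def)
  also have "\<dots> = cls (wdiag EG n 1 ?p \<otimes>\<^bsub>WE\<^esub> wdiag EG n 2 ?q \<otimes>\<^bsub>WE\<^esub> (wdiag EG n 1 ?l \<otimes>\<^bsub>WE\<^esub> wdiag EG n 2 (inv\<^bsub>EG\<^esub> ?l)))"
    unfolding Cons.IH[OF as] hh using a as by (intro cls.hom_mult[symmetric]) auto
  finally show ?case unfolding prod .
qed

text \<open>An element of the kernel of \<open>Phi\<close> is a product of diagonal lifts, and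
  vanishing modulo \<open>A0\<close> says that its two diagonal entries over the extension are
  central and mutually inverse. In the extension group \<open>Q\<close> these two entries determine
  the element, so it is trivial.\<close>

lemma Phi_injective:
  assumes s: "s \<in> carrier SG" and Phi: "Phi s = \<one>\<^bsub>WQ\<^esub>"
  shows "s = \<one>\<^bsub>SG\<^esub>"
proof -
  have idx: "(1::nat) \<in> {1..n}" "(2::nat) \<in> {1..n}" "(1::nat) \<noteq> 2" using three_le by auto
  obtain w where w: "w \<in> TE" "Phi s = cls w" "mu s = wproj w" using SG_to_TE[OF s] by blast
  have "cls w = \<one>\<^bsub>WQ\<^esub>" using Phi w(2) by (simp only:)
  then have "w \<in> A0" using cls_eq_one_iff[OF TE_carrier[OF w(1)]] by blast
  then have "wproj w = \<one>\<^bsub>WG\<^esub>" by (rule wproj_A0)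
  then have "mu s = \<one>\<^bsub>WG\<^esub>" using w(3) by (simp only:)
  from kernel_hprod[OF s this] obtain as where as: "set as \<subseteq> carrier G" "s = hprod as" .
  let ?x = "lift_prod as" and ?y = "lift_inv_prod as"
  have xy: "?x \<in> carrier EG" "?y \<in> carrier EG" using as by auto
  have "cls (wdiag EG n 1 ?x \<otimes>\<^bsub>WE\<^esub> wdiag EG n 2 ?y) = \<one>\<^bsub>WQ\<^esub>"
    using Phi unfolding as(2) Phi_hprod[OF as(1)] .
  then have "wdiag EG n 1 ?x \<otimes>\<^bsub>WE\<^esub> wdiag EG n 2 ?y \<in> A0"
    using cls_eq_one_iff[OF WE.H.m_closed[OF E.wdiag_closed[OF xy(1)] E.wdiag_closed[OF xy(2)]]] by blast
  then have y1: "snd ?y = \<one>" and xy1: "?x \<otimes>\<^bsub>EG\<^esub> ?y = \<one>\<^bsub>EG\<^esub>"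
    using wdiag_wdiag_A0[OF idx xy] by auto
  obtain Q :: "((nat \<times> 'a) word set \<times> ('a \<Rightarrow>\<^sub>0 int) \<Rightarrow> (nat \<times> 'a) word set \<times> ('a \<Rightarrow>\<^sub>0 int)) monoid"
    and \<iota> d where Q: "group Q" "\<iota> \<in> hom SG Q" "inj_on \<iota> (carrier SG)"
    and d [simp]: "\<And>g. g \<in> carrier G \<Longrightarrow> d g \<in> carrier Q"
    and d_\<iota>: "\<And>g s. g \<in> carrier G \<Longrightarrow> s \<in> carrier SG \<Longrightarrow> d g \<otimes>\<^bsub>Q\<^esub> \<iota> s = \<iota> (diag_act 1 g s) \<otimes>\<^bsub>Q\<^esub> d g"
    and d_d: "\<And>g h. g \<in> carrier G \<Longrightarrow> h \<in> carrier G \<Longrightarrow> d g \<otimes>\<^bsub>Q\<^esub> d h = \<iota> (c12 g h) \<otimes>\<^bsub>Q\<^esub> d h \<otimes>\<^bsub>Q\<^esub> d g"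
    using extension_group by blast
  interpret Q: group Q by fact
  interpret \<iota>: group_hom SG Q \<iota>
    using Q by (simp add: group_hom_def group_hom_axioms_def S.S.group_axioms)
  define z where "z a b = d a \<otimes>\<^bsub>Q\<^esub> d b \<otimes>\<^bsub>Q\<^esub> inv\<^bsub>Q\<^esub> d (a \<otimes> b)" for a b
  have z [simp]: "z a b \<in> carrier Q" if "a \<in> carrier G" "b \<in> carrier G" for a b
    using that by (simp add: z_def)
  have z_d: "z a b \<otimes>\<^bsub>Q\<^esub> d (a \<otimes> b) = d a \<otimes>\<^bsub>Q\<^esub> d b" if "a \<in> carrier G" "b \<in> carrier G" for a b
    using that by (simp add: z_def Q.m_assoc)
  \<comment> \<open>The defect acts on \<open>S\<^sub>n(G)\<close> like the product of the diagonal
    entries a, b and \<open>(ab)\<inverse>\<close> at position 1, that is, trivially.\<close>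
  have z_\<iota>: "z a b \<otimes>\<^bsub>Q\<^esub> \<iota> s = \<iota> s \<otimes>\<^bsub>Q\<^esub> z a b" if ab: "a \<in> carrier G" "b \<in> carrier G" and s: "s \<in> carrier SG" for a b s
  proof -
    let ?s' = "diag_act 1 (inv (a \<otimes> b)) s"
    have s': "?s' \<in> carrier SG" "diag_act 1 (a \<otimes> b) ?s' = s"
      using ab s by (simp_all add: Act_Act wdiag_mult wdiag_one Act_one)
    have "d (a \<otimes> b) \<otimes>\<^bsub>Q\<^esub> \<iota> ?s' = \<iota> s \<otimes>\<^bsub>Q\<^esub> d (a \<otimes> b)" using ab s' d_\<iota>[of "a \<otimes> b" ?s'] by simp
    then have "z a b \<otimes>\<^bsub>Q\<^esub> \<iota> s \<otimes>\<^bsub>Q\<^esub> d (a \<otimes> b) = z a b \<otimes>\<^bsub>Q\<^esub> d (a \<otimes> b) \<otimes>\<^bsub>Q\<^esub> \<iota> ?s'"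
      using ab s s'(1) by (simp add: Q.m_assoc)
    also have "\<dots> = d a \<otimes>\<^bsub>Q\<^esub> (d b \<otimes>\<^bsub>Q\<^esub> \<iota> ?s')"
      unfolding z_d[OF ab] using ab s'(1) by (simp add: Q.m_assoc)
    also have "\<dots> = (d a \<otimes>\<^bsub>Q\<^esub> \<iota> (diag_act 1 b ?s')) \<otimes>\<^bsub>Q\<^esub> d b"
      unfolding d_\<iota>[OF ab(2) s'(1)] using ab s'(1) by (simp add: Q.m_assoc)
    also have "\<dots> = \<iota> (diag_act 1 a (diag_act 1 b ?s')) \<otimes>\<^bsub>Q\<^esub> (d a \<otimes>\<^bsub>Q\<^esub> d b)"
      using ab s'(1) by (simp add: d_\<iota> Q.m_assoc)
    also have "diag_act 1 a (diag_act 1 b ?s') = diag_act 1 (a \<otimes> b) ?s'"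
      using ab s'(1) by (simp only: Act_Act wdiag_closed wdiag_mult)
    also have "\<iota> (diag_act 1 (a \<otimes> b) ?s') \<otimes>\<^bsub>Q\<^esub> (d a \<otimes>\<^bsub>Q\<^esub> d b) = \<iota> s \<otimes>\<^bsub>Q\<^esub> z a b \<otimes>\<^bsub>Q\<^esub> d (a \<otimes> b)"
      unfolding s'(2) z_d[OF ab, symmetric] using ab s by (simp add: Q.m_assoc)
    finally show ?thesis using ab s by simp
  qed
  \<comment> \<open>Moving d(c) past d(a) d(b) costs \<open>c12 c a\<close> times
    \<open>c12 c b\<close> shifted by a, and moving it past d(ab) costs \<open>c12 c (a b)\<close>.
    These agree by \<open>cc_mult_right\<close>.\<close>
  have central: "z a b \<otimes>\<^bsub>Q\<^esub> d c = d c \<otimes>\<^bsub>Q\<^esub> z a b" if abc: "a \<in> carrier G" "b \<in> carrier G" "c \<in> carrier G" for a b c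
  proof -
    let ?k = "\<iota> (c12 c (a \<otimes> b))"
    have k: "?k \<in> carrier Q" "\<iota> (c12 c a) \<in> carrier Q" "\<iota> (c12 c b) \<in> carrier Q"
      "\<iota> (diag_act 1 a (c12 c b)) \<in> carrier Q"
      using abc by (auto intro!: \<iota>.hom_closed)
    have k_eq: "?k = \<iota> (c12 c a) \<otimes>\<^bsub>Q\<^esub> \<iota> (diag_act 1 a (c12 c b))"
      using abc by (subst cc_mult_right) auto
    have "d c \<otimes>\<^bsub>Q\<^esub> z a b \<otimes>\<^bsub>Q\<^esub> d (a \<otimes> b) = (d c \<otimes>\<^bsub>Q\<^esub> d a) \<otimes>\<^bsub>Q\<^esub> d b"
      using abc z_d by (simp add: Q.m_assoc)
    also have "\<dots> = \<iota> (c12 c a) \<otimes>\<^bsub>Q\<^esub> (d a \<otimes>\<^bsub>Q\<^esub> (d c \<otimes>\<^bsub>Q\<^esub> d b))"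
      unfolding d_d[OF abc(3,1)] using abc k by (simp add: Q.m_assoc)
    also have "\<dots> = \<iota> (c12 c a) \<otimes>\<^bsub>Q\<^esub> ((d a \<otimes>\<^bsub>Q\<^esub> \<iota> (c12 c b)) \<otimes>\<^bsub>Q\<^esub> d b \<otimes>\<^bsub>Q\<^esub> d c)"
      unfolding d_d[OF abc(3,2)] using abc k by (simp add: Q.m_assoc)
    also have "d a \<otimes>\<^bsub>Q\<^esub> \<iota> (c12 c b) = \<iota> (diag_act 1 a (c12 c b)) \<otimes>\<^bsub>Q\<^esub> d a"
      using abc by (intro d_\<iota>) auto
    also have "\<iota> (c12 c a) \<otimes>\<^bsub>Q\<^esub> (\<iota> (diag_act 1 a (c12 c b)) \<otimes>\<^bsub>Q\<^esub> d a \<otimes>\<^bsub>Q\<^esub> d b \<otimes>\<^bsub>Q\<^esub> d c) = ?k \<otimes>\<^bsub>Q\<^esub> (d a \<otimes>\<^bsub>Q\<^esub> d b) \<otimes>\<^bsub>Q\<^esub> d c"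
      unfolding k_eq using abc k by (simp add: Q.m_assoc)
    also have "\<dots> = (?k \<otimes>\<^bsub>Q\<^esub> z a b) \<otimes>\<^bsub>Q\<^esub> (d (a \<otimes> b) \<otimes>\<^bsub>Q\<^esub> d c)"
      unfolding z_d[OF abc(1,2), symmetric] using abc k by (simp add: Q.m_assoc)
    also have "?k \<otimes>\<^bsub>Q\<^esub> z a b = z a b \<otimes>\<^bsub>Q\<^esub> ?k"
      using abc by (intro z_\<iota>[symmetric]) auto
    also have "z a b \<otimes>\<^bsub>Q\<^esub> ?k \<otimes>\<^bsub>Q\<^esub> (d (a \<otimes> b) \<otimes>\<^bsub>Q\<^esub> d c) = z a b \<otimes>\<^bsub>Q\<^esub> (?k \<otimes>\<^bsub>Q\<^esub> d (a \<otimes> b) \<otimes>\<^bsub>Q\<^esub> d c)"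
      using abc k by (simp add: Q.m_assoc)
    also have "?k \<otimes>\<^bsub>Q\<^esub> d (a \<otimes> b) \<otimes>\<^bsub>Q\<^esub> d c = d c \<otimes>\<^bsub>Q\<^esub> d (a \<otimes> b)"
      using abc by (intro d_d[symmetric]) auto
    also have "z a b \<otimes>\<^bsub>Q\<^esub> (d c \<otimes>\<^bsub>Q\<^esub> d (a \<otimes> b)) = z a b \<otimes>\<^bsub>Q\<^esub> d c \<otimes>\<^bsub>Q\<^esub> d (a \<otimes> b)"
      using abc by (simp add: Q.m_assoc)
    finally show ?thesis using abc by simp
  qed
  obtain \<Omega> where \<Omega>: "\<Omega> \<in> hom EG Q" "\<And>g. g \<in> carrier G \<Longrightarrow> \<Omega> (U.ext_lift g) = d g"
    using U_universal[OF Q(1), of d] central unfolding z_def by (metis d)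
  interpret \<Omega>: group_hom EG Q \<Omega>
    using \<Omega>(1) by (simp add: group_hom_def group_hom_axioms_def E.group_axioms Q.group_axioms)
  \<comment> \<open>Only the image of \<gamma> in G matters for the action, so elements of the
    kernel of the extension commute with all of \<open>S\<^sub>n(G)\<close>, in particular with
    t.\<close>
  have \<Omega>_\<iota>: "\<Omega> \<gamma> \<otimes>\<^bsub>Q\<^esub> \<iota> s = \<iota> (diag_act 1 (snd \<gamma>) s) \<otimes>\<^bsub>Q\<^esub> \<Omega> \<gamma>"
    if \<gamma>: "\<gamma> \<in> carrier EG" and s: "s \<in> carrier SG" for \<gamma> s
  proof -
    have lift: "U.ext_lift ` carrier G \<subseteq> carrier EG" by auto
    have "\<gamma> \<in> generate EG (U.ext_lift ` carrier G)" using \<gamma> by (simp only: generate_ext_lift)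
    then have "\<forall>s \<in> carrier SG. \<Omega> \<gamma> \<otimes>\<^bsub>Q\<^esub> \<iota> s = \<iota> (diag_act 1 (snd \<gamma>) s) \<otimes>\<^bsub>Q\<^esub> \<Omega> \<gamma>"
    proof induction
      case one
      then show ?case by (simp add: wdiag_one Act_one del: One_nat_def)
    next
      case (incl h)
      then show ?case using \<Omega>(2) d_\<iota> by (auto simp: U.ext_lift_def simp del: One_nat_def)
    next
      case (inv h)
      then obtain g where g: "g \<in> carrier G" "h = U.ext_lift g" by blast
      then have snd: "snd h = g" by (simp add: U.ext_lift_def)
      show ?case
      proof
        fix s assume s: "s \<in> carrier SG"
        let ?s' = "diag_act 1 (inv g) s"
        have s': "?s' \<in> carrier SG" "diag_act 1 g ?s' = s"
          using g s by (simp_all add: Act_Act wdiag_mult wdiag_one Act_one)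
        have "d g \<otimes>\<^bsub>Q\<^esub> \<iota> ?s' = \<iota> s \<otimes>\<^bsub>Q\<^esub> d g" using g s' d_\<iota>[of g ?s'] by simp
        then have "inv\<^bsub>Q\<^esub> d g \<otimes>\<^bsub>Q\<^esub> (d g \<otimes>\<^bsub>Q\<^esub> \<iota> ?s') \<otimes>\<^bsub>Q\<^esub> inv\<^bsub>Q\<^esub> d g = inv\<^bsub>Q\<^esub> d g \<otimes>\<^bsub>Q\<^esub> (\<iota> s \<otimes>\<^bsub>Q\<^esub> d g) \<otimes>\<^bsub>Q\<^esub> inv\<^bsub>Q\<^esub> d g" by simp
        then have "\<iota> ?s' \<otimes>\<^bsub>Q\<^esub> inv\<^bsub>Q\<^esub> d g = inv\<^bsub>Q\<^esub> d g \<otimes>\<^bsub>Q\<^esub> \<iota> s"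
          using g s s'(1) by (simp add: Q.m_assoc)
        then show "\<Omega> (inv\<^bsub>EG\<^esub> h) \<otimes>\<^bsub>Q\<^esub> \<iota> s = \<iota> (diag_act 1 (snd (inv\<^bsub>EG\<^esub> h)) s) \<otimes>\<^bsub>Q\<^esub> \<Omega> (inv\<^bsub>EG\<^esub> h)"
          using g \<Omega>(2) snd by (simp del: One_nat_def)
      qed
    next
      case (eng h1 h2)
      have h: "h1 \<in> carrier EG" "h2 \<in> carrier EG" using eng.hyps E.generate_in_carrier[OF lift] by auto
      then have sh: "snd h1 \<in> carrier G" "snd h2 \<in> carrier G" by auto
      show ?case
      proof
        fix s assume s: "s \<in> carrier SG"
        have "\<Omega> (h1 \<otimes>\<^bsub>EG\<^esub> h2) \<otimes>\<^bsub>Q\<^esub> \<iota> s = \<Omega> h1 \<otimes>\<^bsub>Q\<^esub> (\<Omega> h2 \<otimes>\<^bsub>Q\<^esub> \<iota> s)"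
          using h s by (simp add: Q.m_assoc)
        also have "\<dots> = (\<Omega> h1 \<otimes>\<^bsub>Q\<^esub> \<iota> (diag_act 1 (snd h2) s)) \<otimes>\<^bsub>Q\<^esub> \<Omega> h2"
          using bspec[OF eng.IH(2) s] h sh s by (simp add: Q.m_assoc del: One_nat_def)
        also have "\<Omega> h1 \<otimes>\<^bsub>Q\<^esub> \<iota> (diag_act 1 (snd h2) s) = \<iota> (diag_act 1 (snd h1) (diag_act 1 (snd h2) s)) \<otimes>\<^bsub>Q\<^esub> \<Omega> h1"
          using eng.IH(1) sh s by (simp del: One_nat_def)
        also have "diag_act 1 (snd h1) (diag_act 1 (snd h2) s) = diag_act 1 (snd (h1 \<otimes>\<^bsub>EG\<^esub> h2)) s"
          using h sh s by (simp add: Act_Act wdiag_mult del: One_nat_def)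
        also have "\<iota> (diag_act 1 (snd (h1 \<otimes>\<^bsub>EG\<^esub> h2)) s) \<otimes>\<^bsub>Q\<^esub> \<Omega> h1 \<otimes>\<^bsub>Q\<^esub> \<Omega> h2 =
            \<iota> (diag_act 1 (snd (h1 \<otimes>\<^bsub>EG\<^esub> h2)) s) \<otimes>\<^bsub>Q\<^esub> \<Omega> (h1 \<otimes>\<^bsub>EG\<^esub> h2)"
          using h sh s by (simp add: Q.m_assoc del: One_nat_def)
        finally show "\<Omega> (h1 \<otimes>\<^bsub>EG\<^esub> h2) \<otimes>\<^bsub>Q\<^esub> \<iota> s = \<iota> (diag_act 1 (snd (h1 \<otimes>\<^bsub>EG\<^esub> h2)) s) \<otimes>\<^bsub>Q\<^esub> \<Omega> (h1 \<otimes>\<^bsub>EG\<^esub> h2)" .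
      qed
    qed
    then show ?thesis using s by blast
  qed
  define t where "t = \<iota> (ssym (1, 2, \<one>))"
  have sc: "ssym (1, 2, a) \<in> carrier SG" if "a \<in> carrier G" for a using that idx by simp
  have t: "t \<in> carrier Q" using sc by (simp add: t_def)
  have tt: "t \<otimes>\<^bsub>Q\<^esub> t = \<one>\<^bsub>Q\<^esub>"
    using sc S.sym_square[of "(1, 2, \<one>)"] idx by (simp add: t_def flip: \<iota>.hom_mult)
  have t_t: "t \<otimes>\<^bsub>Q\<^esub> (t \<otimes>\<^bsub>Q\<^esub> u) = u" if "u \<in> carrier Q" for u
    using that t by (simp add: tt flip: Q.m_assoc)
  \<comment> \<open>In \<open>Q\<close> the diagonal lift becomes the commutator of d(a) and the
    involution t, because d(a) conjugates the symbol with label 1 to the symbol with label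
    a.\<close>
  have h_eq: "\<iota> (hh 1 2 a) = d a \<otimes>\<^bsub>Q\<^esub> (t \<otimes>\<^bsub>Q\<^esub> inv\<^bsub>Q\<^esub> d a \<otimes>\<^bsub>Q\<^esub> t)" if a: "a \<in> carrier G" for a
  proof -
    have "d a \<otimes>\<^bsub>Q\<^esub> t = \<iota> (ssym (1, 2, a)) \<otimes>\<^bsub>Q\<^esub> d a"
      using a idx d_\<iota>[OF a sc[OF one_closed]] by (simp add: t_def diag_act_ssym)
    then have "d a \<otimes>\<^bsub>Q\<^esub> t \<otimes>\<^bsub>Q\<^esub> (inv\<^bsub>Q\<^esub> d a \<otimes>\<^bsub>Q\<^esub> t) = \<iota> (ssym (1, 2, a)) \<otimes>\<^bsub>Q\<^esub> t"
      using a t sc by (simp add: Q.m_assoc)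
    then show ?thesis using a t sc by (simp add: hh_def t_def Q.m_assoc)
  qed
  have hc: "hh 1 2 a \<in> carrier SG" if "a \<in> carrier G" for a using that idx by simp
  have tdt: "t \<otimes>\<^bsub>Q\<^esub> d b \<otimes>\<^bsub>Q\<^esub> t = inv\<^bsub>Q\<^esub> \<iota> (hh 1 2 b) \<otimes>\<^bsub>Q\<^esub> d b" if b: "b \<in> carrier G" for b
    using b t by (simp add: h_eq Q.inv_mult_group Q.m_assoc Q.inv_equality[OF tt t t] del: One_nat_def)
  \<comment> \<open>The conjugate t d(b) t plays the role of a diagonal entry b in position 2. It
    commutes with d(a) because the prescribed commutator \<open>c12 b a\<close> is, by definition,
    the quotient of \<open>hh 1 2 b\<close> and its shift by a.\<close>
  have comm: "t \<otimes>\<^bsub>Q\<^esub> d b \<otimes>\<^bsub>Q\<^esub> t \<otimes>\<^bsub>Q\<^esub> d a = d a \<otimes>\<^bsub>Q\<^esub> (t \<otimes>\<^bsub>Q\<^esub> d b \<otimes>\<^bsub>Q\<^esub> t)"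
    if ab: "a \<in> carrier G" "b \<in> carrier G" for a b
  proof -
    let ?h = "hh 1 2 b"
    have c: "\<iota> ?h \<in> carrier Q" "\<iota> (diag_act 1 a ?h) \<in> carrier Q" "diag_act 1 a ?h \<in> carrier SG"
      "inv\<^bsub>SG\<^esub> ?h \<in> carrier SG"
      using ab hc by simp_all
    have "inv\<^bsub>Q\<^esub> \<iota> ?h \<otimes>\<^bsub>Q\<^esub> d b \<otimes>\<^bsub>Q\<^esub> d a = inv\<^bsub>Q\<^esub> \<iota> ?h \<otimes>\<^bsub>Q\<^esub> (\<iota> (c12 b a) \<otimes>\<^bsub>Q\<^esub> d a \<otimes>\<^bsub>Q\<^esub> d b)"
      using ab c d_d[OF ab(2,1)] by (simp add: Q.m_assoc)
    also have "\<iota> (c12 b a) = \<iota> ?h \<otimes>\<^bsub>Q\<^esub> inv\<^bsub>Q\<^esub> \<iota> (diag_act 1 a ?h)"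
      using ab c hc by (simp add: cc_def)
    also have "inv\<^bsub>Q\<^esub> \<iota> ?h \<otimes>\<^bsub>Q\<^esub> (\<iota> ?h \<otimes>\<^bsub>Q\<^esub> inv\<^bsub>Q\<^esub> \<iota> (diag_act 1 a ?h) \<otimes>\<^bsub>Q\<^esub> d a \<otimes>\<^bsub>Q\<^esub> d b) =
      (inv\<^bsub>Q\<^esub> \<iota> (diag_act 1 a ?h) \<otimes>\<^bsub>Q\<^esub> d a) \<otimes>\<^bsub>Q\<^esub> d b"
      using ab c by (simp add: Q.m_assoc)
    also have "inv\<^bsub>Q\<^esub> \<iota> (diag_act 1 a ?h) \<otimes>\<^bsub>Q\<^esub> d a = d a \<otimes>\<^bsub>Q\<^esub> inv\<^bsub>Q\<^esub> \<iota> ?h"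
      using ab c hc d_\<iota>[OF ab(1) c(4)] by (simp del: One_nat_def)
    finally show ?thesis
      unfolding tdt[OF ab(2)] using ab c by (simp add: Q.m_assoc)
  qed
  have tc: "t \<otimes>\<^bsub>Q\<^esub> u \<otimes>\<^bsub>Q\<^esub> t \<in> carrier Q" if "u \<in> carrier Q" for u using that t by simp
  have t_mult: "(t \<otimes>\<^bsub>Q\<^esub> u \<otimes>\<^bsub>Q\<^esub> t) \<otimes>\<^bsub>Q\<^esub> (t \<otimes>\<^bsub>Q\<^esub> v \<otimes>\<^bsub>Q\<^esub> t) = t \<otimes>\<^bsub>Q\<^esub> (u \<otimes>\<^bsub>Q\<^esub> v) \<otimes>\<^bsub>Q\<^esub> t"
    if "u \<in> carrier Q" "v \<in> carrier Q" for u v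
    using that t by (simp add: Q.m_assoc t_t)
  have comm_inv: "t \<otimes>\<^bsub>Q\<^esub> inv\<^bsub>Q\<^esub> d b \<otimes>\<^bsub>Q\<^esub> t \<otimes>\<^bsub>Q\<^esub> d a = d a \<otimes>\<^bsub>Q\<^esub> (t \<otimes>\<^bsub>Q\<^esub> inv\<^bsub>Q\<^esub> d b \<otimes>\<^bsub>Q\<^esub> t)"
    if ab: "a \<in> carrier G" "b \<in> carrier G" for a b
  proof -
    let ?u = "t \<otimes>\<^bsub>Q\<^esub> d b \<otimes>\<^bsub>Q\<^esub> t"
    have u: "?u \<in> carrier Q" using ab t by simp
    have iu: "inv\<^bsub>Q\<^esub> ?u = t \<otimes>\<^bsub>Q\<^esub> inv\<^bsub>Q\<^esub> d b \<otimes>\<^bsub>Q\<^esub> t"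
      using ab t by (simp add: Q.inv_mult_group Q.m_assoc Q.inv_equality[OF tt t t])
    have "inv\<^bsub>Q\<^esub> ?u \<otimes>\<^bsub>Q\<^esub> (?u \<otimes>\<^bsub>Q\<^esub> d a) \<otimes>\<^bsub>Q\<^esub> inv\<^bsub>Q\<^esub> ?u = inv\<^bsub>Q\<^esub> ?u \<otimes>\<^bsub>Q\<^esub> (d a \<otimes>\<^bsub>Q\<^esub> ?u) \<otimes>\<^bsub>Q\<^esub> inv\<^bsub>Q\<^esub> ?u"
      using comm[OF ab] by simp
    moreover have "inv\<^bsub>Q\<^esub> ?u \<otimes>\<^bsub>Q\<^esub> (?u \<otimes>\<^bsub>Q\<^esub> d a) \<otimes>\<^bsub>Q\<^esub> inv\<^bsub>Q\<^esub> ?u = d a \<otimes>\<^bsub>Q\<^esub> inv\<^bsub>Q\<^esub> ?u"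
      using u ab by (simp only: Q.inv_cancel_left d)
    moreover have "inv\<^bsub>Q\<^esub> ?u \<otimes>\<^bsub>Q\<^esub> (d a \<otimes>\<^bsub>Q\<^esub> ?u) \<otimes>\<^bsub>Q\<^esub> inv\<^bsub>Q\<^esub> ?u = inv\<^bsub>Q\<^esub> ?u \<otimes>\<^bsub>Q\<^esub> d a"
      using u ab by (simp only: Q.m_assoc Q.r_inv Q.r_one Q.m_closed Q.inv_closed d)
    ultimately show ?thesis unfolding iu by simp
  qed
  \<comment> \<open>The entries of position 1 are collected on the left and those of position 2 on
    the right. The second conjunct strengthens the induction: it allows the next d(a) to pass the
    part already collected.\<close>
  have "\<iota> (hprod as) = \<Omega> (lift_prod as) \<otimes>\<^bsub>Q\<^esub> (t \<otimes>\<^bsub>Q\<^esub> \<Omega> (lift_inv_prod as) \<otimes>\<^bsub>Q\<^esub> t) \<and>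
    (\<forall>a \<in> carrier G. t \<otimes>\<^bsub>Q\<^esub> \<Omega> (lift_inv_prod as) \<otimes>\<^bsub>Q\<^esub> t \<otimes>\<^bsub>Q\<^esub> d a = d a \<otimes>\<^bsub>Q\<^esub> (t \<otimes>\<^bsub>Q\<^esub> \<Omega> (lift_inv_prod as) \<otimes>\<^bsub>Q\<^esub> t))"
    if "set as \<subseteq> carrier G" for as
    using that
  proof (induction as)
    case Nil
    then show ?case using t tt by simp
  next
    case (Cons b as)
    let ?p = "\<Omega> (lift_prod as)" and ?q = "\<Omega> (lift_inv_prod as)"
    have b: "b \<in> carrier G" and as: "set as \<subseteq> carrier G" using Cons.prems by auto
    have pq: "?p \<in> carrier Q" "?q \<in> carrier Q" "d b \<in> carrier Q" using as b by simp_all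
    note IH = Cons.IH[OF as, THEN conjunct1] Cons.IH[OF as, THEN conjunct2, rule_format]
    have e: "\<Omega> (lift_prod (b # as)) = ?p \<otimes>\<^bsub>Q\<^esub> d b" "\<Omega> (lift_inv_prod (b # as)) = ?q \<otimes>\<^bsub>Q\<^esub> inv\<^bsub>Q\<^esub> d b"
      using as b \<Omega>(2) by simp_all
    have "\<iota> (hprod (b # as)) = \<iota> (hprod as) \<otimes>\<^bsub>Q\<^esub> \<iota> (hh 1 2 b)"
      using as hc[OF b] by (simp del: One_nat_def)
    also have "\<dots> = ?p \<otimes>\<^bsub>Q\<^esub> (t \<otimes>\<^bsub>Q\<^esub> ?q \<otimes>\<^bsub>Q\<^esub> t \<otimes>\<^bsub>Q\<^esub> d b) \<otimes>\<^bsub>Q\<^esub> (t \<otimes>\<^bsub>Q\<^esub> inv\<^bsub>Q\<^esub> d b \<otimes>\<^bsub>Q\<^esub> t)"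
      unfolding IH(1) h_eq[OF b] using pq t by (simp add: Q.m_assoc)
    also have "\<dots> = (?p \<otimes>\<^bsub>Q\<^esub> d b) \<otimes>\<^bsub>Q\<^esub> ((t \<otimes>\<^bsub>Q\<^esub> ?q \<otimes>\<^bsub>Q\<^esub> t) \<otimes>\<^bsub>Q\<^esub> (t \<otimes>\<^bsub>Q\<^esub> inv\<^bsub>Q\<^esub> d b \<otimes>\<^bsub>Q\<^esub> t))"
      unfolding IH(2)[OF b] using pq t by (simp add: Q.m_assoc)
    also have "\<dots> = \<Omega> (lift_prod (b # as)) \<otimes>\<^bsub>Q\<^esub> (t \<otimes>\<^bsub>Q\<^esub> \<Omega> (lift_inv_prod (b # as)) \<otimes>\<^bsub>Q\<^esub> t)"
      unfolding e using pq by (simp add: t_mult)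
    finally have 1: "\<iota> (hprod (b # as)) = \<Omega> (lift_prod (b # as)) \<otimes>\<^bsub>Q\<^esub> (t \<otimes>\<^bsub>Q\<^esub> \<Omega> (lift_inv_prod (b # as)) \<otimes>\<^bsub>Q\<^esub> t)" .
    have "t \<otimes>\<^bsub>Q\<^esub> (?q \<otimes>\<^bsub>Q\<^esub> inv\<^bsub>Q\<^esub> d b) \<otimes>\<^bsub>Q\<^esub> t \<otimes>\<^bsub>Q\<^esub> d a = d a \<otimes>\<^bsub>Q\<^esub> (t \<otimes>\<^bsub>Q\<^esub> (?q \<otimes>\<^bsub>Q\<^esub> inv\<^bsub>Q\<^esub> d b) \<otimes>\<^bsub>Q\<^esub> t)"
      if a: "a \<in> carrier G" for a
    proof -
      let ?u = "t \<otimes>\<^bsub>Q\<^esub> ?q \<otimes>\<^bsub>Q\<^esub> t" and ?v = "t \<otimes>\<^bsub>Q\<^esub> inv\<^bsub>Q\<^esub> d b \<otimes>\<^bsub>Q\<^esub> t"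
      have uv: "?u \<in> carrier Q" "?v \<in> carrier Q" "d a \<in> carrier Q" using pq t a by simp_all
      have m: "t \<otimes>\<^bsub>Q\<^esub> (?q \<otimes>\<^bsub>Q\<^esub> inv\<^bsub>Q\<^esub> d b) \<otimes>\<^bsub>Q\<^esub> t = ?u \<otimes>\<^bsub>Q\<^esub> ?v" using pq by (simp add: t_mult)
      have "?u \<otimes>\<^bsub>Q\<^esub> ?v \<otimes>\<^bsub>Q\<^esub> d a = ?u \<otimes>\<^bsub>Q\<^esub> (?v \<otimes>\<^bsub>Q\<^esub> d a)" using uv by (rule Q.m_assoc)
      also have "\<dots> = ?u \<otimes>\<^bsub>Q\<^esub> (d a \<otimes>\<^bsub>Q\<^esub> ?v)" by (simp only: comm_inv[OF a b])
      also have "\<dots> = ?u \<otimes>\<^bsub>Q\<^esub> d a \<otimes>\<^bsub>Q\<^esub> ?v" using uv by (intro Q.m_assoc[symmetric])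
      also have "\<dots> = d a \<otimes>\<^bsub>Q\<^esub> ?u \<otimes>\<^bsub>Q\<^esub> ?v" by (simp only: IH(2)[OF a])
      also have "\<dots> = d a \<otimes>\<^bsub>Q\<^esub> (?u \<otimes>\<^bsub>Q\<^esub> ?v)" using uv by (intro Q.m_assoc)
      finally show ?thesis unfolding m .
    qed
    then show ?case using 1 by (simp only: e) blast
  qed
  from this[OF as(1)] have "\<iota> s = \<Omega> ?x \<otimes>\<^bsub>Q\<^esub> (t \<otimes>\<^bsub>Q\<^esub> \<Omega> ?y \<otimes>\<^bsub>Q\<^esub> t)" by (simp add: as(2))
  \<comment> \<open>Since \<open>?y\<close> lies over 1, its image commutes with t; the two copies
    of t cancel and only the image of \<open>?x\<close> times \<open>?y\<close>, which is 1,
    remains.\<close>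
  also have "t \<otimes>\<^bsub>Q\<^esub> \<Omega> ?y = \<Omega> ?y \<otimes>\<^bsub>Q\<^esub> t"
    using \<Omega>_\<iota>[OF xy(2) sc[OF one_closed]] sc by (simp add: y1 wdiag_one Act_one t_def del: One_nat_def)
  also have "\<Omega> ?x \<otimes>\<^bsub>Q\<^esub> (\<Omega> ?y \<otimes>\<^bsub>Q\<^esub> t \<otimes>\<^bsub>Q\<^esub> t) = \<Omega> (?x \<otimes>\<^bsub>EG\<^esub> ?y)"
    using xy t by (simp add: Q.m_assoc tt)
  finally have "\<iota> s = \<iota> \<one>\<^bsub>SG\<^esub>" by (simp add: xy1)
  then show ?thesis using Q(3) s by (meson S.S.one_closed inj_onD)
qed

section \<open>Kernel and cokernel\<close>

text \<open>The determinant is abelian, so the order of the factors in \<open>lift_inv_prod\<close>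
  is irrelevant here.\<close>

lemma ext_del_lift_prods:
  assumes "set as \<subseteq> carrier G"
  shows "ext_del (lift_prod as) + ext_del (lift_inv_prod as) = 0"
  using assms
proof (induction as)
  case (Cons a as)
  then have "ext_del (U.ext_lift a) + ext_del (inv\<^bsub>EG\<^esub> U.ext_lift a) = 0"
    using ext_del_mult[of "U.ext_lift a" "inv\<^bsub>EG\<^esub> U.ext_lift a"] by (simp add: ext_del_one)
  then show ?case using Cons by (simp add: ext_del_mult algebra_simps)
qed (simp add: ext_del_one)

lemma wdiag_hom: "wdiag EG n i \<in> hom EG WE"
  by (rule homI) (auto simp: E.wdiag_mult)

lemma wproj_wdiag: "\<gamma> \<in> carrier EG \<Longrightarrow> wproj (wdiag EG n i \<gamma>) = wdiag G n i (snd \<gamma>)"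
  by (auto simp: wproj_def wdiag_def fun_eq_iff)

text \<open>Dividing by \<open>A0\<close> identifies central entries in different positions but
  keeps their product, so one position embeds faithfully.\<close>

lemma cls_wdiag_eq_one_iff:
  assumes "\<gamma> \<in> carrier EG"
  shows "cls (wdiag EG n 1 \<gamma>) = \<one>\<^bsub>WQ\<^esub> \<longleftrightarrow> \<gamma> = \<one>\<^bsub>EG\<^esub>"
proof -
  have idx: "(1::nat) \<in> {1..n}" "(2::nat) \<in> {1..n}" "(1::nat) \<noteq> 2" using three_le by auto
  have "wdiag EG n 1 \<gamma> \<otimes>\<^bsub>WE\<^esub> wdiag EG n 2 \<one>\<^bsub>EG\<^esub> \<in> A0 \<longleftrightarrow> \<gamma> = \<one>\<^bsub>EG\<^esub>"
    using assms by (subst wdiag_wdiag_A0[OF idx]) auto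
  then have "wdiag EG n 1 \<gamma> \<in> A0 \<longleftrightarrow> \<gamma> = \<one>\<^bsub>EG\<^esub>"
    using assms by (simp add: E.wdiag_one)
  then show ?thesis
    using cls_eq_one_iff[OF E.wdiag_closed[OF assms]] by blast
qed

text \<open>A 2-chain placed as a central entry in position 1; the kernel of this map is exactly
  \<open>bdry 2\<close>.\<close>

definition bar2_emb :: "('a list \<Rightarrow>\<^sub>0 int) \<Rightarrow> ((nat \<Rightarrow> ('a list \<Rightarrow>\<^sub>0 int) set \<times> 'a) \<times> (nat \<Rightarrow> nat)) set"
  where "bar2_emb c = cls (wdiag EG n 1 (U.ext_in (bar2_cls c)))"

lemma bar2_cls_closed: "c \<in> carrier (bar 2) \<Longrightarrow> bar2_cls c \<in> carrier bar2_mod"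
  by (rule hom_in_carrier[OF bar2_cls_hom])

lemma bar2_emb_hom: "bar2_emb \<in> hom (bar 2) WQ"
proof -
  have "(\<lambda>c. wdiag EG n 1 (U.ext_in (bar2_cls c))) \<in> hom (bar 2) WE"
    using Group.hom_compose[OF Group.hom_compose[OF bar2_cls_hom U.ext_in_hom] wdiag_hom]
    by (simp add: comp_def del: bar_simps)
  from Group.hom_compose[OF this cls.homh] show ?thesis
    by (simp add: bar2_emb_def[abs_def] comp_def del: bar_simps)
qed

lemma bar2_emb_eq_one_iff:
  assumes c: "c \<in> carrier (bar 2)"
  shows "bar2_emb c = \<one>\<^bsub>WQ\<^esub> \<longleftrightarrow> c \<in> bdry 2"
proof -
  have one: "U.ext_in \<one>\<^bsub>bar2_mod\<^esub> = \<one>\<^bsub>EG\<^esub>"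
    by (rule hom_one[OF U.ext_in_hom U.A.group_axioms E.group_axioms])
  have "bar2_emb c = \<one>\<^bsub>WQ\<^esub> \<longleftrightarrow> U.ext_in (bar2_cls c) = \<one>\<^bsub>EG\<^esub>"
    unfolding bar2_emb_def by (rule cls_wdiag_eq_one_iff[OF U.ext_in_closed[OF bar2_cls_closed[OF c]]])
  also have "\<dots> \<longleftrightarrow> bar2_cls c = \<one>\<^bsub>bar2_mod\<^esub>"
    using inj_onD[OF U.ext_in_inj _ bar2_cls_closed[OF c] U.A.one_closed] one by auto
  also have "\<dots> \<longleftrightarrow> c \<in> bdry 2" by (rule bar2_cls_eq_one_iff[OF c])
  finally show ?thesis .
qed

lemma det_wdiag: "det_E (wdiag EG n 1 \<gamma>) = ext_del \<gamma>"
  by (rule E.wdet_wdiag) (use three_le in \<open>auto simp: ext_del_one\<close>)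

text \<open>Both diagonal entries x, y of the image lie over 1, so modulo \<open>A0\<close> they can
  be merged into the single central entry xy. Its boundary is the determinant, which vanishes since
  y collects the inverses of the factors of x.\<close>

lemma Phi_kernel_subset:
  assumes s: "s \<in> carrier SG" and mu: "mu s = \<one>\<^bsub>WG\<^esub>"
  shows "\<exists>c \<in> carrier (bar 2). bd 2 c = 0 \<and> Phi s = bar2_emb c"
proof -
  have idx: "(1::nat) \<in> {1..n}" "(2::nat) \<in> {1..n}" "(2::nat) \<noteq> 1" "(1::nat) \<noteq> 2" using three_le by auto
  obtain as where as: "set as \<subseteq> carrier G" "s = hprod as" using kernel_hprod[OF s mu] .
  let ?x = "lift_prod as" and ?y = "lift_inv_prod as"
  let ?dx = "wdiag EG n 1 ?x" and ?dy = "wdiag EG n 2 ?y"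
  have xy: "?x \<in> carrier EG" "?y \<in> carrier EG" using as by auto
  have dxy: "?dx \<in> carrier WE" "?dy \<in> carrier WE" using xy by auto
  obtain w where w: "w \<in> TE" "Phi s = cls w" "mu s = wproj w" using SG_to_TE[OF s] by blast
  have wW: "w \<in> carrier WE" by (rule TE_carrier[OF w(1)])
  have Phi: "Phi s = cls (?dx \<otimes>\<^bsub>WE\<^esub> ?dy)" unfolding as(2) by (rule Phi_hprod[OF as(1)])
  \<comment> \<open>The companion \<open>w\<close> and the diagonal matrix have the same class,
    hence the same projection to G, which is \<open>mu s = 1\<close>. Both entries therefore lie
    over 1.\<close>
  have "cls (?dx \<otimes>\<^bsub>WE\<^esub> ?dy \<otimes>\<^bsub>WE\<^esub> inv\<^bsub>WE\<^esub> w) = cls (?dx \<otimes>\<^bsub>WE\<^esub> ?dy) \<otimes>\<^bsub>WQ\<^esub> inv\<^bsub>WQ\<^esub> cls w"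
    using dxy wW by (simp only: cls.hom_mult cls.hom_inv WE.H.m_closed WE.H.inv_closed)
  also have "\<dots> = cls w \<otimes>\<^bsub>WQ\<^esub> inv\<^bsub>WQ\<^esub> cls w" using Phi w(2) by (simp only:)
  also have "\<dots> = \<one>\<^bsub>WQ\<^esub>" by (rule WQ.r_inv[OF cls.hom_closed[OF wW]])
  finally have "?dx \<otimes>\<^bsub>WE\<^esub> ?dy \<otimes>\<^bsub>WE\<^esub> inv\<^bsub>WE\<^esub> w \<in> A0"
    using cls_eq_one_iff[OF WE.H.m_closed[OF WE.H.m_closed[OF dxy] WE.H.inv_closed[OF wW]]] by blast
  then have "wproj (?dx \<otimes>\<^bsub>WE\<^esub> ?dy \<otimes>\<^bsub>WE\<^esub> inv\<^bsub>WE\<^esub> w) = \<one>\<^bsub>WG\<^esub>" by (rule wproj_A0)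
  moreover have "wproj (?dx \<otimes>\<^bsub>WE\<^esub> ?dy \<otimes>\<^bsub>WE\<^esub> inv\<^bsub>WE\<^esub> w) = wdiag G n 1 (snd ?x) \<otimes>\<^bsub>WG\<^esub> wdiag G n 2 (snd ?y)"
  proof -
    have "wproj w = \<one>\<^bsub>WG\<^esub>" using w(3) mu by (simp only:)
    then have "wproj (?dx \<otimes>\<^bsub>WE\<^esub> ?dy \<otimes>\<^bsub>WE\<^esub> inv\<^bsub>WE\<^esub> w) = wproj ?dx \<otimes>\<^bsub>WG\<^esub> wproj ?dy \<otimes>\<^bsub>WG\<^esub> inv\<^bsub>WG\<^esub> \<one>\<^bsub>WG\<^esub>"
      using dxy wW by (simp only: wproj.hom_mult wproj.hom_inv WE.H.m_closed WE.H.inv_closed)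
    also have "\<dots> = wproj ?dx \<otimes>\<^bsub>WG\<^esub> wproj ?dy" using dxy by simp
    finally show ?thesis using xy by (simp only: wproj_wdiag)
  qed
  ultimately have one: "wdiag G n 1 (snd ?x) \<otimes>\<^bsub>WG\<^esub> wdiag G n 2 (snd ?y) = \<one>\<^bsub>WG\<^esub>" by simp
  have sc: "snd ?x \<in> carrier G" "snd ?y \<in> carrier G" using xy by auto
  have "fst (wdiag G n 1 (snd ?x) \<otimes>\<^bsub>WG\<^esub> wdiag G n 2 (snd ?y)) 1 = snd ?x"
    "fst (wdiag G n 1 (snd ?x) \<otimes>\<^bsub>WG\<^esub> wdiag G n 2 (snd ?y)) 2 = snd ?y"
    using idx sc by (auto simp: wdiag_def mult_wreath)
  then have snd: "snd ?x = \<one>" "snd ?y = \<one>"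
    using idx unfolding one by (simp_all add: one_wreath)
  \<comment> \<open>Central entries may be moved between positions modulo \<open>A0\<close>.\<close>
  have "wdiag EG n 2 ?y \<otimes>\<^bsub>WE\<^esub> wdiag EG n 1 (inv\<^bsub>EG\<^esub> ?y) \<in> A0"
    using idx xy snd by (subst wdiag_wdiag_A0) auto
  then have "cls (?dy \<otimes>\<^bsub>WE\<^esub> wdiag EG n 1 (inv\<^bsub>EG\<^esub> ?y)) = \<one>\<^bsub>WQ\<^esub>"
    using cls_eq_one_iff[OF WE.H.m_closed[OF dxy(2) E.wdiag_closed[OF E.inv_closed[OF xy(2)]]]] by blast
  then have "cls ?dy \<otimes>\<^bsub>WQ\<^esub> inv\<^bsub>WQ\<^esub> cls (wdiag EG n 1 ?y) = \<one>\<^bsub>WQ\<^esub>"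
    using dxy xy by (simp only: cls.hom_mult cls.hom_inv E.wdiag_closed WE.H.inv_closed E.inv_closed flip: E.inv_wdiag)
  then have "cls ?dy = cls (wdiag EG n 1 ?y)"
    using dxy xy by (metis WQ.inv_closed WQ.inv_equality WQ.inv_inv cls.hom_closed E.wdiag_closed)
  then have Phi_xy: "Phi s = cls (wdiag EG n 1 (?x \<otimes>\<^bsub>EG\<^esub> ?y))"
    unfolding Phi using dxy xy by (simp only: cls.hom_mult E.wdiag_closed flip: E.wdiag_mult)
  have "snd (?x \<otimes>\<^bsub>EG\<^esub> ?y) = \<one>" using xy snd by simp
  then obtain \<alpha> where \<alpha>: "\<alpha> \<in> carrier bar2_mod" "?x \<otimes>\<^bsub>EG\<^esub> ?y = U.ext_in \<alpha>"
    using U.snd_eq_one_iff[OF E.m_closed[OF xy]] by blast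
  then obtain c where c: "c \<in> carrier (bar 2)" "\<alpha> = bar2_cls c"
    unfolding carrier_bar2_mod by blast
  have "Phi s = bar2_emb c" unfolding bar2_emb_def Phi_xy \<alpha>(2) c(2) ..
  moreover have "bd 2 c = 0"
  proof -
    have "bd 2 c = ext_del (U.ext_in \<alpha>)" using c \<alpha> by (simp only: ext_del_in bd2_mod_cls)
    also have "\<dots> = ext_del ?x + ext_del ?y" using xy by (simp only: ext_del_mult flip: \<alpha>(2))
    also have "\<dots> = 0" by (rule ext_del_lift_prods[OF as(1)])
    finally show ?thesis .
  qed
  ultimately show ?thesis using c by blast
qed

text \<open>The determinant of the matrix with this central entry is the boundary of
  \<open>c\<close>. For a cycle it is 0, so the matrix is a product of symbols and comes from
  \<open>S\<^sub>n(G)\<close>.\<close>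

lemma bar2_emb_subset:
  assumes c: "c \<in> carrier (bar 2)" and bd: "bd 2 c = 0"
  shows "\<exists>s \<in> carrier SG. mu s = \<one>\<^bsub>WG\<^esub> \<and> Phi s = bar2_emb c"
proof -
  let ?\<gamma> = "U.ext_in (bar2_cls c)"
  have \<gamma>: "?\<gamma> \<in> carrier EG" by (rule U.ext_in_closed[OF bar2_cls_closed[OF c]])
  have "det_E (wdiag EG n 1 ?\<gamma>) = bd 2 c"
    unfolding det_wdiag ext_del_in[OF bar2_cls_closed[OF c]] by (rule bd2_mod_cls[OF c])
  then have "wdiag EG n 1 ?\<gamma> \<in> TE" using \<gamma> bd by (intro kernel_det_E) auto
  from TE_to_SG[OF this] obtain s where s: "s \<in> carrier SG" "Phi s = cls (wdiag EG n 1 ?\<gamma>)"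
    "mu s = wproj (wdiag EG n 1 ?\<gamma>)" by blast
  have "wproj (wdiag EG n 1 ?\<gamma>) = wdiag G n 1 \<one>"
    unfolding wproj_wdiag[OF \<gamma>] by (simp add: U.ext_in_def)
  then have "mu s = \<one>\<^bsub>WG\<^esub>" using s(3) by (simp add: wdiag_one)
  then show ?thesis using s unfolding bar2_emb_def by blast
qed

text \<open>The kernel embeds through \<open>Phi\<close>, and its image is also the image of the
  2-cycles under \<open>bar2_emb\<close>, which are mapped with kernel the boundaries.\<close>

theorem kernel_iso: "kernel_group SG WG mu \<cong> group_homology G 2"
proof -
  define N where "N = kernel SG WG mu"
  define Z where "Z = kernel (bar 2) (bar 1) (bd 2)"
  let ?N = "SG\<lparr>carrier := N\<rparr>" and ?Z = "bar 2\<lparr>carrier := Z\<rparr>"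
  have N: "subgroup N SG" unfolding N_def by (rule mu.subgroup_kernel)
  interpret C2: comm_group "bar 2" by (rule comm_group_bar)
  interpret C1: comm_group "bar 1" by (rule comm_group_bar)
  interpret bd: group_hom "bar 2" "bar 1" "bd 2"
    using bd_2_hom by (simp only: group_hom_def group_hom_axioms_def C1.group_axioms C2.group_axioms simp_thms)
  have Z: "subgroup Z (bar 2)" unfolding Z_def by (rule bd.subgroup_kernel)
  have Z_iff: "c \<in> Z \<longleftrightarrow> c \<in> carrier (bar 2) \<and> bd 2 c = 0" for c
    by (simp add: Z_def kernel_def)
  have N_iff: "s \<in> N \<longleftrightarrow> s \<in> carrier SG \<and> mu s = \<one>\<^bsub>WG\<^esub>" for s
    by (simp add: N_def kernel_def)
  have image: "bar2_emb ` Z = Phi ` N"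
  proof (intro subset_antisym subsetI)
    fix x assume "x \<in> bar2_emb ` Z"
    then show "x \<in> Phi ` N" using bar2_emb_subset unfolding image_iff Z_iff N_iff Bex_def by metis
  next
    fix x assume "x \<in> Phi ` N"
    then show "x \<in> bar2_emb ` Z" using Phi_kernel_subset unfolding image_iff Z_iff N_iff Bex_def by metis
  qed
  have PN: "subgroup (Phi ` N) WQ" by (rule Phi.subgroup_img_is_subgroup[OF N])
  let ?P = "WQ\<lparr>carrier := Phi ` N\<rparr>"
  have gP: "group ?P" by (rule WQ.subgroup_imp_group[OF PN])
  have gN: "group ?N" by (rule S.S.subgroup_imp_group[OF N])
  have gZ: "group ?Z" by (rule C2.subgroup_imp_group[OF Z])
  have N_carrier: "N \<subseteq> carrier SG" by (rule subgroup.subset[OF N])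
  have "Phi \<in> iso ?N ?P"
  proof (rule isoI)
    show "Phi \<in> hom ?N ?P"
      using N_carrier by (intro homI) (auto simp: subset_iff simp del: Coset.mult_FactGroup)
    have "inj_on Phi (carrier SG)"
      using Phi.inj_on_one_iff Phi_injective by blast
    then show "bij_betw Phi (carrier ?N) (carrier ?P)"
      using N_carrier by (auto simp: bij_betw_def intro: inj_on_subset)
  qed
  then have 1: "?N \<cong> ?P" by (auto simp: is_iso_def)
  have Z_carrier: "Z \<subseteq> carrier (bar 2)" by (rule subgroup.subset[OF Z])
  have "bar2_emb \<in> hom ?Z ?P"
  proof (rule homI)
    show "bar2_emb x \<in> carrier ?P" if "x \<in> carrier ?Z" for x using that image by auto
    show "bar2_emb (x \<otimes>\<^bsub>?Z\<^esub> y) = bar2_emb x \<otimes>\<^bsub>?P\<^esub> bar2_emb y" if "x \<in> carrier ?Z" "y \<in> carrier ?Z" for x y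
      using that hom_mult[OF bar2_emb_hom, of x y] Z_carrier by (auto simp del: Coset.mult_FactGroup bar_simps)
  qed
  then interpret J: group_hom ?Z ?P bar2_emb
    using gZ gP by (simp add: group_hom_def group_hom_axioms_def)
  have "bdry 2 \<subseteq> Z"
    using bd_3_closed bd_2_bd_3 by (auto simp: bdry_def Z_iff simp del: bar_simps)
  then have kernel: "kernel ?Z ?P bar2_emb = bdry 2"
    using bar2_emb_eq_one_iff Z_carrier by (auto simp: kernel_def simp del: bar_simps one_FactGroup)
  have "?Z Mod kernel ?Z ?P bar2_emb \<cong> ?P"
    by (rule J.FactGroup_iso) (simp add: image)
  then have "?Z Mod bdry 2 \<cong> ?P" by (simp only: kernel)
  moreover have "group_homology G 2 = ?Z Mod bdry 2"
    by (simp add: group_homology_def kernel_group_def Z_def bdry_def)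
  moreover have "group (?Z Mod bdry 2)"
    using normal.factorgroup_is_group[OF J.normal_kernel] by (simp only: kernel)
  ultimately have "?P \<cong> group_homology G 2" by (simp add: group.iso_sym)
  then have "?N \<cong> group_homology G 2" using 1 iso_trans by blast
  then show ?thesis by (simp add: kernel_group_def N_def)
qed

section \<open>The cokernel and the first homology group\<close>

definition bar1_cls :: "('a list \<Rightarrow>\<^sub>0 int) \<Rightarrow> ('a list \<Rightarrow>\<^sub>0 int) set"
  where "bar1_cls c = bdry 1 #>\<^bsub>bar 1\<^esub> c"

abbreviation H1 where "H1 \<equiv> bar 1 Mod bdry 1"

lemma normal_bdry_1: "bdry 1 \<lhd> bar 1"
  by (rule comm_group.subgroup_imp_normal[OF comm_group_bar subgroup_bdry_1])

lemma group_H1: "group H1"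
  by (rule normal.factorgroup_is_group[OF normal_bdry_1])

lemma bar1_cls_hom: "bar1_cls \<in> hom (bar 1) H1"
  unfolding bar1_cls_def by (rule normal.r_coset_hom_Mod[OF normal_bdry_1])

lemma bar1_cls_add: "c \<in> carrier (bar 1) \<Longrightarrow> c' \<in> carrier (bar 1) \<Longrightarrow>
    bar1_cls (c + c') = bar1_cls c \<otimes>\<^bsub>H1\<^esub> bar1_cls c'"
  using hom_mult[OF bar1_cls_hom] by (simp del: Coset.mult_FactGroup)

lemma bar1_cls_eq_one_iff:
  assumes c: "c \<in> carrier (bar 1)"
  shows "bar1_cls c = \<one>\<^bsub>H1\<^esub> \<longleftrightarrow> c \<in> bdry 1"
proof -
  interpret C1: comm_group "bar 1" by (rule comm_group_bar)
  show ?thesis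
    using C1.coset_join1[OF _ c subgroup_bdry_1] C1.coset_join2[OF c subgroup_bdry_1]
    unfolding bar1_cls_def one_FactGroup by blast
qed

lemma bdry_1_iff: "c \<in> bdry 1 \<longleftrightarrow> (\<exists>b \<in> carrier (bar 2). c = bd 2 b)"
  by (auto simp: bdry_def numeral_2_eq_2 simp del: bar_simps)

lemma bar1_cls_add_bdry:
  assumes "b \<in> bdry 1" "c \<in> carrier (bar 1)"
  shows "bar1_cls (b + c) = bar1_cls c"
proof -
  interpret H1: group H1 by (rule group_H1)
  have b: "b \<in> carrier (bar 1)" by (rule subgroup.mem_carrier[OF subgroup_bdry_1 assms(1)])
  then have "bar1_cls (b + c) = \<one>\<^bsub>H1\<^esub> \<otimes>\<^bsub>H1\<^esub> bar1_cls c"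
    using bar1_cls_add[OF b assms(2)] assms(1) unfolding bar1_cls_eq_one_iff[OF b, symmetric] by (simp only:)
  then show ?thesis using hom_in_carrier[OF bar1_cls_hom assms(2)] by (simp only: H1.l_one)
qed

text \<open>The determinant for matrices over G. Entries multiply only up to boundaries, so it is a
  homomorphism only with values in \<open>H\<^sub>1\<close>.\<close>

definition wclass :: "(nat \<Rightarrow> 'a) \<times> (nat \<Rightarrow> nat) \<Rightarrow> ('a list \<Rightarrow>\<^sub>0 int) set"
  where "wclass w = bar1_cls (\<Sum>i=1..n. frag_of [fst w i])"

lemma bar_sum_closed: "(\<And>i. i \<in> I \<Longrightarrow> f i \<in> carrier (bar k)) \<Longrightarrow> sum f I \<in> carrier (bar k)"
  unfolding bar_chain_group_def by (rule sum_closed_free_Abelian_group)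

lemma bdry_1_sum: "finite I \<Longrightarrow> (\<And>i. i \<in> I \<Longrightarrow> f i \<in> bdry 1) \<Longrightarrow> sum f I \<in> bdry 1"
proof (induction I rule: finite_induct)
  case empty
  show ?case using subgroup.one_closed[OF subgroup_bdry_1] by simp
next
  case (insert x F)
  then show ?case using subgroup.m_closed[OF subgroup_bdry_1] by simp
qed

text \<open>The determinant over the extension adds to the sum of the [g] only values of
  \<open>bd2_mod\<close>, which are boundaries.\<close>

lemma wclass_wproj:
  assumes "w \<in> carrier WE"
  shows "wclass (wproj w) = bar1_cls (det_E w)"
proof -
  obtain g \<sigma> where w: "w = (g, \<sigma>)" "\<And>i. i \<in> {1..n} \<Longrightarrow> g i \<in> carrier EG"
    using E.wreath_cases[OF assms] by metis
  have mod: "bd2_mod (fst (g i)) \<in> bdry 1" if "i \<in> {1..n}" for i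
  proof -
    have "fst (g i) \<in> carrier bar2_mod" using w(2)[OF that] by (auto simp: U.carrier_ext)
    then obtain c where "c \<in> carrier (bar 2)" "fst (g i) = bar2_cls c" unfolding carrier_bar2_mod by blast
    then show ?thesis using bd2_mod_cls bdry_1_iff by auto
  qed
  have fr: "frag_of [snd (g i)] \<in> carrier (bar 1)" if "i \<in> {1..n}" for i
    using sndE.hom_closed[OF w(2)[OF that]] by simp
  have "det_E w = (\<Sum>i=1..n. bd2_mod (fst (g i))) + (\<Sum>i=1..n. frag_of [snd (g i)])"
    by (simp add: E.wdet_def w(1) ext_del_def sum.distrib)
  also have "bar1_cls \<dots> = bar1_cls (\<Sum>i=1..n. frag_of [snd (g i)])"
    by (rule bar1_cls_add_bdry[OF bdry_1_sum bar_sum_closed]) (use mod fr in auto)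
  also have "\<dots> = wclass (wproj w)"
    unfolding wclass_def
    by (intro arg_cong[of _ _ bar1_cls] sum.cong[OF HOL.refl]) (simp add: wproj_def w(1))
  finally show ?thesis by simp
qed

lemma wproj_lift:
  assumes "w \<in> carrier WG"
  obtains w' where "w' \<in> carrier WE" "wproj w' = w"
proof -
  obtain g \<sigma> where w: "w = (g, \<sigma>)" "g \<in> {1..n} \<rightarrow>\<^sub>E carrier G" "\<sigma> permutes {1..n}"
    using wreath_cases[OF assms] by metis
  let ?w = "(\<lambda>i\<in>{1..n}. U.ext_lift (g i), \<sigma>)"
  have "?w \<in> carrier WE" using w by (auto simp: carrier_wreath PiE_iff)
  moreover have "wproj ?w = w" using w by (auto simp: wproj_def U.ext_lift_def PiE_iff extensional_def fun_eq_iff)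
  ultimately show thesis by (rule that)
qed

lemma det_E_closed: "w \<in> carrier WE \<Longrightarrow> det_E w \<in> carrier (bar 1)"
  unfolding E.wdet_def
  by (rule bar_sum_closed, rule hom_in_carrier[OF ext_del_hom]) (auto simp: carrier_wreath PiE_iff)

lemma det_E_mult: "w \<in> carrier WE \<Longrightarrow> w' \<in> carrier WE \<Longrightarrow> det_E (w \<otimes>\<^bsub>WE\<^esub> w') = det_E w + det_E w'"
  by (rule E.wdet_mult[OF ext_del_mult])

text \<open>Multiplicativity is inherited from the determinant over the extension, as every matrix
  over G can be lifted entrywise.\<close>

lemma wclass_hom: "wclass \<in> hom WG H1"
proof (rule homI)
  fix w assume "w \<in> carrier WG"
  then obtain v where v: "v \<in> carrier WE" "wproj v = w" using wproj_lift by blast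
  then have "bar1_cls (det_E v) \<in> carrier H1" by (intro hom_in_carrier[OF bar1_cls_hom] det_E_closed)
  then show "wclass w \<in> carrier H1" using wclass_wproj[OF v(1)] v(2) by simp
next
  fix w w' assume "w \<in> carrier WG" "w' \<in> carrier WG"
  then obtain v v' where v: "v \<in> carrier WE" "wproj v = w" "v' \<in> carrier WE" "wproj v' = w'"
    using wproj_lift by metis
  have "wclass (w \<otimes>\<^bsub>WG\<^esub> w') = wclass (wproj (v \<otimes>\<^bsub>WE\<^esub> v'))"
    using v by simp
  also have "\<dots> = bar1_cls (det_E (v \<otimes>\<^bsub>WE\<^esub> v'))"
    using v by (intro wclass_wproj) simp
  also have "\<dots> = bar1_cls (det_E v) \<otimes>\<^bsub>H1\<^esub> bar1_cls (det_E v')"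
    using v by (simp only: det_E_mult bar1_cls_add det_E_closed)
  also have "\<dots> = wclass w \<otimes>\<^bsub>H1\<^esub> wclass w'"
    using wclass_wproj[OF v(1)] wclass_wproj[OF v(3)] v by (simp only:)
  finally show "wclass (w \<otimes>\<^bsub>WG\<^esub> w') = wclass w \<otimes>\<^bsub>H1\<^esub> wclass w'" .
qed

text \<open>If the class vanishes, a lift of \<open>w\<close> has a boundary as determinant. A
  central entry removes that boundary without changing the projection, and a matrix of determinant 0
  comes from \<open>S\<^sub>n(G)\<close>.\<close>

lemma wclass_eq_one_iff:
  assumes w: "w \<in> carrier WG"
  shows "wclass w = \<one>\<^bsub>H1\<^esub> \<longleftrightarrow> w \<in> mu ` carrier SG"
proof
  assume "w \<in> mu ` carrier SG"
  then obtain s where s: "s \<in> carrier SG" "w = mu s" by blast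
  then obtain t where t: "t \<in> TE" "mu s = wproj t" using SG_to_TE by blast
  have "det_E t = 0" using ext_del_mult t(1) by (rule E.wdet_wsym_group)
  then have "wclass w = bar1_cls 0"
    using wclass_wproj[OF TE_carrier[OF t(1)]] s(2) t(2) by simp
  moreover have "0 \<in> bdry 1" using subgroup.one_closed[OF subgroup_bdry_1] by simp
  ultimately show "wclass w = \<one>\<^bsub>H1\<^esub>" using bar1_cls_eq_one_iff[of 0] by simp
next
  assume one: "wclass w = \<one>\<^bsub>H1\<^esub>"
  obtain v where v: "v \<in> carrier WE" "wproj v = w" using wproj_lift[OF w] .
  then have "bar1_cls (det_E v) = \<one>\<^bsub>H1\<^esub>" using wclass_wproj[OF v(1)] one by simp
  then obtain b where b: "b \<in> carrier (bar 2)" "det_E v = bd 2 b"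
    using bar1_cls_eq_one_iff[OF det_E_closed[OF v(1)]] bdry_1_iff by blast
  \<comment> \<open>This entry lies over 1 and has determinant minus \<open>bd 2 b\<close>.\<close>
  let ?\<gamma> = "inv\<^bsub>EG\<^esub> U.ext_in (bar2_cls b)"
  have in_b: "U.ext_in (bar2_cls b) \<in> carrier EG" by (rule U.ext_in_closed[OF bar2_cls_closed[OF b(1)]])
  have "ext_del (U.ext_in (bar2_cls b)) = bd 2 b"
    using ext_del_in[OF bar2_cls_closed[OF b(1)]] bd2_mod_cls[OF b(1)] by simp
  then have "bd 2 b + ext_del ?\<gamma> = 0"
    using ext_del_mult[OF in_b E.inv_closed[OF in_b]] in_b by (simp add: ext_del_one)
  then have "det_E (v \<otimes>\<^bsub>WE\<^esub> wdiag EG n 1 ?\<gamma>) = 0"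
    using v in_b b(2) by (simp only: det_E_mult det_wdiag E.wdiag_closed E.inv_closed)
  then have "v \<otimes>\<^bsub>WE\<^esub> wdiag EG n 1 ?\<gamma> \<in> TE" using v in_b by (intro kernel_det_E) auto
  then obtain s where s: "s \<in> carrier SG" "mu s = wproj (v \<otimes>\<^bsub>WE\<^esub> wdiag EG n 1 ?\<gamma>)" using TE_to_SG by blast
  have "snd ?\<gamma> = \<one>" using in_b by (simp add: U.ext_in_def)
  then have "wproj (wdiag EG n 1 ?\<gamma>) = \<one>\<^bsub>WG\<^esub>"
    unfolding wproj_wdiag[OF E.inv_closed[OF in_b]] by (simp only: wdiag_one)
  then have "wproj (v \<otimes>\<^bsub>WE\<^esub> wdiag EG n 1 ?\<gamma>) = w"
    using v in_b w by simp
  then show "w \<in> mu ` carrier SG" using s by (metis imageI)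
qed

lemma wclass_surj: "wclass ` carrier WG = carrier H1"
proof
  interpret H1: group H1 by (rule group_H1)
  interpret c: group_hom WG H1 wclass
    using wclass_hom by (simp only: group_hom_def group_hom_axioms_def W.H.group_axioms H1.group_axioms simp_thms)
  show "wclass ` carrier WG \<subseteq> carrier H1" using c.hom_closed by blast
  have sub: "subgroup (wclass ` carrier WG) H1" by (rule c.img_is_subgroup)
  have "bar1_cls x \<in> wclass ` carrier WG" if "x \<in> carrier (bar 1)" for x
    using that
  proof (induction x rule: bar_1_induct)
    case zero
    have "bar1_cls 0 = \<one>\<^bsub>H1\<^esub>"
      using bar1_cls_eq_one_iff[of 0] subgroup.one_closed[OF subgroup_bdry_1] by simp
    then show ?case using subgroup.one_closed[OF sub] by simp
  next
    case (diff x y)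
    have "bar1_cls (x - y) \<otimes>\<^bsub>H1\<^esub> bar1_cls y = bar1_cls x"
      using diff bar1_cls_add[OF bar_diff_closed[OF diff(1,2)] diff(2)] by simp
    then have "bar1_cls (x - y) = bar1_cls x \<otimes>\<^bsub>H1\<^esub> inv\<^bsub>H1\<^esub> bar1_cls y"
      using hom_in_carrier[OF bar1_cls_hom] diff(1,2) bar_diff_closed[OF diff(1,2)]
      by (metis H1.inv_solve_right)
    then show ?case
      using subgroup.m_closed[OF sub diff(3) subgroup.m_inv_closed[OF sub diff(4)]] by simp
  next
    case (frag a)
    have one: "(1::nat) \<in> {1..n}" using three_le by auto
    \<comment> \<open>An entry a in position 1 realises the generator [a] of the 1-chains.\<close>
    let ?w = "wdiag EG n 1 (U.ext_lift a)"
    have w: "?w \<in> carrier WE" using frag by simp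
    have "wclass (wproj ?w) = bar1_cls (frag_of [a])"
      unfolding wclass_wproj[OF w] det_wdiag ext_del_lift ..
    then show ?case using wproj.hom_closed[OF w] by (metis imageI)
  qed
  then show "carrier H1 \<subseteq> wclass ` carrier WG"
    by (auto simp: carrier_FactGroup bar1_cls_def simp del: bar_simps)
qed

theorem cokernel_iso: "cokernel_group SG WG mu \<cong> group_homology G 1"
proof -
  interpret H1: group H1 by (rule group_H1)
  interpret c: group_hom WG H1 wclass
    using wclass_hom by (simp only: group_hom_def group_hom_axioms_def W.H.group_axioms H1.group_axioms simp_thms)
  have "kernel WG H1 wclass = mu ` carrier SG"
    using wclass_eq_one_iff mu.hom_closed unfolding kernel_def by blast
  then have "WG Mod (mu ` carrier SG) \<cong> H1"
    using c.FactGroup_iso[OF wclass_surj] by simp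
  \<comment> \<open>With trivial coefficients the two faces of [a] coincide, so every 1-chain is a
    cycle.\<close>
  moreover have "kernel (bar 1) (bar 0) (bd 1) = carrier (bar 1)"
    using bd_1 by (auto simp: kernel_def simp del: bar_simps(1))
  then have "group_homology G 1 = H1"
    by (simp add: group_homology_def kernel_group_def bdry_def)
  ultimately show ?thesis by (simp add: cokernel_group_def)
qed

end

theorem theorem1:
  fixes G :: "('a, 'b) monoid_scheme" and n :: nat
  assumes "group G" and "n \<ge> 3"
  shows "\<exists>\<mu>. (\<exists>act. crossed_module (Sn_group G n) (wreath_product G n) \<mu> act)
    \<and> cokernel_group (Sn_group G n) (wreath_product G n) \<mu> \<cong> group_homology G 1
    \<and> kernel_group (Sn_group G n) (wreath_product G n) \<mu> \<cong> group_homology G 2"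
proof -
  interpret Sn_setting G n
    using assms by (simp add: Sn_setting_def Sn_setting_axioms_def)
  show ?thesis
    using crossed_module_mu cokernel_iso kernel_iso by blast
qed

end
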